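(* The Delay Minimization Problem (DMP) is NP-hard, even when restricted to instances in which every vertex has delay $1$ (the uniform model). In particular it is NP-hard in the general model, where vertex delays are arbitrary.
   Context: A network is a finite, connected undirected graph $G=(V,E,L)$ where $L:V\to\mathbb{R}_{>0}$ assigns to each vertex $v$ a delay $l(v)$. The length (delay) of a path $(v_s,v_1,\dots,v_r,v_t)$ from $v_s$ to $v_t$ is $l(v_s)+\sum_{i=1}^r l(v_i)$, i.e. the sum of the delays of its vertices, excluding the destination. $d(s,t)$ denotes the minimum length of a path from $s$ to $t$, with $d(s,s)=0$. For $T\subseteq V$, $d(s,t|T)$ denotes the shortest path length from $s$ to $t$ after the delays of all vertices in $T$ are set to $0$ (other delays unchanged). Delay Minimization Problem (DMP): given a network $G=(V,E,L)$ and a budget $k$, find $T\subseteq V$ with $|T|=k$ minimizing $\sum_{s,t\in V} d(s,t|T)$ (sum over ordered pairs). NP-hardness refers to the associated decision problem: given $G$, $k$ and a number $X$, decide whether there is $T\subseteq V$ with $|T|=k$ and $\sum_{s,t\in V} d(s,t|T)\le X$. *)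

theory Defs
  imports
    Complex_Main
    "HOL-Computational_Algebra.Polynomial"
    "Graph_Theory.Graph_Theory"
begin

section \<open>Networks and delays\<close>

text \<open>
  Undirected graphs are the symmetric loop-free digraphs of the Graph\_Theory entry, so an
  undirected edge is a pair of opposite arcs, and a path is a list of arcs that visits no vertex
  twice (apath).
\<close>

definition network :: "'a pair_pre_digraph \<Rightarrow> ('a \<Rightarrow> real) \<Rightarrow> bool" where
  "network G l \<longleftrightarrow>
     pair_graph G \<and> Digraph_Component.connected (with_proj G) \<and> (\<forall>v\<in>pverts G. 0 < l v)"

text \<open>The tails of the arcs of a path are its vertices with the destination left out.\<close>

definition path_delay :: "('a \<Rightarrow> real) \<Rightarrow> ('a \<times> 'a) awalk \<Rightarrow> real" where
  "path_delay l p = (\<Sum>a\<leftarrow>p. l (fst a))"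

text \<open>
  The only path from a vertex to itself is the empty list of arcs, of delay 0.  The minimum is
  over a finite set, which is nonempty if the graph is connected and contains both vertices.
\<close>

definition delay_dist :: "'a pair_pre_digraph \<Rightarrow> ('a \<Rightarrow> real) \<Rightarrow> 'a \<Rightarrow> 'a \<Rightarrow> real" where
  "delay_dist G l s t = Min {path_delay l p | p. pre_digraph.apath (with_proj G) s p t}"

definition zero_delays :: "'a set \<Rightarrow> ('a \<Rightarrow> real) \<Rightarrow> 'a \<Rightarrow> real" where
  "zero_delays T l = (\<lambda>v. if v \<in> T then 0 else l v)"

definition total_delay :: "'a pair_pre_digraph \<Rightarrow> ('a \<Rightarrow> real) \<Rightarrow> 'a set \<Rightarrow> real" where
  "total_delay G l T = (\<Sum>s\<in>pverts G. \<Sum>t\<in>pverts G. delay_dist G (zero_delays T l) s t)"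

definition dmp_decision :: "'a pair_pre_digraph \<Rightarrow> ('a \<Rightarrow> real) \<Rightarrow> nat \<Rightarrow> real \<Rightarrow> bool" where
  "dmp_decision G l k X \<longleftrightarrow> (\<exists>T\<subseteq>pverts G. card T = k \<and> total_delay G l T \<le> X)"

section \<open>Binary encoding of instances\<close>

text \<open>
  To be part of the input of a machine, the delays and the bound are rational and the vertices
  are numbered from 0.
\<close>

record dmp_instance =
  graph :: "nat pair_pre_digraph"
  delays :: "nat \<Rightarrow> rat"
  budget :: nat
  bound :: rat

definition real_delays :: "dmp_instance \<Rightarrow> nat \<Rightarrow> real" where
  "real_delays I v = of_rat (delays I v)"

definition valid_instance :: "dmp_instance \<Rightarrow> bool" where
  "valid_instance I \<longleftrightarrow>
     (\<exists>n. pverts (graph I) = {..<n}) \<and> network (graph I) (real_delays I)"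

definition uniform_instance :: "dmp_instance \<Rightarrow> bool" where
  "uniform_instance I \<longleftrightarrow> valid_instance I \<and> (\<forall>v\<in>pverts (graph I). delays I v = 1)"

definition yes_instance :: "dmp_instance \<Rightarrow> bool" where
  "yes_instance I \<longleftrightarrow>
     valid_instance I \<and>
     dmp_decision (graph I) (real_delays I) (budget I) (of_rat (bound I))"

text \<open>Least significant bit first, without leading zeros.\<close>

fun binary :: "nat \<Rightarrow> bool list" where
  "binary n = (if n = 0 then [] else odd n # binary (n div 2))"

declare binary.simps [simp del]

text \<open>
  Numbers are self-delimiting: each digit is preceded by True, and False marks the end.
\<close>

definition enc_nat :: "nat \<Rightarrow> bool list" where
  "enc_nat n = concat (map (\<lambda>b. [True, b]) (binary n)) @ [False]"

definition enc_rat :: "rat \<Rightarrow> bool list" where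
  "enc_rat r = (case quotient_of r of (a, b) \<Rightarrow>
     (a < 0) # enc_nat (nat \<bar>a\<bar>) @ enc_nat (nat b))"

text \<open>Order of the graph, adjacency matrix row by row, delays, budget, bound.\<close>

definition enc_instance :: "dmp_instance \<Rightarrow> bool list" where
  "enc_instance I = (let n = card (pverts (graph I)) in
     enc_nat n @
     concat (map (\<lambda>i. map (\<lambda>j. (i, j) \<in> parcs (graph I)) [0..<n]) [0..<n]) @
     concat (map (\<lambda>v. enc_rat (delays I v)) [0..<n]) @
     enc_nat (budget I) @ enc_rat (bound I))"

definition DMP :: "bool list set" where
  "DMP = {enc_instance I | I. yes_instance I}"

definition uniform_model :: "bool list set" where
  "uniform_model = {enc_instance I | I. uniform_instance I}"

lemma binary_inj: "binary m = binary n \<Longrightarrow> m = n"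
proof (induction m arbitrary: n rule: binary.induct)
  case (1 m)
  show ?case
  proof (cases "m = 0 \<or> n = 0")
    case True
    then show ?thesis using 1(2) binary.simps[of m] binary.simps[of n] by (auto split: if_splits)
  next
    case False
    then have "odd m = odd n" "binary (m div 2) = binary (n div 2)"
      using 1(2) binary.simps[of m] binary.simps[of n] by auto
    with 1(1)[of "n div 2"] False have "m div 2 = n div 2" "odd m = odd n" by auto
    then show ?thesis by presburger
  qed
qed

lemma enc_digits_append:
  "concat (map (\<lambda>b. [True, b]) ds) @ False # xs = concat (map (\<lambda>b. [True, b]) es) @ False # ys
   \<Longrightarrow> ds = es \<and> xs = ys"
proof (induction ds arbitrary: es)
  case Nil
  then show ?case by (cases es) auto
next
  case (Cons d ds)
  then show ?case by (cases es) auto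
qed

lemma enc_nat_append [simp]: "enc_nat m @ xs = enc_nat n @ ys \<longleftrightarrow> m = n \<and> xs = ys"
  using enc_digits_append[of "binary m" xs "binary n" ys] binary_inj[of m n]
  by (auto simp: enc_nat_def)

lemma enc_rat_append [simp]: "enc_rat q @ xs = enc_rat r @ ys \<longleftrightarrow> q = r \<and> xs = ys"
proof
  assume eq: "enc_rat q @ xs = enc_rat r @ ys"
  obtain a b where q: "quotient_of q = (a, b)" by fastforce
  obtain c d where r: "quotient_of r = (c, d)" by fastforce
  have "b > 0" "d > 0" using q r quotient_of_denom_pos by auto
  with eq q r have "a < 0 \<longleftrightarrow> c < 0" "nat \<bar>a\<bar> = nat \<bar>c\<bar>" "b = d" "xs = ys"
    by (auto simp: enc_rat_def)
  then have "a = c" "b = d" "xs = ys" by linarith+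
  then show "q = r \<and> xs = ys" using q r by (metis quotient_of_inject)
qed auto

lemma enc_rats_append:
  "concat (map (\<lambda>v. enc_rat (f v)) vs) @ xs = concat (map (\<lambda>v. enc_rat (g v)) vs) @ ys
   \<longleftrightarrow> (\<forall>v\<in>set vs. f v = g v) \<and> xs = ys"
  by (induction vs) auto

lemma matrix_append:
  "concat (map (\<lambda>i. map (P i) js) is) @ xs = concat (map (\<lambda>i. map (Q i) js) is) @ ys
   \<longleftrightarrow> (\<forall>i\<in>set is. \<forall>j\<in>set js. P i j = Q i j) \<and> xs = ys"
  by (induction "is") auto

lemma enc_instance_eq:
  assumes I: "valid_instance I" and J: "valid_instance J" and eq: "enc_instance I = enc_instance J"
  shows "graph I = graph J" "\<forall>v\<in>pverts (graph I). delays I v = delays J v"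
    "budget I = budget J" "bound I = bound J"
proof -
  obtain n where n: "pverts (graph I) = {..<n}" using I by (auto simp: valid_instance_def)
  obtain m where m: "pverts (graph J) = {..<m}" using J by (auto simp: valid_instance_def)
  have "m = n" using eq n m by (simp add: enc_instance_def Let_def)
  have eq': "(\<forall>i<n. \<forall>j<n. ((i, j) \<in> parcs (graph I)) = ((i, j) \<in> parcs (graph J)))
      \<and> (\<forall>v<n. delays I v = delays J v) \<and> budget I = budget J
      \<and> enc_rat (bound I) @ [] = enc_rat (bound J) @ []"
    using eq n m \<open>m = n\<close>
    by (simp add: enc_instance_def Let_def enc_rats_append matrix_append atLeast0LessThan
        del: enc_rat_append)
  have "parcs (graph K) \<subseteq> pverts (graph K) \<times> pverts (graph K)" if "valid_instance K" for K
  proof -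
    have "pair_wf_digraph (graph K)"
      using that
      by (simp add: valid_instance_def network_def pair_graph_def pair_digraph_def
          pair_fin_digraph_def)
    then show ?thesis
      using pair_wf_digraph.in_arcsD1 pair_wf_digraph.in_arcsD2 by fast
  qed
  from this[OF I] this[OF J]
  have "parcs (graph I) \<subseteq> {..<n} \<times> {..<n}" "parcs (graph J) \<subseteq> {..<n} \<times> {..<n}"
    unfolding n m \<open>m = n\<close> .
  then have "a \<in> parcs (graph I) \<longleftrightarrow> a \<in> parcs (graph J)" for a
    using eq' by (cases a) blast
  then have "parcs (graph I) = parcs (graph J)" by blast
  then show "graph I = graph J" using n m \<open>m = n\<close> by simp
  show "\<forall>v\<in>pverts (graph I). delays I v = delays J v" using eq' n by auto
  show "budget I = budget J" using eq' by simp
  show "bound I = bound J" using eq' by (simp only: enc_rat_append)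
qed

lemma total_delay_cong:
  assumes "pair_graph G" "\<And>v. v \<in> pverts G \<Longrightarrow> l v = l' v"
  shows "total_delay G l T = total_delay G l' T"
proof -
  interpret pair_graph G by fact
  have l: "l (fst a) = l' (fst a)" if "apath s p t" "a \<in> set p" for s p t a
    using that by (intro assms(2) arc_fst_in_verts) (auto simp: apath_def awalk_def)
  have "path_delay (zero_delays T l) p = path_delay (zero_delays T l') p"
    if "apath s p t" for s p t
    unfolding path_delay_def zero_delays_def
    by (rule arg_cong[where f = sum_list], rule map_cong[OF refl]) (simp add: l[OF that])
  then have "{path_delay (zero_delays T l) p | p. apath s p t} =
      {path_delay (zero_delays T l') p | p. apath s p t}" for s t
    unfolding setcompr_eq_image by (intro image_cong) auto
  then show ?thesis by (simp add: total_delay_def delay_dist_def)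
qed

text \<open>Distinct instances have distinct codes, so the code of a valid instance determines the answer.\<close>

lemma enc_instance_in_DMP_iff:
  assumes "valid_instance I"
  shows "enc_instance I \<in> DMP \<longleftrightarrow> yes_instance I"
proof
  assume "enc_instance I \<in> DMP"
  then obtain J where J: "enc_instance I = enc_instance J" "yes_instance J"
    by (auto simp: DMP_def)
  then have v: "valid_instance J" by (simp add: yes_instance_def)
  note e = enc_instance_eq[OF assms v J(1)]
  have "pair_graph (graph I)" using assms by (simp add: valid_instance_def network_def)
  then have "total_delay (graph I) (real_delays I) T = total_delay (graph I) (real_delays J) T" for T
    by (rule total_delay_cong) (use e in \<open>auto simp: real_delays_def\<close>)
  then show "yes_instance I" using J(2) e assms
    by (simp add: yes_instance_def dmp_decision_def)
qed (auto simp: DMP_def)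

section \<open>Multi-tape Turing machines\<close>

text \<open>
  States and tape symbols are initial segments of the natural numbers.  Symbol 0 is the blank,
  and the bits False and True are the symbols 1 and 2.  Tapes are infinite in both directions.
  A transition maps the state and the list of symbols read to the new state and, for each
  tape, the symbol written and the head move.
\<close>

datatype move = MoveLeft | Stay | MoveRight

record tm =
  num_tapes :: nat
  num_symbols :: nat
  num_states :: nat
  start_state :: nat
  accept_state :: nat
  reject_state :: nat
  transition :: "nat \<Rightarrow> nat list \<Rightarrow> nat \<times> (nat \<times> move) list"

definition wf_tm :: "tm \<Rightarrow> bool" where
  "wf_tm M \<longleftrightarrow>
     1 \<le> num_tapes M \<and> 3 \<le> num_symbols M \<and>
     start_state M < num_states M \<and> accept_state M < num_states M \<and>
     reject_state M < num_states M \<and> accept_state M \<noteq> reject_state M \<and>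
     (\<forall>q rs. q < num_states M \<longrightarrow> length rs = num_tapes M \<longrightarrow> set rs \<subseteq> {..<num_symbols M} \<longrightarrow>
        (case transition M q rs of (q', ws) \<Rightarrow>
           q' < num_states M \<and> length ws = num_tapes M \<and> fst ` set ws \<subseteq> {..<num_symbols M}))"

type_synonym tape = "(int \<Rightarrow> nat) \<times> int"  \<comment> \<open>contents and head position\<close>
type_synonym config = "nat \<times> tape list"

fun act :: "nat \<times> move \<Rightarrow> tape \<Rightarrow> tape" where
  "act (s, m) (f, h) =
     (f(h := s), case m of MoveLeft \<Rightarrow> h - 1 | Stay \<Rightarrow> h | MoveRight \<Rightarrow> h + 1)"

fun step :: "tm \<Rightarrow> config \<Rightarrow> config" where
  "step M (q, ts) =
     (if q = accept_state M \<or> q = reject_state M then (q, ts)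
      else case transition M q (map (\<lambda>(f, h). f h) ts) of
        (q', ws) \<Rightarrow> (q', map2 act ws ts))"

text \<open>The word occupies the cells from 0 on, everything else is blank.\<close>

definition word_tape :: "bool list \<Rightarrow> int \<Rightarrow> nat" where
  "word_tape w i =
     (if 0 \<le> i \<and> i < int (length w) then (if w ! nat i then 2 else 1) else 0)"

text \<open>The inputs are on the first tapes, one each, and the other tapes are blank.\<close>

definition initial :: "tm \<Rightarrow> bool list list \<Rightarrow> config" where
  "initial M xs =
     (start_state M,
      map (\<lambda>i. (word_tape (if i < length xs then xs ! i else []), 0)) [0..<num_tapes M])"

definition run :: "tm \<Rightarrow> bool list list \<Rightarrow> nat \<Rightarrow> config" where
  "run M xs t = (step M ^^ t) (initial M xs)"

section \<open>Polynomial time and NP-hardness\<close>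

text \<open>
  Halting configurations are fixed by step, so a machine is in a halting state after the given
  number of steps iff it halts within that number of steps.  The output is on the last tape.
\<close>

definition polytime_computable :: "(bool list \<Rightarrow> bool list) \<Rightarrow> bool" where
  "polytime_computable f \<longleftrightarrow>
     (\<exists>M (p :: nat poly). wf_tm M \<and>
        (\<forall>x. case run M [x] (poly p (length x)) of (q, ts) \<Rightarrow>
           q = accept_state M \<and> fst (last ts) = word_tape (f x)))"

definition polytime_decidable2 :: "(bool list \<Rightarrow> bool list \<Rightarrow> bool) \<Rightarrow> bool" where
  "polytime_decidable2 R \<longleftrightarrow>
     (\<exists>M (p :: nat poly). wf_tm M \<and> 2 \<le> num_tapes M \<and>
        (\<forall>x y. fst (run M [x, y] (poly p (length x + length y))) =
           (if R x y then accept_state M else reject_state M)))"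

definition NP :: "bool list set set" where
  "NP = {A. \<exists>R (p :: nat poly). polytime_decidable2 R \<and>
     (\<forall>x. x \<in> A \<longleftrightarrow> (\<exists>y. length y \<le> poly p (length x) \<and> R x y))}"

definition poly_reduction :: "(bool list \<Rightarrow> bool list) \<Rightarrow> bool list set \<Rightarrow> bool list set \<Rightarrow> bool"
  where
  "poly_reduction f A B \<longleftrightarrow> polytime_computable f \<and> (\<forall>x. x \<in> A \<longleftrightarrow> f x \<in> B)"

definition NP_hard :: "bool list set \<Rightarrow> bool" where
  "NP_hard B \<longleftrightarrow> (\<forall>A\<in>NP. \<exists>f. poly_reduction f A B)"

text \<open>Hardness restricted to a set of instances: the reductions only produce such instances.\<close>

definition NP_hard_on :: "bool list set \<Rightarrow> bool list set \<Rightarrow> bool" where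
  "NP_hard_on S B \<longleftrightarrow> (\<forall>A\<in>NP. \<exists>f. poly_reduction f A B \<and> range f \<subseteq> S)"

end

theory Submission
  imports Defs
begin

text \<open>
  Let T have k vertices out of n.  A vertex outside T is at distance at least 1 from every other
  vertex, so the total delay is at least (n - k) (n - 1), with equality iff all pairs of distinct
  nonadjacent vertices are joined by a path through T, which holds iff T is essentially a connected
  dominating set.  Satisfiability reduces to this: make the 2 N literals a clique, join each of N
  variable vertices to its two literals and each clause to its literals, and take k = N.  Then T
  must pick one vertex per variable, hence an assignment, and it dominates the clauses iff the
  assignment satisfies them.

  The formula is the tableau of the verifier, with tape cells addressed relative to the heads.  Its
  clauses, literals and variables are numbered by a kind, a time and a position, and adjacency is a
  Boolean combination of comparisons of these numbers and of tests of input symbols.  Nested loops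
  over unary counters therefore print the instance in polynomial time; a counter is a tape whose
  head position is the value, so a Turing machine simulates each operation in one step.
\<close>

section \<open>Counter programs and their simulation\<close>

text \<open>Absolute head positions are unknown when the clauses are printed. In relative
  coordinates the scanned cells always sit in column \<open>H\<close>, so a transition clause
  involves only the state and one symbol per tape, and a move shifts a whole tape by one column. The
  price is an edge effect: a shift draws on a neighbouring column, so at time \<open>t\<close> only
  the columns \<open>p\<close> with \<open>t < p\<close> and \<open>p + t < 2 * H\<close> are under
  control. This is why the centre \<open>H\<close> and the final time \<open>H - 1\<close> are
  coupled. The certificate is left open by the formula: a model chooses it on tape 1 at time 0, and
  column \<open>E\<close> bounds its length. The transition clauses only force variables to be true,
  so a model may contain more than the trace of a run; excluding the rejecting state at the end is
  still conclusive, because the state of the trace is forced. The kinds of clauses and literals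
  depend on the machine alone and can be unrolled into the program text. Only times and positions
  grow with the input, and all of them are digits in the same base \<open>2 * H + 1\<close>.\<close>

datatype test = Pos "nat list" | Symb "nat list"

datatype com = Skip | Inc nat | Dec nat | MoveIn bool | Out bool
  | Seq com com | If test com com | While test com

type_synonym store = "(nat \<Rightarrow> nat) \<times> int \<times> bool list"

fun holds :: "test \<Rightarrow> (nat \<Rightarrow> bool) \<Rightarrow> nat \<Rightarrow> bool" where
  "holds (Pos rs) z a \<longleftrightarrow> (\<forall>r\<in>set rs. \<not> z r)"
| "holds (Symb as) z a \<longleftrightarrow> a \<in> set as"

datatype action = NoAct | IncA nat | DecA nat | InA bool | OutA bool

text \<open>Of the store it sees only the zero flags \<open>z\<close> and the scanned symbol
  \<open>a\<close>, which is what a machine reads in one step. \<open>Dec\<close> at zero yields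
  \<open>NoAct\<close>, so a head that represents a register stays on the nonnegative cells.\<close>

fun control :: "(nat \<Rightarrow> bool) \<Rightarrow> nat \<Rightarrow> com list \<Rightarrow> com list \<times> action" where
  "control z a [] = ([], NoAct)"
| "control z a (Skip # k) = (k, NoAct)"
| "control z a (Inc r # k) = (k, IncA r)"
| "control z a (Dec r # k) = (k, if z r then NoAct else DecA r)"
| "control z a (MoveIn b # k) = (k, InA b)"
| "control z a (Out b # k) = (k, OutA b)"
| "control z a (Seq c d # k) = (c # d # k, NoAct)"
| "control z a (If t c d # k) = ((if holds t z a then c else d) # k, NoAct)"
| "control z a (While t c # k) = (if holds t z a then c # While t c # k else k, NoAct)"

fun perform :: "action \<Rightarrow> store \<Rightarrow> store" where
  "perform NoAct s = s"
| "perform (IncA r) (\<rho>, h, out) = (\<rho>(r := Suc (\<rho> r)), h, out)"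
| "perform (DecA r) (\<rho>, h, out) = (\<rho>(r := \<rho> r - 1), h, out)"
| "perform (InA b) (\<rho>, h, out) = (\<rho>, if b then h + 1 else h - 1, out)"
| "perform (OutA b) (\<rho>, h, out) = (\<rho>, h, out @ [b])"

fun cstep :: "bool list \<Rightarrow> com list \<times> store \<Rightarrow> com list \<times> store" where
  "cstep w (k, \<rho>, h, out) =
     (case control (\<lambda>r. \<rho> r = 0) (word_tape w h) k of (k', a) \<Rightarrow> (k', perform a (\<rho>, h, out)))"

text \<open>Quantifying over the continuation makes runs of subprograms composable.\<close>

definition reaches :: "bool list \<Rightarrow> com \<Rightarrow> store \<Rightarrow> store \<Rightarrow> nat \<Rightarrow> bool" where
  "reaches w c s s' n \<longleftrightarrow> (\<exists>t\<le>n. \<forall>k. (cstep w ^^ t) (c # k, s) = (k, s'))"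

text \<open>The stacks that can occur while \<open>c\<close> runs above \<open>k\<close>. A loop
  puts itself back under its body, so the set is finite and its elements can serve as machine
  states.\<close>

fun conts :: "com \<Rightarrow> com list \<Rightarrow> com list set" where
  "conts (Seq c d) k = insert (Seq c d # k) (conts c (d # k) \<union> conts d k)"
| "conts (If t c d) k = insert (If t c d # k) (conts c k \<union> conts d k)"
| "conts (While t c) k = insert (While t c # k) (conts c (While t c # k))"
| "conts c k = {c # k}"

lemma finite_conts: "finite (conts c k)"
  by (induction c k rule: conts.induct) auto

lemma conts_self: "c # k \<in> conts c k"
  by (cases c) auto

lemma control_conts:
  "k' \<in> conts c k \<Longrightarrow> fst (control z a k') \<in> insert k (conts c k)"
proof (induction c k rule: conts.induct)
  case (1 c d k)
  then show ?case using conts_self[of c "d # k"] conts_self[of d k] by auto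
next
  case (2 t c d k)
  then show ?case using conts_self[of c k] conts_self[of d k] by auto
next
  case (3 t c k)
  then show ?case using conts_self[of c "While t c # k"] by (auto split: if_splits)
qed auto

fun treg :: "test \<Rightarrow> nat set" where
  "treg (Pos rs) = set rs"
| "treg (Symb as) = {}"

fun regs :: "com \<Rightarrow> nat set" where
  "regs (Inc r) = {r}"
| "regs (Dec r) = {r}"
| "regs (Seq c d) = regs c \<union> regs d"
| "regs (If t c d) = treg t \<union> regs c \<union> regs d"
| "regs (While t c) = treg t \<union> regs c"
| "regs c = {}"

lemma finite_regs: "finite (regs c)"
proof -
  have "finite (treg t)" for t by (cases t) auto
  then show ?thesis by (induction c) auto
qed

definition lregs :: "com list \<Rightarrow> nat set" where
  "lregs k = (\<Union>c\<in>set k. regs c)"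

lemma lregs_simps [simp]: "lregs [] = {}" "lregs (c # k) = regs c \<union> lregs k"
  by (auto simp: lregs_def)

lemma lregs_conts: "k' \<in> conts c k \<Longrightarrow> lregs k' \<subseteq> regs c \<union> lregs k"
  by (induction c k rule: conts.induct) auto

text \<open>The flags read off the tapes are correct only for registers that have a tape; these
  include all registers that the stack mentions.\<close>

lemma control_cong:
  assumes "\<And>r. r \<in> lregs k \<Longrightarrow> z r = z' r"
  shows "control z a k = control z' a k"
proof -
  have "holds t z a = holds t z' a" if "\<And>r. r \<in> treg t \<Longrightarrow> z r = z' r" for t
    using that by (cases t) auto
  then show ?thesis using assms by (cases "(z, a, k)" rule: control.cases) auto
qed

text \<open>
  Tape 0 is the input, tape r + 1 holds register r as its head position, with a mark in cell 0
  for the zero test, and the last tape is the output.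
\<close>

definition tapes_of :: "nat \<Rightarrow> bool list \<Rightarrow> store \<Rightarrow> tape list" where
  "tapes_of R w s = (case s of (\<rho>, h, out) \<Rightarrow>
     (word_tape w, h) # map (\<lambda>r. (\<lambda>i. if i = 0 then 1 else 0, int (\<rho> r))) [0..<R] @
     [(word_tape out, int (length out))])"

text \<open>Every tape is written in every step, so each one gets back the symbol it showed, except
  the output tape under \<open>OutA\<close>. Increments and decrements become head moves.\<close>

definition moves_of :: "nat \<Rightarrow> (nat \<Rightarrow> bool) \<Rightarrow> nat \<Rightarrow> action \<Rightarrow> (nat \<times> move) list" where
  "moves_of R z a ac =
     (a, case ac of InA b \<Rightarrow> if b then MoveRight else MoveLeft | _ \<Rightarrow> Stay) #
     map (\<lambda>r. (if z r then 1 else 0,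
       if ac = IncA r then MoveRight else if ac = DecA r then MoveLeft else Stay)) [0..<R] @
     [case ac of OutA b \<Rightarrow> (if b then 2 else 1, MoveRight) | _ \<Rightarrow> (0, Stay)]"

lemma word_tape_snoc:
  "(word_tape out)(int (length out) := if b then 2 else 1) = word_tape (out @ [b])"
  by (rule ext) (auto simp: word_tape_def nth_append nat_less_iff)

lemma word_tape_end: "word_tape out (int (length out)) = 0"
  by (simp add: word_tape_def)

text \<open>The premise rules out a decrement at zero, where \<open>perform\<close> truncates but
  the head would move to cell -1.\<close>

lemma map2_act_moves_of:
  assumes "\<And>r. ac = DecA r \<Longrightarrow> \<rho> r \<noteq> 0"
  shows "map2 act (moves_of R (\<lambda>r. \<rho> r = 0) (word_tape w h) ac) (tapes_of R w (\<rho>, h, out)) =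
     tapes_of R w (perform ac (\<rho>, h, out))"
proof -
  have upd: "(\<lambda>i. if i = 0 then 1 else 0)(int n := if n = 0 then 1 else 0) =
      (\<lambda>i::int. if i = 0 then 1 else (0::nat))" for n
    by (rule ext) auto
  obtain \<rho>' h' out' where p: "perform ac (\<rho>, h, out) = (\<rho>', h', out')"
    by (cases "perform ac (\<rho>, h, out)") auto
  have regs: "map2 act (map (\<lambda>r. (if \<rho> r = 0 then 1 else 0,
         if ac = IncA r then MoveRight else if ac = DecA r then MoveLeft else Stay)) [0..<R])
       (map (\<lambda>r. (\<lambda>i. if i = 0 then 1 else 0, int (\<rho> r))) [0..<R]) =
     map (\<lambda>r. (\<lambda>i. if i = 0 then 1 else 0, int (\<rho>' r))) [0..<R]"
  proof (rule nth_equalityI)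
    fix i
    assume "i < length (map2 act (map (\<lambda>r. (if \<rho> r = 0 then 1 else 0,
         if ac = IncA r then MoveRight else if ac = DecA r then MoveLeft else Stay)) [0..<R])
       (map (\<lambda>r. (\<lambda>i. if i = 0 then 1 else 0, int (\<rho> r))) [0..<R]))"
    then show "map2 act (map (\<lambda>r. (if \<rho> r = 0 then 1 else 0,
         if ac = IncA r then MoveRight else if ac = DecA r then MoveLeft else Stay)) [0..<R])
       (map (\<lambda>r. (\<lambda>i. if i = 0 then 1 else 0, int (\<rho> r))) [0..<R]) ! i =
      map (\<lambda>r. (\<lambda>i. if i = 0 then 1 else 0, int (\<rho>' r))) [0..<R] ! i"
      using p assms[of i] upd[of "\<rho> i"] by (cases ac) (auto simp: of_nat_diff split: if_splits)
  qed simp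
  have input: "act (word_tape w h, case ac of InA b \<Rightarrow> if b then MoveRight else MoveLeft | _ \<Rightarrow> Stay)
      (word_tape w, h) = (word_tape w, h')"
    using p by (cases ac) auto
  have outp: "act (case ac of OutA b \<Rightarrow> (if b then 2 else 1, MoveRight) | _ \<Rightarrow> (0, Stay))
      (word_tape out, int (length out)) = (word_tape out', int (length out'))"
    using p word_tape_snoc[of out True] word_tape_snoc[of out False]
    by (cases ac) (auto simp: fun_upd_idem word_tape_end)
  show ?thesis
    unfolding tapes_of_def moves_of_def p prod.case using regs input outp by simp
qed

lemma cstep_funpow_mem:
  assumes "fst kc \<in> insert [] (conts c [])"
  shows "fst ((cstep w ^^ t) kc) \<in> insert [] (conts c [])"
proof (induction t)
  case (Suc t)
  obtain k \<rho> h out where e: "(cstep w ^^ t) kc = (k, \<rho>, h, out)" by (cases "(cstep w ^^ t) kc") auto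
  then have "k = [] \<or> k \<in> conts c []" using Suc by auto
  then show ?case using control_conts[of k c "[]" "\<lambda>r. \<rho> r = 0" "word_tape w h"] e
    by (auto split: prod.split)
qed (use assms in simp)

lemma cstep_halt: "(cstep w ^^ t) ([], s) = ([], s)"
  by (induction t) (cases s; auto)+

text \<open>Tape 0 is the input, hence the \<open>Suc\<close>; the symbol 1 is the mark in cell 0 of
  a register tape.\<close>

definition zeros :: "nat list \<Rightarrow> nat \<Rightarrow> bool" where
  "zeros rs r \<longleftrightarrow> rs ! Suc r = 1"

text \<open>States 0 and 1 are set aside, for writing the marks into the register tapes and for
  rejection, so the code of a stack is shifted by 2. The empty stack accepts.\<close>

definition machine :: "(com list \<Rightarrow> nat) \<Rightarrow> (nat \<Rightarrow> com list) \<Rightarrow> nat \<Rightarrow> nat \<Rightarrow> com \<Rightarrow> tm" where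
  "machine code decode Q R c = \<lparr>num_tapes = R + 2, num_symbols = 3, num_states = Q + 2,
     start_state = 0, accept_state = code [] + 2, reject_state = 1,
     transition = \<lambda>q rs. if q = 0
       then (code [c] + 2, (rs ! 0, Stay) # replicate R (1, Stay) @ [(0, Stay)])
       else case control (zeros rs) (rs ! 0) (decode (q - 2)) of
         (k, a) \<Rightarrow> (code k + 2, moves_of R (zeros rs) (rs ! 0) a)\<rparr>"

text \<open>\<open>decode\<close> must land among the stacks for every number below
  \<open>Q\<close>, because \<open>wf_tm\<close> quantifies over all states.\<close>

locale simulation =
  fixes c :: com and R :: nat and code :: "com list \<Rightarrow> nat" and decode :: "nat \<Rightarrow> com list"
    and Q :: nat
  assumes R: "regs c \<subseteq> {..<R}"
    and code: "\<And>k. k \<in> insert [] (conts c []) \<Longrightarrow> code k < Q \<and> decode (code k) = k"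
    and decode: "\<And>q. q < Q \<Longrightarrow> decode q \<in> insert [] (conts c [])"
begin

abbreviation "M \<equiv> machine code decode Q R c"

lemma wf: "wf_tm M"
proof -
  have mem: "code [] < Q" "code [c] < Q" using code conts_self by blast+
  have sym: "fst ` set (moves_of R z a ac) \<subseteq> {..<3}" if "a < 3" for z a ac
    using that by (cases ac) (auto simp: moves_of_def)
  have len: "length (moves_of R z a ac) = R + 2" for z a ac
    by (simp add: moves_of_def)
  have "case transition M q rs of (q', ws) \<Rightarrow>
      q' < Q + 2 \<and> length ws = R + 2 \<and> fst ` set ws \<subseteq> {..<3}"
    if q: "q < Q + 2" and rs: "length rs = R + 2" "set rs \<subseteq> {..<3}" for q rs
  proof -
    have a: "rs ! 0 < 3" using rs nth_mem[of 0 rs] by (auto simp del: nth_mem)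
    show ?thesis
    proof (cases "q = 0")
      case True
      then show ?thesis using a mem by (auto simp: machine_def)
    next
      case False
      obtain k ac where ka: "control (zeros rs) (rs ! 0) (decode (q - 2)) = (k, ac)" by fastforce
      have "q - 2 < Q" using q False mem by linarith
      then have "k \<in> insert [] (conts c [])"
        using decode[of "q - 2"] control_conts[of "decode (q - 2)" c "[]" "zeros rs" "rs ! 0"] ka by auto
      then have "code k < Q" using code by blast
      then show ?thesis
        using False ka sym[OF a] len by (simp add: machine_def)
    qed
  qed
  then show ?thesis
    unfolding wf_tm_def using mem by (simp add: machine_def)
qed

lemma reads:
  "map (\<lambda>(f, h). f h) (tapes_of R w (\<rho>, h, out)) =
     word_tape w h # map (\<lambda>r. if \<rho> r = 0 then 1 else 0) [0..<R] @ [0]"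
  by (auto simp: tapes_of_def word_tape_end)

lemma step_tapes_of:
  assumes "k \<in> insert [] (conts c [])" "cstep w (k, s) = (k', s')"
  shows "step M (code k + 2, tapes_of R w s) = (code k' + 2, tapes_of R w s')"
proof (cases "k = []")
  case True
  then show ?thesis using assms by (cases s) (auto simp: machine_def)
next
  case False
  have "code k \<noteq> code []" using False assms(1) code[of k] code[of "[]"] by auto
  obtain \<rho> h out where s: "s = (\<rho>, h, out)" by (cases s)
  define z where "z = zeros (map (\<lambda>(f, h). f h) (tapes_of R w s))"
  have zr: "z r \<longleftrightarrow> \<rho> r = 0" if "r < R" for r
    using that by (simp add: z_def s zeros_def reads nth_append)
  have r0: "map (\<lambda>(f, h). f h) (tapes_of R w s) ! 0 = word_tape w h"
    by (simp only: s reads nth_Cons_0)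
  have k: "lregs k \<subseteq> {..<R}" using lregs_conts[of k c "[]"] R assms(1) False by auto
  have zc: "control z (word_tape w h) k = control (\<lambda>r. \<rho> r = 0) (word_tape w h) k"
    using zr k by (intro control_cong) auto
  obtain a where ca: "control (\<lambda>r. \<rho> r = 0) (word_tape w h) k = (k', a)" and s': "s' = perform a s"
    using assms(2) s by (auto split: prod.splits)
  have "\<rho> r \<noteq> 0" if "a = DecA r" for r
    using ca that by (cases "(\<lambda>r. \<rho> r = 0, word_tape w h, k)" rule: control.cases) (auto split: if_splits)
  then have "map2 act (moves_of R (\<lambda>r. \<rho> r = 0) (word_tape w h) a) (tapes_of R w s) = tapes_of R w s'"
    unfolding s s' by (rule map2_act_moves_of)
  moreover have "moves_of R z (word_tape w h) a = moves_of R (\<lambda>r. \<rho> r = 0) (word_tape w h) a"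
    using zr by (simp add: moves_of_def)
  moreover have "decode (code k) = k" using code assms(1) by auto
  ultimately show ?thesis
    using \<open>code k \<noteq> code []\<close>
    by (simp add: machine_def r0 zc ca del: nth_map flip: z_def)
qed

text \<open>The extra step of the machine is the one from state 0 that writes the marks.\<close>

lemma run_tapes_of:
  "run M [w] (Suc t) =
     (case (cstep w ^^ t) ([c], (\<lambda>_. 0, 0, [])) of (k, s) \<Rightarrow> (code k + 2, tapes_of R w s))"
proof (induction t)
  case 0
  let ?ts = "snd (initial M [w])"
  have ts: "?ts = (word_tape w, 0) # replicate R (word_tape [], 0) @ [(word_tape [], 0)]"
    by (rule nth_equalityI) (auto simp: initial_def machine_def nth_Cons' nth_append simp del: upt_Suc)
  have e: "(word_tape [])(0 := 1) = (\<lambda>i. if i = 0 then 1 else 0)"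
    by (rule ext) (auto simp: word_tape_def)
  have r: "map2 act (replicate R (1, Stay)) (replicate R (word_tape [], 0)) =
      map (\<lambda>r. (\<lambda>i. if i = 0 then 1 else 0, 0)) [0..<R]"
    by (rule nth_equalityI) (auto simp: e[unfolded One_nat_def])
  have "initial M [w] = (0, ?ts)" by (simp add: initial_def machine_def)
  then have "run M [w] (Suc 0) = step M (0, ?ts)" by (simp add: run_def)
  also have "\<dots> = (code [c] + 2, tapes_of R w (\<lambda>_. 0, 0, []))"
    unfolding ts using r by (simp add: machine_def tapes_of_def fun_upd_idem word_tape_def)
  finally show ?case by simp
next
  case (Suc t)
  obtain k s where ks: "(cstep w ^^ t) ([c], (\<lambda>_. 0, 0, [])) = (k, s)"
    by (cases "(cstep w ^^ t) ([c], (\<lambda>_. 0, 0, []))")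
  obtain k' s' where ks': "cstep w (k, s) = (k', s')" by (cases "cstep w (k, s)")
  have "k \<in> insert [] (conts c [])"
    using cstep_funpow_mem[where kc = "([c], (\<lambda>_. 0, 0, []))" and c = c and w = w and t = t] conts_self ks by auto
  from step_tapes_of[OF this ks'] show ?case using Suc ks ks' by (simp add: run_def)
qed

end

theorem com_polytime:
  fixes p :: "nat poly"
  assumes "\<And>x. \<exists>\<rho> h. reaches x c (\<lambda>_. 0, 0, []) (\<rho>, h, f x) (poly p (length x))"
  shows "polytime_computable f"
proof -
  let ?S = "insert [] (conts c [])"
  have "finite ?S" by (simp add: finite_conts)
  then obtain code where b: "bij_betw code ?S {0..<card ?S}" using ex_bij_betw_finite_nat by blast
  obtain R where R: "regs c \<subseteq> {..<R}" using finite_regs finite_nat_iff_bounded by blast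
  interpret simulation c R code "the_inv_into ?S code" "card ?S"
  proof
    show "code k < card ?S \<and> the_inv_into ?S code (code k) = k" if "k \<in> ?S" for k
      using b that by (auto simp: bij_betw_def the_inv_into_f_f)
    show "the_inv_into ?S code q \<in> ?S" if "q < card ?S" for q
    proof -
      have "q \<in> code ` ?S" using that bij_betw_imp_surj_on[OF b] by auto
      then show ?thesis by (rule the_inv_into_into[OF bij_betw_imp_inj_on[OF b]]) simp
    qed
  qed (rule R)
  have "case run M [x] (poly (p + 1) (length x)) of (q, ts) \<Rightarrow>
      q = accept_state M \<and> fst (last ts) = word_tape (f x)" for x
  proof -
    obtain \<rho> h t where t: "t \<le> poly p (length x)"
        "(cstep x ^^ t) ([c], (\<lambda>_. 0, 0, [])) = ([], \<rho>, h, f x)"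
      using assms[of x] unfolding reaches_def by metis
    \<comment> \<open>The empty stack is a fixed point of \<open>cstep\<close>, so the remaining
      \<open>u\<close> steps change nothing and the result can be read at exactly the time given by
      the polynomial.\<close>
    then obtain u where "poly p (length x) = u + t" by (metis le_iff_add add.commute)
    then have "(cstep x ^^ poly p (length x)) ([c], (\<lambda>_. 0, 0, [])) = ([], \<rho>, h, f x)"
      by (simp only: funpow_add comp_apply t(2) cstep_halt)
    then have "run M [x] (Suc (poly p (length x))) = (code [] + 2, tapes_of R x (\<rho>, h, f x))"
      by (simp only: run_tapes_of prod.case)
    then show ?thesis by (simp add: machine_def tapes_of_def)
  qed
  then show ?thesis unfolding polytime_computable_def using wf by blast
qed

section \<open>Running time of programs\<close>

lemma poly_nat_mono: "m \<le> n \<Longrightarrow> poly p m \<le> poly p n" for p :: "nat poly"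
  by (induction p) (auto intro: add_mono mult_mono)

lemma reaches_mono: "reaches w c s s' m \<Longrightarrow> m \<le> n \<Longrightarrow> reaches w c s s' n"
  unfolding reaches_def by (meson le_trans)

lemma reaches_Skip: "reaches w Skip s s 1"
  unfolding reaches_def by (rule exI[of _ 1]) (cases s; simp)

lemma reaches_Inc: "reaches w (Inc r) (\<rho>, h, out) (\<rho>(r := Suc (\<rho> r)), h, out) 1"
  unfolding reaches_def by (rule exI[of _ 1]) simp

lemma reaches_Dec: "reaches w (Dec r) (\<rho>, h, out) (\<rho>(r := \<rho> r - 1), h, out) 1"
  unfolding reaches_def by (rule exI[of _ 1]) auto

lemma reaches_MoveIn: "reaches w (MoveIn b) (\<rho>, h, out) (\<rho>, if b then h + 1 else h - 1, out) 1"
  unfolding reaches_def by (rule exI[of _ 1]) simp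

lemma reaches_Out: "reaches w (Out b) (\<rho>, h, out) (\<rho>, h, out @ [b]) 1"
  unfolding reaches_def by (rule exI[of _ 1]) simp

lemma reaches_step:
  assumes "\<And>k. cstep w (c # k, s) = (d # k, s1)" "reaches w d s1 s2 n"
  shows "reaches w c s s2 (Suc n)"
proof -
  obtain t where "t \<le> n" "\<And>k. (cstep w ^^ t) (d # k, s1) = (k, s2)"
    using assms(2) by (auto simp: reaches_def)
  then show ?thesis
    unfolding reaches_def using assms(1) by (intro exI[of _ "Suc t"]) (simp add: funpow_Suc_right del: funpow.simps)
qed

lemma reaches_Seq:
  assumes "reaches w c s s1 m" "reaches w d s1 s2 n"
  shows "reaches w (Seq c d) s s2 (Suc (m + n))"
proof -
  obtain t u where "t \<le> m" "\<And>k. (cstep w ^^ t) (c # k, s) = (k, s1)"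
      "u \<le> n" "\<And>k. (cstep w ^^ u) (d # k, s1) = (k, s2)"
    using assms by (auto simp: reaches_def)
  moreover have "(cstep w ^^ (u + t + 1)) (Seq c d # k, s) =
      (cstep w ^^ u) ((cstep w ^^ t) (c # d # k, s))" for k
    by (cases s) (simp only: funpow_add comp_apply, simp)
  ultimately show ?thesis
    unfolding reaches_def by (intro exI[of _ "u + t + 1"]) simp
qed

definition tests :: "test \<Rightarrow> bool list \<Rightarrow> store \<Rightarrow> bool" where
  "tests t w s \<longleftrightarrow> holds t (\<lambda>r. fst s r = 0) (word_tape w (fst (snd s)))"

lemma tests_Pos [simp]: "tests (Pos rs) w (\<rho>, h, out) \<longleftrightarrow> (\<forall>r\<in>set rs. 0 < \<rho> r)"
  by (simp add: tests_def)

lemma tests_Symb [simp]: "tests (Symb as) w (\<rho>, h, out) \<longleftrightarrow> word_tape w h \<in> set as"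
  by (simp add: tests_def)

lemma reaches_If:
  assumes "tests t w s \<Longrightarrow> reaches w c s s' n" "\<not> tests t w s \<Longrightarrow> reaches w d s s' n"
  shows "reaches w (If t c d) s s' (Suc n)"
proof (cases "tests t w s")
  case True
  then show ?thesis
    by (intro reaches_step[of _ _ s c s s' n] assms) (cases s, auto simp: tests_def)
next
  case False
  then show ?thesis
    by (intro reaches_step[of _ _ s d s s' n] assms) (cases s, auto simp: tests_def)
qed

lemma reaches_While_end:
  "\<not> tests t w s \<Longrightarrow> reaches w (While t c) s s 1"
  unfolding reaches_def by (rule exI[of _ 1]) (cases s; auto simp: tests_def)

lemma reaches_While_step:
  assumes "tests t w s" "reaches w c s s1 m" "reaches w (While t c) s1 s2 n"
  shows "reaches w (While t c) s s2 (Suc (m + n))"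
proof -
  obtain i j where "i \<le> m" "\<And>k. (cstep w ^^ i) (c # k, s) = (k, s1)"
      "j \<le> n" "\<And>k. (cstep w ^^ j) (While t c # k, s1) = (k, s2)"
    using assms by (auto simp: reaches_def)
  moreover have "(cstep w ^^ (j + i + 1)) (While t c # k, s) =
      (cstep w ^^ j) ((cstep w ^^ i) (c # While t c # k, s))" for k
    using assms(1) by (cases s) (simp only: funpow_add comp_apply, simp add: tests_def)
  ultimately show ?thesis
    unfolding reaches_def by (intro exI[of _ "j + i + 1"]) simp
qed

text \<open>\<open>S i\<close> is the store after \<open>i\<close> rounds in closed form; the
  induction is on the number of rounds that remain.\<close>

lemma reaches_While:
  assumes "\<And>i. i < n \<Longrightarrow> tests t w (S i)" "\<not> tests t w (S n)"
    and "\<And>i. i < n \<Longrightarrow> reaches w c (S i) (S (Suc i)) m"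
  shows "reaches w (While t c) (S 0) (S n) (n * Suc m + 1)"
proof -
  have "i \<le> n \<Longrightarrow> reaches w (While t c) (S (n - i)) (S n) (i * Suc m + 1)" for i
  proof (induction i)
    case 0
    then show ?case using reaches_While_end[OF assms(2)] by simp
  next
    case (Suc i)
    have "reaches w (While t c) (S (n - Suc i)) (S n) (Suc (m + (i * Suc m + 1)))"
    proof (rule reaches_While_step)
      show "reaches w c (S (n - Suc i)) (S (n - i)) m"
        using assms(3)[of "n - Suc i"] Suc.prems by (simp add: Suc_diff_Suc)
    qed (use Suc assms(1) in auto)
    then show ?case by (simp add: algebra_simps)
  qed
  from this[of n] show ?thesis by simp
qed

text \<open>Time and final registers are polynomial in a bound \<open>N\<close> on the initial
  registers, with one polynomial for all inputs and stores. Bounding the final registers as well is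
  what makes the notion closed under sequencing.\<close>

definition polyrun :: "com \<Rightarrow> ((nat \<Rightarrow> nat) \<Rightarrow> bool) \<Rightarrow> (bool list \<Rightarrow> store \<Rightarrow> store) \<Rightarrow> bool" where
  "polyrun c P F \<longleftrightarrow> (\<exists>p :: nat poly. \<forall>w s N. P (fst s) \<longrightarrow> (\<forall>r. fst s r \<le> N) \<longrightarrow>
     reaches w c s (F w s) (poly p N) \<and> (\<forall>r. fst (F w s) r \<le> poly p N))"

lemma polyrunI:
  fixes p q :: "nat poly"
  assumes "\<And>w \<rho> h out N. P \<rho> \<Longrightarrow> (\<And>r. \<rho> r \<le> N) \<Longrightarrow>
      reaches w c (\<rho>, h, out) (F w (\<rho>, h, out)) (poly p N)"
    and "\<And>w \<rho> h out N r. P \<rho> \<Longrightarrow> (\<And>r. \<rho> r \<le> N) \<Longrightarrow> fst (F w (\<rho>, h, out)) r \<le> poly q N"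
  shows "polyrun c P F"
  unfolding polyrun_def
proof (intro exI[of _ "p + q"] allI impI)
  fix w :: "bool list" and s :: store and N
  assume a: "P (fst s)" "\<forall>r. fst s r \<le> N"
  obtain \<rho> h out where s: "s = (\<rho>, h, out)" by (cases s) auto
  show "reaches w c s (F w s) (poly (p + q) N) \<and> (\<forall>r. fst (F w s) r \<le> poly (p + q) N)"
    unfolding s using assms(1)[of \<rho> N w h out] assms(2)[of \<rho> N w h out] a s
    by (auto intro: reaches_mono trans_le_add2)
qed

lemma polyrunE:
  assumes "polyrun c P F"
  obtains p :: "nat poly" where "\<And>w s N. P (fst s) \<Longrightarrow> (\<And>r. fst s r \<le> N) \<Longrightarrow>
      reaches w c s (F w s) (poly p N)"
    "\<And>w s N r. P (fst s) \<Longrightarrow> (\<And>r. fst s r \<le> N) \<Longrightarrow> fst (F w s) r \<le> poly p N"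
  using assms unfolding polyrun_def by blast

lemma polyrun_cong:
  assumes "polyrun c P F" "\<And>\<rho>. Q \<rho> \<Longrightarrow> P \<rho>"
    "\<And>w \<rho> h out. Q \<rho> \<Longrightarrow> F w (\<rho>, h, out) = G w (\<rho>, h, out)"
  shows "polyrun c Q G"
proof -
  obtain p where "\<And>w s N. P (fst s) \<Longrightarrow> (\<And>r. fst s r \<le> N) \<Longrightarrow> reaches w c s (F w s) (poly p N)"
    "\<And>w s N r. P (fst s) \<Longrightarrow> (\<And>r. fst s r \<le> N) \<Longrightarrow> fst (F w s) r \<le> poly p N"
    using polyrunE[OF assms(1)] by metis
  then show ?thesis using assms(2,3) by (intro polyrunI[where p = p and q = p]) (metis fst_conv)+
qed

lemma polyrun_Seq:
  assumes "polyrun c P F" "polyrun d Q G" "\<And>w \<rho> h out. P \<rho> \<Longrightarrow> Q (fst (F w (\<rho>, h, out)))"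
  shows "polyrun (Seq c d) P (\<lambda>w s. G w (F w s))"
proof -
  obtain p where p: "\<And>w s N. P (fst s) \<Longrightarrow> (\<And>r. fst s r \<le> N) \<Longrightarrow> reaches w c s (F w s) (poly p N)"
    "\<And>w s N r. P (fst s) \<Longrightarrow> (\<And>r. fst s r \<le> N) \<Longrightarrow> fst (F w s) r \<le> poly p N"
    using polyrunE[OF assms(1)] by metis
  obtain q where q: "\<And>w s N. Q (fst s) \<Longrightarrow> (\<And>r. fst s r \<le> N) \<Longrightarrow> reaches w d s (G w s) (poly q N)"
    "\<And>w s N r. Q (fst s) \<Longrightarrow> (\<And>r. fst s r \<le> N) \<Longrightarrow> fst (G w s) r \<le> poly q N"
    using polyrunE[OF assms(2)] by metis
  have Q: "Q (fst (F w s))" if "P (fst s)" for w s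
    using that assms(3) by (cases s) auto
  show ?thesis
  proof (rule polyrunI)
    fix w :: "bool list" and \<rho> :: "nat \<Rightarrow> nat" and h :: int and out :: "bool list" and N
    let ?s = "(\<rho>, h, out)"
    assume a: "P \<rho>" "\<And>r. \<rho> r \<le> N"
    \<comment> \<open>The second command starts with registers up to \<open>poly p N\<close>, hence
      the composed polynomial.\<close>
    have "reaches w (Seq c d) ?s (G w (F w ?s)) (Suc (poly p N + poly q (poly p N)))"
      using p[of ?s N] q[of "F w ?s" "poly p N"] Q[of ?s] a by (intro reaches_Seq) auto
    then show "reaches w (Seq c d) ?s (G w (F w ?s)) (poly (1 + p + pcompose q p) N)"
      by (simp add: poly_pcompose)
    show "fst (G w (F w ?s)) r \<le> poly (pcompose q p) N" for r
      using p(2)[of ?s N] q(2)[of "F w ?s" "poly p N"] Q[of ?s] a by (auto simp: poly_pcompose)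
  qed
qed

lemma polyrun_If:
  assumes "polyrun c P F" "polyrun d P G"
  shows "polyrun (If t c d) P (\<lambda>w s. if tests t w s then F w s else G w s)"
proof -
  obtain p where p: "\<And>w s N. P (fst s) \<Longrightarrow> (\<And>r. fst s r \<le> N) \<Longrightarrow> reaches w c s (F w s) (poly p N)"
    "\<And>w s N r. P (fst s) \<Longrightarrow> (\<And>r. fst s r \<le> N) \<Longrightarrow> fst (F w s) r \<le> poly p N"
    using polyrunE[OF assms(1)] by metis
  obtain q where q: "\<And>w s N. P (fst s) \<Longrightarrow> (\<And>r. fst s r \<le> N) \<Longrightarrow> reaches w d s (G w s) (poly q N)"
    "\<And>w s N r. P (fst s) \<Longrightarrow> (\<And>r. fst s r \<le> N) \<Longrightarrow> fst (G w s) r \<le> poly q N"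
    using polyrunE[OF assms(2)] by metis
  show ?thesis
  proof (rule polyrunI)
    fix w :: "bool list" and \<rho> :: "nat \<Rightarrow> nat" and h :: int and out :: "bool list" and N
    let ?s = "(\<rho>, h, out)" and ?H = "\<lambda>w s. if tests t w s then F w s else G w s"
    assume a: "P \<rho>" "\<And>r. \<rho> r \<le> N"
    have "reaches w (If t c d) ?s (?H w ?s) (Suc (poly p N + poly q N))"
    proof (rule reaches_If)
      show "reaches w c ?s (?H w ?s) (poly p N + poly q N)" if "tests t w ?s"
        using p(1)[of ?s N w] a that by (auto intro: reaches_mono)
      show "reaches w d ?s (?H w ?s) (poly p N + poly q N)" if "\<not> tests t w ?s"
        using q(1)[of ?s N w] a that by (auto intro: reaches_mono)
    qed
    then show "reaches w (If t c d) ?s (?H w ?s) (poly (1 + p + q) N)" by simp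
    show "fst (?H w ?s) r \<le> poly (p + q) N" for r
      using p(2)[of ?s N w r] q(2)[of ?s N w r] a by auto
  qed
qed

text \<open>\<open>S w s i\<close> is the store after \<open>i\<close> rounds in closed form. Its
  registers get one bound \<open>b\<close> for all rounds; composing the polynomial of the body with
  itself once per round would not give a polynomial.\<close>

lemma polyrun_While:
  assumes body: "polyrun c Q F"
    and S0: "\<And>w \<rho> h out. P \<rho> \<Longrightarrow> S w (\<rho>, h, out) 0 = (\<rho>, h, out)"
    and S: "\<And>w \<rho> h out i. P \<rho> \<Longrightarrow> i < n \<rho> \<Longrightarrow> tests t w (S w (\<rho>, h, out) i) \<and>
      Q (fst (S w (\<rho>, h, out) i)) \<and> F w (S w (\<rho>, h, out) i) = S w (\<rho>, h, out) (Suc i)"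
    and stop: "\<And>w \<rho> h out. P \<rho> \<Longrightarrow> \<not> tests t w (S w (\<rho>, h, out) (n \<rho>))"
    and bound: "\<And>w \<rho> h out i N r. P \<rho> \<Longrightarrow> (\<And>r. \<rho> r \<le> N) \<Longrightarrow> i \<le> n \<rho> \<Longrightarrow>
      fst (S w (\<rho>, h, out) i) r \<le> poly b N"
    and n: "\<And>\<rho> N. P \<rho> \<Longrightarrow> (\<And>r. \<rho> r \<le> N) \<Longrightarrow> n \<rho> \<le> poly m N"
  shows "polyrun (While t c) P (\<lambda>w s. S w s (n (fst s)))"
proof -
  obtain p where p: "\<And>w s N. Q (fst s) \<Longrightarrow> (\<And>r. fst s r \<le> N) \<Longrightarrow> reaches w c s (F w s) (poly p N)"
    using polyrunE[OF body] by metis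
  show ?thesis
  proof (rule polyrunI)
    fix w :: "bool list" and \<rho> :: "nat \<Rightarrow> nat" and h :: int and out :: "bool list" and N
    let ?S = "S w (\<rho>, h, out)"
    assume a: "P \<rho>" "\<And>r. \<rho> r \<le> N"
    have "reaches w (While t c) (?S 0) (?S (n \<rho>)) (n \<rho> * Suc (poly p (poly b N)) + 1)"
    proof (rule reaches_While)
      fix i assume i: "i < n \<rho>"
      show "tests t w (?S i)" using S a i by blast
      have "reaches w c (?S i) (F w (?S i)) (poly p (poly b N))"
        using S[OF a(1) i] bound[OF a] i by (intro p) auto
      then show "reaches w c (?S i) (?S (Suc i)) (poly p (poly b N))" using S[OF a(1) i] by simp
    qed (use stop a in blast)
    then have "reaches w (While t c) (\<rho>, h, out) (?S (n \<rho>)) (n \<rho> * Suc (poly p (poly b N)) + 1)"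
      using S0 a by simp
    then have "reaches w (While t c) (\<rho>, h, out) (?S (n \<rho>)) (poly m N * Suc (poly p (poly b N)) + 1)"
      by (rule reaches_mono) (use n[OF a] in \<open>simp add: add_mono mult_mono\<close>)
    then show "reaches w (While t c) (\<rho>, h, out) (?S (n (fst (\<rho>, h, out))))
        (poly (m * (1 + pcompose p b) + 1) N)"
      by (simp add: poly_pcompose)
    show "fst (?S (n (fst (\<rho>, h, out)))) r \<le> poly b N" for r
      using bound[OF a] by simp
  qed
qed

lemma polyrun_Skip: "polyrun Skip P (\<lambda>w s. s)"
  by (rule polyrunI[where p = 1 and q = "[:0, 1:]"])
    (use reaches_Skip in auto)

lemma polyrun_Inc: "polyrun (Inc r) P (\<lambda>w (\<rho>, h, out). (\<rho>(r := Suc (\<rho> r)), h, out))"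
  by (rule polyrunI[where p = 1 and q = "[:1, 1:]"])
    (use reaches_Inc in \<open>auto intro: le_SucI\<close>)

lemma polyrun_Dec: "polyrun (Dec r) P (\<lambda>w (\<rho>, h, out). (\<rho>(r := \<rho> r - 1), h, out))"
proof (rule polyrunI[where p = 1 and q = "[:0, 1:]"])
  show "fst (case (\<rho>, h, out) of (\<rho>, h, out) \<Rightarrow> (\<rho>(r := \<rho> r - 1), h, out)) r' \<le> poly [:0, 1:] N"
    if "\<And>r. \<rho> r \<le> N" for \<rho> :: "nat \<Rightarrow> nat" and h :: int and out :: "bool list" and N r'
    using that[of r] that[of r'] by auto
qed (use reaches_Dec in auto)

lemma polyrun_MoveIn:
  "polyrun (MoveIn b) P (\<lambda>w (\<rho>, h, out). (\<rho>, if b then h + 1 else h - 1, out))"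
  by (rule polyrunI[where p = 1 and q = "[:0, 1:]"])
    (use reaches_MoveIn in \<open>auto simp del: split_paired_All\<close>)

lemma polyrun_Out: "polyrun (Out b) P (\<lambda>w (\<rho>, h, out). (\<rho>, h, out @ [b]))"
  by (rule polyrunI[where p = 1 and q = "[:0, 1:]"])
    (use reaches_Out in auto)

section \<open>Arithmetic on unary registers\<close>

fun incs :: "nat list \<Rightarrow> com" where
  "incs [] = Skip"
| "incs (r # rs) = Seq (Inc r) (incs rs)"

lemma polyrun_incs:
  "distinct rs \<Longrightarrow>
   polyrun (incs rs) P (\<lambda>w (\<rho>, h, out). (\<lambda>x. if x \<in> set rs then Suc (\<rho> x) else \<rho> x, h, out))"
proof (induction rs arbitrary: P)
  case Nil
  show ?case unfolding incs.simps by (rule polyrun_cong[OF polyrun_Skip[of P]]) auto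
next
  case (Cons r rs)
  then have "polyrun (Seq (Inc r) (incs rs)) P (\<lambda>w s.
      (\<lambda>(\<rho>, h, out). (\<lambda>x. if x \<in> set rs then Suc (\<rho> x) else \<rho> x, h, out))
        (case s of (\<rho>, h, out) \<Rightarrow> (\<rho>(r := Suc (\<rho> r)), h, out)))"
    by (intro polyrun_Seq[OF polyrun_Inc Cons.IH[of "\<lambda>_. True"]]) auto
  then show ?case
    unfolding incs.simps by (rule polyrun_cong) (use Cons.prems in \<open>auto simp: fun_eq_iff\<close>)
qed

text \<open>Reading a register means counting it down, so a value is moved, possibly to several
  targets at once. With no target this is a reset.\<close>

definition drain :: "nat \<Rightarrow> nat list \<Rightarrow> com" where
  "drain r rs = While (Pos [r]) (Seq (Dec r) (incs rs))"

definition drained :: "nat \<Rightarrow> nat list \<Rightarrow> (nat \<Rightarrow> nat) \<Rightarrow> nat \<Rightarrow> nat" where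
  "drained r rs \<rho> = (\<lambda>x. if x = r then 0 else if x \<in> set rs then \<rho> x + \<rho> r else \<rho> x)"

lemma polyrun_drain:
  assumes "distinct (r # rs)"
  shows "polyrun (drain r rs) P (\<lambda>w (\<rho>, h, out). (drained r rs \<rho>, h, out))"
proof -
  define S where "S = (\<lambda>(w :: bool list) (\<rho> :: nat \<Rightarrow> nat, h :: int, out :: bool list) i.
    ((\<lambda>x. if x = r then \<rho> r - i else if x \<in> set rs then \<rho> x + i else \<rho> x), h, out))"
  have "polyrun (drain r rs) P (\<lambda>w s. S w s ((\<lambda>\<rho>. \<rho> r) (fst s)))"
    unfolding drain_def
  proof (rule polyrun_While[where S = S and n = "\<lambda>\<rho>. \<rho> r"])
    show "polyrun (Seq (Dec r) (incs rs)) (\<lambda>_. True) (\<lambda>w s.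
      (\<lambda>(\<rho>, h, out). (\<lambda>x. if x \<in> set rs then Suc (\<rho> x) else \<rho> x, h, out))
        (case s of (\<rho>, h, out) \<Rightarrow> (\<rho>(r := \<rho> r - 1), h, out)))"
      using assms by (intro polyrun_Seq[OF polyrun_Dec polyrun_incs[of _ "\<lambda>_. True"]]) auto
    show "fst (S w (\<rho>, h, out) i) x \<le> poly [:0, 2:] N"
      if "\<And>r. \<rho> r \<le> N" "i \<le> \<rho> r" for w \<rho> h out i N x
      using that(1)[of r] that(1)[of x] that(2) by (auto simp: S_def)
    show "\<rho> r \<le> poly [:0, 1:] N" if "\<And>r. \<rho> r \<le> N" for \<rho> :: "nat \<Rightarrow> nat" and N
      using that by simp
  qed (use assms in \<open>auto simp: S_def fun_eq_iff\<close>)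
  then show ?thesis
    by (rule polyrun_cong) (use assms in \<open>auto simp: S_def drained_def fun_eq_iff\<close>)
qed

text \<open>The value passes through the scratch register \<open>u\<close>, from which
  \<open>n\<close> is restored.\<close>

definition copy :: "nat \<Rightarrow> nat \<Rightarrow> nat \<Rightarrow> com" where
  "copy u n m = Seq (drain n [u, m]) (drain u [n])"

lemma polyrun_copy:
  assumes "distinct [u, n, m]"
  shows "polyrun (copy u n m) (\<lambda>\<rho>. P \<rho> \<and> \<rho> u = 0) (\<lambda>w (\<rho>, h, out). (\<rho>(m := \<rho> m + \<rho> n), h, out))"
proof -
  have "polyrun (copy u n m) (\<lambda>\<rho>. P \<rho> \<and> \<rho> u = 0) (\<lambda>w s.
      (\<lambda>(\<rho>, h, out). (drained u [n] \<rho>, h, out))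
        (case s of (\<rho>, h, out) \<Rightarrow> (drained n [u, m] \<rho>, h, out)))"
    unfolding copy_def using assms
    by (intro polyrun_Seq[OF polyrun_drain polyrun_drain[of _ _ "\<lambda>_. True"]]) auto
  then show ?thesis
    by (rule polyrun_cong) (use assms in \<open>auto simp: drained_def fun_eq_iff\<close>)
qed

text \<open>\<open>acc\<close> counts the rounds, \<open>v\<close> collects the product, and the
  result replaces \<open>acc\<close>: the shape of a Horner step.\<close>

definition mult :: "nat \<Rightarrow> nat \<Rightarrow> nat \<Rightarrow> nat \<Rightarrow> com" where
  "mult u v src acc = Seq (While (Pos [acc]) (Seq (Dec acc) (copy u src v))) (drain v [acc])"

lemma polyrun_mult:
  assumes "distinct [u, v, src, acc]"
  shows "polyrun (mult u v src acc) (\<lambda>\<rho>. \<rho> u = 0 \<and> \<rho> v = 0)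
    (\<lambda>w (\<rho>, h, out). (\<rho>(acc := \<rho> src * \<rho> acc), h, out))"
proof -
  let ?P = "\<lambda>\<rho> :: nat \<Rightarrow> nat. \<rho> u = 0 \<and> \<rho> v = 0"
  define S where "S = (\<lambda>(w :: bool list) (\<rho> :: nat \<Rightarrow> nat, h :: int, out :: bool list) i.
    (\<rho>(acc := \<rho> acc - i, v := i * \<rho> src), h, out))"
  have "polyrun (While (Pos [acc]) (Seq (Dec acc) (copy u src v))) ?P
      (\<lambda>w s. S w s ((\<lambda>\<rho>. \<rho> acc) (fst s)))"
  proof (rule polyrun_While[where S = S and n = "\<lambda>\<rho>. \<rho> acc"])
    show "polyrun (Seq (Dec acc) (copy u src v)) (\<lambda>\<rho>. \<rho> u = 0) (\<lambda>w s.
      (\<lambda>(\<rho>, h, out). (\<rho>(v := \<rho> v + \<rho> src), h, out))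
        (case s of (\<rho>, h, out) \<Rightarrow> (\<rho>(acc := \<rho> acc - 1), h, out)))"
      using assms by (intro polyrun_Seq[OF polyrun_Dec polyrun_copy[of _ _ _ "\<lambda>_. True"]]) auto
    show "fst (S w (\<rho>, h, out) i) x \<le> poly [:0, 1, 1:] N"
      if "\<And>r. \<rho> r \<le> N" "i \<le> \<rho> acc" for w \<rho> h out i N x
    proof -
      have "i * \<rho> src \<le> N * N" using that(2) that(1)[of acc] that(1)[of src] by (intro mult_mono) auto
      then show ?thesis using that(1)[of acc] that(1)[of x] by (auto simp: S_def algebra_simps)
    qed
    show "\<rho> acc \<le> poly [:0, 1:] N" if "\<And>r. \<rho> r \<le> N" for \<rho> :: "nat \<Rightarrow> nat" and N
      using that by simp
  qed (use assms in \<open>auto simp: S_def fun_eq_iff\<close>)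
  then have "polyrun (mult u v src acc) ?P (\<lambda>w s. (\<lambda>(\<rho>, h, out). (drained v [acc] \<rho>, h, out))
      (S w s ((\<lambda>\<rho>. \<rho> acc) (fst s))))"
    unfolding mult_def using assms by (intro polyrun_Seq[OF _ polyrun_drain[of _ _ "\<lambda>_. True"]]) auto
  then show ?thesis
    by (rule polyrun_cong) (use assms in \<open>auto simp: S_def drained_def fun_eq_iff\<close>)
qed

lemma polyrun_Inc_n:
  "\<exists>c. polyrun c P (\<lambda>w (\<rho>, h, out). (\<rho>(r := \<rho> r + n), h, out))"
proof (induction n)
  case 0
  have "polyrun Skip P (\<lambda>w (\<rho>, h, out). (\<rho>(r := \<rho> r + 0), h, out))"
    by (rule polyrun_cong[OF polyrun_Skip[of P]]) auto
  then show ?case ..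
next
  case (Suc n)
  then obtain c where "polyrun c P (\<lambda>w (\<rho>, h, out). (\<rho>(r := \<rho> r + n), h, out))" ..
  from polyrun_Seq[OF this polyrun_Inc[of r "\<lambda>_. True"]]
  have "polyrun (Seq c (Inc r)) P (\<lambda>w (\<rho>, h, out). (\<rho>(r := \<rho> r + Suc n), h, out))"
    by (rule polyrun_cong) auto
  then show ?case ..
qed

text \<open>Horner's scheme: for \<open>pCons a p\<close> the value of \<open>p\<close> is
  multiplied by the argument and \<open>a\<close> is added. The polynomial is fixed, so the
  recursion is unrolled into the program.\<close>

lemma polyrun_poly:
  fixes p :: "nat poly"
  assumes "distinct [u, v, src, acc]"
  shows "\<exists>c. polyrun c (\<lambda>\<rho>. \<rho> u = 0 \<and> \<rho> v = 0 \<and> \<rho> acc = 0)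
    (\<lambda>w (\<rho>, h, out). (\<rho>(acc := poly p (\<rho> src)), h, out))"
proof (induction p)
  case 0
  have "polyrun Skip (\<lambda>\<rho>. \<rho> u = 0 \<and> \<rho> v = 0 \<and> \<rho> acc = 0)
    (\<lambda>w (\<rho>, h, out). (\<rho>(acc := poly 0 (\<rho> src)), h, out))"
    by (rule polyrun_cong[OF polyrun_Skip[of "\<lambda>_. True"]]) (auto simp: fun_eq_iff)
  then show ?case ..
next
  case (pCons a p)
  let ?P = "\<lambda>\<rho> :: nat \<Rightarrow> nat. \<rho> u = 0 \<and> \<rho> v = 0 \<and> \<rho> acc = 0"
  obtain c where c: "polyrun c ?P (\<lambda>w (\<rho>, h, out). (\<rho>(acc := poly p (\<rho> src)), h, out))"
    using pCons.IH ..
  obtain d where d: "polyrun d (\<lambda>_. True) (\<lambda>w (\<rho>, h, out). (\<rho>(acc := \<rho> acc + a), h, out))"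
    using polyrun_Inc_n by blast
  have "polyrun (Seq (mult u v src acc) d) (\<lambda>\<rho>. \<rho> u = 0 \<and> \<rho> v = 0) (\<lambda>w s.
      (\<lambda>(\<rho>, h, out). (\<rho>(acc := \<rho> acc + a), h, out))
        (case s of (\<rho>, h, out) \<Rightarrow> (\<rho>(acc := \<rho> src * \<rho> acc), h, out)))"
    using assms by (intro polyrun_Seq[OF polyrun_mult d]) auto
  from polyrun_Seq[OF c this]
  have "polyrun (Seq c (Seq (mult u v src acc) d)) ?P
      (\<lambda>w (\<rho>, h, out). (\<rho>(acc := poly (pCons a p) (\<rho> src)), h, out))"
    by (rule polyrun_cong) (use assms in \<open>auto simp: fun_eq_iff\<close>)
  then show ?case ..
qed

text \<open>\<open>Shift r b\<close> asks \<open>b\<close> with \<open>r\<close> increased by one,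
  which expresses offsets in comparisons without a language of terms. \<open>InSym\<close> looks at
  the input at the register's distance from the input head.\<close>

datatype cond = IsZ nat | InSym nat nat | Less nat nat | Shift nat cond | NotC cond | AndC cond cond

fun ceval :: "cond \<Rightarrow> bool list \<Rightarrow> int \<Rightarrow> (nat \<Rightarrow> nat) \<Rightarrow> bool" where
  "ceval (IsZ r) w h \<rho> \<longleftrightarrow> \<rho> r = 0"
| "ceval (InSym r a) w h \<rho> \<longleftrightarrow> word_tape w (h + int (\<rho> r)) = a"
| "ceval (Less r r') w h \<rho> \<longleftrightarrow> \<rho> r < \<rho> r'"
| "ceval (Shift r b) w h \<rho> \<longleftrightarrow> ceval b w h (\<rho>(r := Suc (\<rho> r)))"
| "ceval (NotC b) w h \<rho> \<longleftrightarrow> \<not> ceval b w h \<rho>"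
| "ceval (AndC b b') w h \<rho> \<longleftrightarrow> ceval b w h \<rho> \<and> ceval b' w h \<rho>"

fun cregs :: "cond \<Rightarrow> nat set" where
  "cregs (IsZ r) = {r}"
| "cregs (InSym r a) = {r}"
| "cregs (Less r r') = {r, r'}"
| "cregs (Shift r b) = insert r (cregs b)"
| "cregs (NotC b) = cregs b"
| "cregs (AndC b b') = cregs b \<union> cregs b'"

lemma ceval_cong:
  "(\<And>r. r \<in> cregs b \<Longrightarrow> \<rho> r = \<rho>' r) \<Longrightarrow> ceval b w h \<rho> = ceval b w h \<rho>'"
proof (induction b arbitrary: \<rho> \<rho>')
  case (Shift r b)
  have "ceval b w h (\<rho>(r := Suc (\<rho> r))) = ceval b w h (\<rho>'(r := Suc (\<rho>' r)))"
    using Shift.prems by (intro Shift.IH) auto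
  then show ?case by simp
next
  case (AndC b b')
  have "ceval b w h \<rho> = ceval b w h \<rho>'" "ceval b' w h \<rho> = ceval b' w h \<rho>'"
    using AndC.prems by (auto intro!: AndC.IH)
  then show ?case by simp
next
  case (NotC b)
  have "ceval b w h \<rho> = ceval b w h \<rho>'" using NotC.prems by (intro NotC.IH) auto
  then show ?case by simp
qed auto

text \<open>\<open>u\<close> is the scratch register of the tests. \<open>Less\<close> counts both
  of its registers down at once, so they must differ.\<close>

fun wf_cond :: "nat \<Rightarrow> cond \<Rightarrow> bool" where
  "wf_cond u (IsZ r) \<longleftrightarrow> True"
| "wf_cond u (InSym r a) \<longleftrightarrow> r \<noteq> u"
| "wf_cond u (Less r r') \<longleftrightarrow> distinct [r, r', u]"
| "wf_cond u (Shift r b) \<longleftrightarrow> r \<noteq> u \<and> wf_cond u b"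
| "wf_cond u (NotC b) \<longleftrightarrow> wf_cond u b"
| "wf_cond u (AndC b b') \<longleftrightarrow> wf_cond u b \<and> wf_cond u b'"

text \<open>\<open>InSym\<close> and \<open>Less\<close> destroy the registers that they count down.
  They record the number of rounds in \<open>u\<close>, and both branches begin by undoing the test,
  so \<open>c\<close> and \<open>d\<close> find the original store.\<close>

fun branch :: "nat \<Rightarrow> cond \<Rightarrow> com \<Rightarrow> com \<Rightarrow> com" where
  "branch u (IsZ r) c d = If (Pos [r]) d c"
| "branch u (InSym r a) c d =
    (let undo = While (Pos [u]) (Seq (Dec u) (Seq (Inc r) (MoveIn False)))
     in Seq (While (Pos [r]) (Seq (Dec r) (Seq (Inc u) (MoveIn True))))
          (If (Symb [a]) (Seq undo c) (Seq undo d)))"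
| "branch u (Less r r') c d =
    (let undo = drain u [r, r']
     in Seq (While (Pos [r, r']) (Seq (Dec r) (Seq (Dec r') (Inc u))))
          (If (Pos [r']) (Seq undo c) (Seq undo d)))"
| "branch u (Shift r b) c d = Seq (Inc r) (branch u b (Seq (Dec r) c) (Seq (Dec r) d))"
| "branch u (NotC b) c d = branch u b d c"
| "branch u (AndC b b') c d = branch u b (branch u b' c d) d"

text \<open>\<open>a\<close> is the destructive part of a test and \<open>z\<close> its inverse. In
  between, \<open>P\<close> may fail; what holds there is \<open>P (g \<rho>)\<close>, where
  \<open>g\<close> is the effect of \<open>z\<close> on the registers.\<close>

lemma polyrun_undo:
  assumes a: "polyrun a P A" and z: "polyrun z (\<lambda>_. True) Z"
    and reg: "\<And>w \<rho> h out. fst (Z w (\<rho>, h, out)) = g \<rho>"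
    and undo: "\<And>w \<rho> h out. P \<rho> \<Longrightarrow> Z w (A w (\<rho>, h, out)) = (\<rho>, h, out)"
    and c: "polyrun c P F" and d: "polyrun d P G"
  shows "polyrun (Seq a (If t (Seq z c) (Seq z d))) P
    (\<lambda>w s. if tests t w (A w s) then F w s else G w s)"
proof -
  have zP: "polyrun z (\<lambda>\<rho>. P (g \<rho>)) Z" by (rule polyrun_cong[OF z]) auto
  have "polyrun (Seq z c) (\<lambda>\<rho>. P (g \<rho>)) (\<lambda>w s. F w (Z w s))"
    "polyrun (Seq z d) (\<lambda>\<rho>. P (g \<rho>)) (\<lambda>w s. G w (Z w s))"
    using reg by (auto intro!: polyrun_Seq[OF zP] c d)
  note polyrun_If[OF this, of t]
  from polyrun_Seq[OF a this]
  have "polyrun (Seq a (If t (Seq z c) (Seq z d))) P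
      (\<lambda>w s. if tests t w (A w s) then F w (Z w (A w s)) else G w (Z w (A w s)))"
    using undo reg by (metis fst_conv prod.collapse)
  then show ?thesis by (rule polyrun_cong) (auto simp: undo)
qed

lemma polyrun_branch:
  assumes "wf_cond u b" "\<And>\<rho>. P \<rho> \<Longrightarrow> \<rho> u = 0" "polyrun c P F" "polyrun d P G"
  shows "polyrun (branch u b c d) P
    (\<lambda>w s. if ceval b w (fst (snd s)) (fst s) then F w s else G w s)"
  using assms
proof (induction b arbitrary: P c d F G)
  case (IsZ r)
  show ?case
    unfolding branch.simps by (rule polyrun_cong[OF polyrun_If[OF IsZ(4,3)]]) auto
next
  case (InSym r a)
  have r: "r \<noteq> u" using InSym.prems by simp
  define S where "S = (\<lambda>(w :: bool list) (\<rho> :: nat \<Rightarrow> nat, h, out :: bool list) i.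
    (\<rho>(r := \<rho> r - i, u := \<rho> u + i), h + int i, out))"
  have "polyrun (While (Pos [r]) (Seq (Dec r) (Seq (Inc u) (MoveIn True)))) P
      (\<lambda>w s. S w s ((\<lambda>\<rho>. \<rho> r) (fst s)))"
  proof (rule polyrun_While[where S = S and n = "\<lambda>\<rho>. \<rho> r"])
    show "polyrun (Seq (Dec r) (Seq (Inc u) (MoveIn True))) (\<lambda>_. True)
        (\<lambda>w (\<rho>, h, out). (\<rho>(r := \<rho> r - 1, u := Suc (\<rho> u)), h + 1, out))"
      by (rule polyrun_cong[OF polyrun_Seq[OF polyrun_Dec[of _ "\<lambda>_. True"]
          polyrun_Seq[OF polyrun_Inc[of _ "\<lambda>_. True"] polyrun_MoveIn[of _ "\<lambda>_. True"]]]])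
        (use r in auto)
    show "fst (S w (\<rho>, h, out) i) x \<le> poly [:0, 2:] N"
      if "\<And>r. \<rho> r \<le> N" "i \<le> \<rho> r" for w \<rho> h out i N x
      using that(1)[of r] that(1)[of x] that(1)[of u] that(2) by (auto simp: S_def)
    show "\<rho> r \<le> poly [:0, 1:] N" if "\<And>r. \<rho> r \<le> N" for \<rho> :: "nat \<Rightarrow> nat" and N
      using that by simp
  qed (use r in \<open>auto simp: S_def fun_eq_iff\<close>)
  moreover
  define S' where "S' = (\<lambda>(w :: bool list) (\<rho> :: nat \<Rightarrow> nat, h, out :: bool list) i.
    (\<rho>(r := \<rho> r + i, u := \<rho> u - i), h - int i, out))"
  have "polyrun (While (Pos [u]) (Seq (Dec u) (Seq (Inc r) (MoveIn False)))) (\<lambda>_. True)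
      (\<lambda>w s. S' w s ((\<lambda>\<rho>. \<rho> u) (fst s)))"
  proof (rule polyrun_While[where S = S' and n = "\<lambda>\<rho>. \<rho> u"])
    show "polyrun (Seq (Dec u) (Seq (Inc r) (MoveIn False))) (\<lambda>_. True)
        (\<lambda>w (\<rho>, h, out). (\<rho>(u := \<rho> u - 1, r := Suc (\<rho> r)), h - 1, out))"
      by (rule polyrun_cong[OF polyrun_Seq[OF polyrun_Dec[of _ "\<lambda>_. True"]
          polyrun_Seq[OF polyrun_Inc[of _ "\<lambda>_. True"] polyrun_MoveIn[of _ "\<lambda>_. True"]]]])
        (use r in auto)
    show "fst (S' w (\<rho>, h, out) i) x \<le> poly [:0, 2:] N"
      if "\<And>r. \<rho> r \<le> N" "i \<le> \<rho> u" for w \<rho> h out i N x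
      using that(1)[of r] that(1)[of x] that(1)[of u] that(2) by (auto simp: S'_def)
    show "\<rho> u \<le> poly [:0, 1:] N" if "\<And>r. \<rho> r \<le> N" for \<rho> :: "nat \<Rightarrow> nat" and N
      using that by simp
  qed (use r in \<open>auto simp: S'_def fun_eq_iff\<close>)
  ultimately have "polyrun (branch u (InSym r a) c d) P
    (\<lambda>w s. if tests (Symb [a]) w (S w s ((\<lambda>\<rho>. \<rho> r) (fst s))) then F w s else G w s)"
    unfolding branch.simps Let_def
    by (rule polyrun_undo[where g = "\<lambda>\<rho>. \<rho>(r := \<rho> r + \<rho> u, u := 0)"])
      (use InSym.prems r in \<open>auto simp: S_def S'_def fun_eq_iff\<close>)
  then show ?case by (rule polyrun_cong) (auto simp: S_def)
next
  case (Less r r')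
  have r: "r \<noteq> r'" "r \<noteq> u" "r' \<noteq> u" using Less.prems by auto
  define S where "S = (\<lambda>(w :: bool list) (\<rho> :: nat \<Rightarrow> nat, h :: int, out :: bool list) i.
    (\<rho>(r := \<rho> r - i, r' := \<rho> r' - i, u := \<rho> u + i), h, out))"
  have "polyrun (While (Pos [r, r']) (Seq (Dec r) (Seq (Dec r') (Inc u)))) P
      (\<lambda>w s. S w s ((\<lambda>\<rho>. min (\<rho> r) (\<rho> r')) (fst s)))"
  proof (rule polyrun_While[where S = S and n = "\<lambda>\<rho>. min (\<rho> r) (\<rho> r')"])
    show "polyrun (Seq (Dec r) (Seq (Dec r') (Inc u))) (\<lambda>_. True)
        (\<lambda>w (\<rho>, h, out). (\<rho>(r := \<rho> r - 1, r' := \<rho> r' - 1, u := Suc (\<rho> u)), h, out))"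
      by (rule polyrun_cong[OF polyrun_Seq[OF polyrun_Dec[of _ "\<lambda>_. True"]
          polyrun_Seq[OF polyrun_Dec[of _ "\<lambda>_. True"] polyrun_Inc[of _ "\<lambda>_. True"]]]])
        (use r in auto)
    show "fst (S w (\<rho>, h, out) i) x \<le> poly [:0, 2:] N"
      if "\<And>r. \<rho> r \<le> N" "i \<le> min (\<rho> r) (\<rho> r')" for w \<rho> h out i N x
      using that(1)[of r] that(1)[of x] that(1)[of u] that(1)[of r'] that(2) by (auto simp: S_def)
    show "min (\<rho> r) (\<rho> r') \<le> poly [:0, 1:] N" if "\<And>r. \<rho> r \<le> N" for \<rho> :: "nat \<Rightarrow> nat" and N
      using that[of r] by simp
  qed (use r in \<open>auto simp: S_def fun_eq_iff\<close>)
  moreover have "polyrun (drain u [r, r']) (\<lambda>_. True) (\<lambda>w (\<rho>, h, out). (drained u [r, r'] \<rho>, h, out))"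
    using r by (intro polyrun_drain) auto
  ultimately have "polyrun (branch u (Less r r') c d) P
    (\<lambda>w s. if tests (Pos [r']) w (S w s ((\<lambda>\<rho>. min (\<rho> r) (\<rho> r')) (fst s))) then F w s else G w s)"
    unfolding branch.simps Let_def
    by (rule polyrun_undo[where g = "drained u [r, r']"])
      (use Less.prems r in \<open>auto simp: S_def drained_def fun_eq_iff\<close>)
  then show ?case by (rule polyrun_cong) (use r in \<open>auto simp: S_def min_def\<close>)
next
  case (Shift r b)
  \<comment> \<open>After the increment, \<open>P\<close> is known only of the registers with
    \<open>r\<close> counted back.\<close>
  let ?Q = "\<lambda>\<rho>. 0 < \<rho> r \<and> P (\<rho>(r := \<rho> r - 1))"
  have "polyrun (Seq (Dec r) c) ?Q (\<lambda>w s. F w (case s of (\<rho>, h, out) \<Rightarrow> (\<rho>(r := \<rho> r - 1), h, out)))"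
    "polyrun (Seq (Dec r) d) ?Q (\<lambda>w s. G w (case s of (\<rho>, h, out) \<Rightarrow> (\<rho>(r := \<rho> r - 1), h, out)))"
    by (rule polyrun_Seq[OF polyrun_Dec Shift.prems(3)] polyrun_Seq[OF polyrun_Dec Shift.prems(4)],
        simp add: fun_upd_def)+
  from Shift.IH[OF _ _ this] Shift.prems
  have "polyrun (branch u b (Seq (Dec r) c) (Seq (Dec r) d)) ?Q (\<lambda>w s.
      if ceval b w (fst (snd s)) (fst s)
      then F w (case s of (\<rho>, h, out) \<Rightarrow> (\<rho>(r := \<rho> r - 1), h, out))
      else G w (case s of (\<rho>, h, out) \<Rightarrow> (\<rho>(r := \<rho> r - 1), h, out)))"
    by (metis fun_upd_other wf_cond.simps(4))
  from polyrun_Seq[OF polyrun_Inc[of r P] this] show ?case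
    unfolding branch.simps by (rule polyrun_cong) auto
next
  case (NotC b)
  have "polyrun (branch u b d c) P (\<lambda>w s. if ceval b w (fst (snd s)) (fst s) then G w s else F w s)"
    using NotC.prems by (intro NotC.IH) auto
  then show ?case unfolding branch.simps by (rule polyrun_cong) auto
next
  case (AndC b b')
  have "polyrun (branch u b' c d) P (\<lambda>w s. if ceval b' w (fst (snd s)) (fst s) then F w s else G w s)"
    using AndC.prems by (intro AndC.IH) auto
  then have "polyrun (branch u b (branch u b' c d) d) P (\<lambda>w s. if ceval b w (fst (snd s)) (fst s)
      then if ceval b' w (fst (snd s)) (fst s) then F w s else G w s else G w s)"
    using AndC.prems by (intro AndC.IH) auto
  then show ?case unfolding branch.simps by (rule polyrun_cong) auto
qed

section \<open>Programs that print\<close>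

text \<open>The registers in \<open>Z\<close> are scratch and start at zero. Registers and input
  head come back unchanged and only the output grows, so printing programs can be sequenced and
  nested freely.\<close>

definition emits :: "nat set \<Rightarrow> com \<Rightarrow> (bool list \<Rightarrow> int \<Rightarrow> (nat \<Rightarrow> nat) \<Rightarrow> bool list) \<Rightarrow> bool" where
  "emits Z c f \<longleftrightarrow> polyrun c (\<lambda>\<rho>. \<forall>r\<in>Z. \<rho> r = 0) (\<lambda>w (\<rho>, h, out). (\<rho>, h, out @ f w h \<rho>))"

lemma emits_Out: "emits Z (Out b) (\<lambda>_ _ _. [b])"
  unfolding emits_def by (rule polyrun_Out)

lemma emits_Skip: "emits Z Skip (\<lambda>_ _ _. [])"
  unfolding emits_def by (rule polyrun_cong[OF polyrun_Skip[of "\<lambda>_. True"]]) auto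

lemma emits_Seq:
  assumes "emits Z c f" "emits Z d g"
  shows "emits Z (Seq c d) (\<lambda>w h \<rho>. f w h \<rho> @ g w h \<rho>)"
  unfolding emits_def
  by (rule polyrun_cong[OF polyrun_Seq[OF assms[unfolded emits_def]]]) auto

lemma emits_list:
  assumes "\<And>x. x \<in> set xs \<Longrightarrow> emits Z (c x) (f x)"
  shows "emits Z (foldr Seq (map c xs) Skip) (\<lambda>w h \<rho>. concat (map (\<lambda>x. f x w h \<rho>) xs))"
  using assms by (induction xs) (auto intro!: emits_Skip emits_Seq)

lemma emits_branch:
  assumes "wf_cond u b" "u \<in> Z" "emits Z c f" "emits Z d g"
  shows "emits Z (branch u b c d) (\<lambda>w h \<rho>. if ceval b w h \<rho> then f w h \<rho> else g w h \<rho>)"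
  unfolding emits_def
  by (rule polyrun_cong[OF polyrun_branch[OF assms(1) _ assms(3,4)[unfolded emits_def]]])
    (use assms(2) in auto)

text \<open>The copy \<open>m\<close> is counted down because the bound \<open>n\<close> has to
  survive the loop.\<close>

definition for_loop :: "nat \<Rightarrow> nat \<Rightarrow> nat \<Rightarrow> nat \<Rightarrow> com \<Rightarrow> com" where
  "for_loop u m n i c =
     Seq (copy u n m) (Seq (While (Pos [m]) (Seq (Dec m) (Seq c (Inc i)))) (drain i []))"

text \<open>\<open>m\<close> changes from round to round, so what the body prints must not depend on
  it; this is \<open>insens\<close>. The body's scratch set \<open>Z'\<close> leaves out
  \<open>i\<close> and \<open>m\<close>, which can be nonzero inside the loop.\<close>

lemma emits_for_loop:
  assumes c: "emits Z' c f" and Z: "insert i (insert m (insert u Z')) \<subseteq> Z" "i \<notin> Z'" "m \<notin> Z'"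
    and distinct: "distinct [u, m, n, i]"
    and insens: "\<And>w h \<rho> x. f w h (\<rho>(m := x)) = f w h \<rho>"
  shows "emits Z (for_loop u m n i c) (\<lambda>w h \<rho>. concat (map (\<lambda>v. f w h (\<rho>(i := v))) [0..<\<rho> n]))"
proof -
  define S where "S = (\<lambda>w (\<rho> :: nat \<Rightarrow> nat, h, out) j. (\<rho>(m := \<rho> m - j, i := j), h,
    out @ concat (map (\<lambda>v. f w h (\<rho>(i := v))) [0..<j])))"
  \<comment> \<open>At this point \<open>m\<close> already holds the copy, so it is exempt from the
    zero condition.\<close>
  let ?P = "\<lambda>\<rho>. \<forall>r\<in>Z - {m}. \<rho> r = 0"
  have f: "f w h (\<rho>(m := x, i := y)) = f w h (\<rho>(i := y))" for w h \<rho> x y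
    using insens[of w h "\<rho>(i := y)" x] distinct by (simp add: fun_upd_twist)
  have "polyrun (While (Pos [m]) (Seq (Dec m) (Seq c (Inc i)))) ?P (\<lambda>w s. S w s (fst s m))"
  proof (rule polyrun_While[where S = S and n = "\<lambda>\<rho>. \<rho> m"])
    show "polyrun (Seq (Dec m) (Seq c (Inc i))) (\<lambda>\<rho>. \<forall>r\<in>Z'. \<rho> r = 0) (\<lambda>w (\<rho>, h, out).
        (\<rho>(m := \<rho> m - 1, i := Suc (\<rho> i)), h, out @ f w h \<rho>))"
      by (rule polyrun_cong[OF polyrun_Seq[OF polyrun_Dec[of _ "\<lambda>\<rho>. \<forall>r\<in>Z'. \<rho> r = 0"]
            polyrun_Seq[OF c[unfolded emits_def] polyrun_Inc[of _ "\<lambda>_. True"]]]])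
        (use Z distinct insens in auto)
    show "S w (\<rho>, h, out) 0 = (\<rho>, h, out)" if "?P \<rho>" for w \<rho> h out
      using that Z distinct by (auto simp: S_def fun_eq_iff)
    show "fst (S w (\<rho>, h, out) j) x \<le> poly [:0, 1:] N"
      if "\<And>r. \<rho> r \<le> N" "j \<le> \<rho> m" for w \<rho> h out j N x
      using that(1)[of m] that(1)[of x] that(2) by (auto simp: S_def)
    show "\<rho> m \<le> poly [:0, 1:] N" if "\<And>r. \<rho> r \<le> N" for \<rho> :: "nat \<Rightarrow> nat" and N
      using that by simp
    show "tests (Pos [m]) w (S w (\<rho>, h, out) j) \<and> (\<forall>r\<in>Z'. fst (S w (\<rho>, h, out) j) r = 0) \<and>
      (case S w (\<rho>, h, out) j of (\<rho>, h, out) \<Rightarrow> (\<rho>(m := \<rho> m - 1, i := Suc (\<rho> i)), h, out @ f w h \<rho>)) =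
      S w (\<rho>, h, out) (Suc j)" if "?P \<rho>" "j < \<rho> m" for w \<rho> h out j
      using that Z distinct by (auto simp: S_def f fun_eq_iff)
    show "\<not> tests (Pos [m]) w (S w (\<rho>, h, out) (\<rho> m))" for w \<rho> h out
      using distinct by (simp add: S_def)
  qed
  from polyrun_Seq[OF this polyrun_drain[of i "[]" "\<lambda>_. True"]]
  have "polyrun (Seq (While (Pos [m]) (Seq (Dec m) (Seq c (Inc i)))) (drain i [])) ?P
      (\<lambda>w s. case S w s (fst s m) of (\<rho>, h, out) \<Rightarrow> (drained i [] \<rho>, h, out))" by simp
  from polyrun_Seq[OF polyrun_copy[of u n m "\<lambda>\<rho>. \<forall>r\<in>Z. \<rho> r = 0"] this]
  have "polyrun (for_loop u m n i c) (\<lambda>\<rho>. (\<forall>r\<in>Z. \<rho> r = 0) \<and> \<rho> u = 0)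
      (\<lambda>w s. case S w ((\<lambda>(\<rho>, h, out). (\<rho>(m := \<rho> m + \<rho> n), h, out)) s)
          (fst ((\<lambda>(\<rho>, h, out). (\<rho>(m := \<rho> m + \<rho> n), h, out)) s) m) of
        (\<rho>, h, out) \<Rightarrow> (drained i [] \<rho>, h, out))"
    unfolding for_loop_def using distinct by auto
  then show ?thesis
    unfolding emits_def
    by (rule polyrun_cong) (use Z distinct in \<open>auto simp: S_def drained_def f fun_eq_iff\<close>)
qed

definition halve :: "nat \<Rightarrow> nat \<Rightarrow> nat \<Rightarrow> com" where
  "halve v z r = While (Pos [r]) (Seq (Dec r) (If (Pos [r]) (Seq (Dec r) (Inc v)) (Inc z)))"

lemma polyrun_halve:
  assumes "distinct [v, z, r]"
  shows "polyrun (halve v z r) (\<lambda>\<rho>. \<rho> v = 0 \<and> \<rho> z = 0)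
    (\<lambda>w (\<rho>, h, out). (\<rho>(r := 0, v := \<rho> r div 2, z := \<rho> r mod 2), h, out))"
proof -
  \<comment> \<open>An odd register has a last round that removes only 1: the subtraction truncates,
    \<open>min\<close> stops the quotient, and the remainder becomes 1.\<close>
  define S where "S = (\<lambda>(w :: bool list) (\<rho> :: nat \<Rightarrow> nat, h :: int, out :: bool list) i.
    (\<rho>(r := \<rho> r - 2 * i, v := min i (\<rho> r div 2), z := if 2 * i > \<rho> r then 1 else 0), h, out))"
  have "polyrun (halve v z r) (\<lambda>\<rho>. \<rho> v = 0 \<and> \<rho> z = 0) (\<lambda>w s. S w s ((fst s r + 1) div 2))"
    unfolding halve_def
  proof (rule polyrun_While[where S = S and n = "\<lambda>\<rho>. (\<rho> r + 1) div 2"])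
    show "polyrun (Seq (Dec r) (If (Pos [r]) (Seq (Dec r) (Inc v)) (Inc z))) (\<lambda>_. True)
        (\<lambda>w (\<rho>, h, out). (if \<rho> r > 1 then \<rho>(r := \<rho> r - 2, v := Suc (\<rho> v))
           else \<rho>(r := \<rho> r - 1, z := Suc (\<rho> z)), h, out))"
      by (rule polyrun_cong[OF polyrun_Seq[OF polyrun_Dec[of _ "\<lambda>_. True"] polyrun_If[OF
              polyrun_Seq[OF polyrun_Dec[of _ "\<lambda>_. True"] polyrun_Inc[of _ "\<lambda>_. True"]]
              polyrun_Inc[of _ "\<lambda>_. True"]]]])
        (use assms in \<open>auto simp: fun_eq_iff\<close>)
    show "fst (S w (\<rho>, h, out) i) x \<le> poly [:1, 1:] N"
      if "\<And>r. \<rho> r \<le> N" for w \<rho> h out i N x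
      using that[of r] that[of x] by (auto simp: S_def)
    show "(\<rho> r + 1) div 2 \<le> poly [:0, 1:] N" if "\<And>r. \<rho> r \<le> N" for \<rho> :: "nat \<Rightarrow> nat" and N
      using that[of r] by simp
  qed (use assms in \<open>auto simp: S_def fun_eq_iff\<close>)
  then show ?thesis
    by (rule polyrun_cong, simp, use assms in \<open>auto simp: S_def fun_eq_iff mod2_eq_if\<close>) presburger+
qed

section \<open>Binary output\<close>

lemma length_binary: "length (binary n) \<le> n"
proof (induction n rule: binary.induct)
  case (1 n)
  then show ?case by (cases "n = 0") (auto simp: binary.simps[of 0] binary.simps[of n])
qed

lemma div_length_binary: "n div 2 ^ length (binary n) = 0"
proof (induction n rule: binary.induct)
  case (1 n)
  then show ?case by (cases "n = 0") (auto simp: binary.simps[of 0] binary.simps[of n] div_mult2_eq)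
qed

lemma binary_nth: "j < length (binary n) \<Longrightarrow> 0 < n div 2 ^ j \<and> binary n ! j = odd (n div 2 ^ j)"
proof (induction n arbitrary: j rule: binary.induct)
  case (1 n)
  then have "n \<noteq> 0" by (cases "n = 0") (auto simp: binary.simps[of 0])
  then show ?case using 1 by (cases j) (auto simp: binary.simps[of n] div_mult2_eq)
qed

text \<open>Repeated halving yields the digits least significant first, which is the order of the
  encoding, and leaves the register at zero.\<close>

lemma polyrun_enc_nat:
  assumes "distinct [v, z, r]"
  shows "\<exists>c. polyrun c (\<lambda>\<rho>. \<rho> v = 0 \<and> \<rho> z = 0)
    (\<lambda>w (\<rho>, h, out). (\<rho>(r := 0), h, out @ enc_nat (\<rho> r)))"
proof -
  let ?c = "Seq (halve v z r) (Seq (Out True)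
    (Seq (If (Pos [z]) (Seq (Dec z) (Out True)) (Out False)) (drain v [r])))"
  let ?P = "\<lambda>\<rho> :: nat \<Rightarrow> nat. \<rho> v = 0 \<and> \<rho> z = 0"
  define S where "S = (\<lambda>(w :: bool list) (\<rho> :: nat \<Rightarrow> nat, h :: int, out) j. (\<rho>(r := \<rho> r div 2 ^ j), h,
    out @ concat (map (\<lambda>b. [True, b]) (take j (binary (\<rho> r))))))"
  have "polyrun (While (Pos [r]) ?c) ?P (\<lambda>w s. S w s (length (binary (fst s r))))"
  proof (rule polyrun_While[where S = S and n = "\<lambda>\<rho>. length (binary (\<rho> r))"])
    have if_z: "polyrun (If (Pos [z]) (Seq (Dec z) (Out True)) (Out False)) (\<lambda>_. True)
        (\<lambda>w (\<rho>, h, out). (\<rho>(z := \<rho> z - 1), h, out @ [\<rho> z > 0]))"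
      by (rule polyrun_cong[OF polyrun_If[OF polyrun_Seq[OF polyrun_Dec[of _ "\<lambda>_. True"]
              polyrun_Out[of _ "\<lambda>_. True"]] polyrun_Out[of _ "\<lambda>_. True"]]]) auto
    show "polyrun ?c ?P (\<lambda>w (\<rho>, h, out). (\<rho>(r := \<rho> r div 2), h, out @ [True, odd (\<rho> r)]))"
      by (rule polyrun_cong[OF polyrun_Seq[OF polyrun_halve polyrun_Seq[OF
              polyrun_Out[of _ "\<lambda>_. True"] polyrun_Seq[OF if_z polyrun_drain[of _ _ "\<lambda>_. True"]]]]])
        (use assms in \<open>auto simp: fun_eq_iff drained_def odd_iff_mod_2_eq_one\<close>)
    show "fst (S w (\<rho>, h, out) i) x \<le> poly [:0, 1:] N"
      if "\<And>r. \<rho> r \<le> N" for w \<rho> h out i N x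
      using le_trans[OF div_le_dividend that[of r], of "2 ^ i"] that[of x] by (auto simp: S_def)
    show "length (binary (\<rho> r)) \<le> poly [:0, 1:] N" if "\<And>r. \<rho> r \<le> N" for \<rho> :: "nat \<Rightarrow> nat" and N
      using le_trans[OF length_binary that[of r]] by simp
    show "tests (Pos [r]) w (S w (\<rho>, h, out) j) \<and> ?P (fst (S w (\<rho>, h, out) j)) \<and>
      (case S w (\<rho>, h, out) j of (\<rho>, h, out) \<Rightarrow> (\<rho>(r := \<rho> r div 2), h, out @ [True, odd (\<rho> r)])) =
      S w (\<rho>, h, out) (Suc j)" if "?P \<rho>" "j < length (binary (\<rho> r))" for w \<rho> h out j
      using that assms binary_nth[OF that(2)]
      by (auto simp: S_def take_Suc_conv_app_nth div_mult2_eq[symmetric] mult.commute)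
  qed (use assms in \<open>auto simp: S_def div_length_binary\<close>)
  from polyrun_Seq[OF this polyrun_Out[of False "\<lambda>_. True"]]
  have "polyrun (Seq (While (Pos [r]) ?c) (Out False)) ?P
    (\<lambda>w (\<rho>, h, out). (\<rho>(r := 0), h, out @ enc_nat (\<rho> r)))"
    by (rule polyrun_cong) (use assms in \<open>auto simp: S_def div_length_binary enc_nat_def\<close>)
  then show ?thesis ..
qed

text \<open>Printing consumes \<open>acc\<close>, which returns it to zero, as \<open>emits\<close>
  demands of a scratch register.\<close>

lemma emits_enc_nat:
  fixes p :: "nat poly"
  assumes "distinct [u, v, z, src, acc]" "{u, v, z, acc} \<subseteq> Z"
  shows "\<exists>c. emits Z c (\<lambda>w h \<rho>. enc_nat (poly p (\<rho> src)))"
proof -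
  obtain c where c: "polyrun c (\<lambda>\<rho>. \<rho> u = 0 \<and> \<rho> v = 0 \<and> \<rho> acc = 0)
    (\<lambda>w (\<rho>, h, out). (\<rho>(acc := poly p (\<rho> src)), h, out))"
    using polyrun_poly[of u v src acc p] assms(1) by auto
  obtain d where d: "polyrun d (\<lambda>\<rho>. \<rho> v = 0 \<and> \<rho> z = 0)
    (\<lambda>w (\<rho>, h, out). (\<rho>(acc := 0), h, out @ enc_nat (\<rho> acc)))"
    using polyrun_enc_nat[of v z acc] assms(1) by auto
  have c': "polyrun c (\<lambda>\<rho>. \<forall>r\<in>Z. \<rho> r = 0) (\<lambda>w (\<rho>, h, out). (\<rho>(acc := poly p (\<rho> src)), h, out))"
    by (rule polyrun_cong[OF c]) (use assms(2) in auto)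
  have "emits Z (Seq c d) (\<lambda>w h \<rho>. enc_nat (poly p (\<rho> src)))"
    unfolding emits_def
    by (rule polyrun_cong[OF polyrun_Seq[OF c' d]]) (use assms in \<open>auto simp: fun_eq_iff\<close>)
  then show ?thesis ..
qed

section \<open>Input length and initial registers\<close>

lemma word_tape_nonblank:
  "word_tape w (int i) \<in> {1, 2} \<longleftrightarrow> i < length w"
  by (simp add: word_tape_def)

text \<open>The time of this loop depends on the input length and not on the registers, so it is
  stated with \<open>reaches\<close> for the initial store. The head ends on the first
  blank.\<close>

lemma reaches_count:
  "reaches w (While (Symb [1, 2]) (Seq (MoveIn True) (Inc r))) (\<lambda>_. 0, 0, [])
    ((\<lambda>_. 0)(r := length w), int (length w), []) (length w * 4 + 1)"
proof -
  define S where "S = (\<lambda>i. ((\<lambda>_. 0 :: nat)(r := i), int i, [] :: bool list))"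
  have "reaches w (While (Symb [1, 2]) (Seq (MoveIn True) (Inc r))) (S 0) (S (length w))
      (length w * Suc (Suc (1 + 1)) + 1)"
  proof (rule reaches_While)
    show "reaches w (Seq (MoveIn True) (Inc r)) (S i) (S (Suc i)) (Suc (1 + 1))" for i
      using reaches_Seq[OF reaches_MoveIn[of w True] reaches_Inc[of w r],
          of "(\<lambda>_. 0)(r := i)" "int i" "[]"]
      by (simp add: S_def add.commute)
  qed (use word_tape_nonblank[of w] in \<open>auto simp: S_def\<close>)
  moreover have "S 0 = (\<lambda>_. 0, 0, [])" by (auto simp: S_def)
  ultimately show ?thesis by (auto simp: S_def elim!: reaches_mono)
qed

lemma polyrun_rewind:
  "polyrun (While (Pos [r]) (Seq (Dec r) (MoveIn False))) P
    (\<lambda>w (\<rho>, h, out). (\<rho>(r := 0), h - int (\<rho> r), out))"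
proof -
  define S where "S = (\<lambda>(w :: bool list) (\<rho> :: nat \<Rightarrow> nat, h, out :: bool list) i.
    (\<rho>(r := \<rho> r - i), h - int i, out))"
  have "polyrun (While (Pos [r]) (Seq (Dec r) (MoveIn False))) P (\<lambda>w s. S w s (fst s r))"
  proof (rule polyrun_While[where S = S and n = "\<lambda>\<rho>. \<rho> r"])
    show "polyrun (Seq (Dec r) (MoveIn False)) (\<lambda>_. True)
        (\<lambda>w (\<rho>, h, out). (\<rho>(r := \<rho> r - 1), h - 1, out))"
      by (rule polyrun_cong[OF polyrun_Seq[OF polyrun_Dec[of _ "\<lambda>_. True"]
            polyrun_MoveIn[of _ "\<lambda>_. True"]]]) auto
    show "fst (S w (\<rho>, h, out) i) x \<le> poly [:0, 1:] N"
      if "\<And>r. \<rho> r \<le> N" for w \<rho> h out i N x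
      using that[of r] that[of x] by (auto simp: S_def)
    show "\<rho> r \<le> poly [:0, 1:] N" if "\<And>r. \<rho> r \<le> N" for \<rho> :: "nat \<Rightarrow> nat" and N
      using that by simp
  qed (auto simp: S_def)
  then show ?thesis by (rule polyrun_cong) (auto simp: S_def)
qed

text \<open>Register 15 keeps the input length while the parameters are computed. Register 16 gets
  the length plus the value of \<open>p\<close>, which takes the head from the end of the input to
  minus that value; from there nonnegative column numbers also reach the cells left of the
  input.\<close>

theorem emits_polytime:
  fixes p q :: "nat poly"
  assumes "emits (- {1, 2, 3}) c f"
  shows "polytime_computable (\<lambda>x. f x (- int (poly p (length x)))
    ((\<lambda>_. 0)(1 := poly p (length x), 2 := poly (p + q) (length x), 3 := 2 * poly p (length x) + 1)))"
proof -
  let ?P = "\<lambda>\<rho> :: nat \<Rightarrow> nat. \<forall>r. r \<noteq> 15 \<longrightarrow> \<rho> r = 0"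
  have ev: "\<exists>c. polyrun c (\<lambda>\<rho>. \<rho> 0 = 0 \<and> \<rho> 12 = 0 \<and> \<rho> r = 0)
      (\<lambda>w (\<rho>, h, out). (\<rho>(r := poly g (\<rho> 15)), h, out))" if "r \<in> {1, 2, 3, 16}" for r g
    using polyrun_poly[of 0 12 15 r g] that by auto
  obtain c1 where c1: "polyrun c1 (\<lambda>\<rho>. \<rho> 0 = 0 \<and> \<rho> 12 = 0 \<and> \<rho> 1 = 0)
      (\<lambda>w (\<rho>, h, out). (\<rho>(1 := poly p (\<rho> 15)), h, out))" using ev[of 1 p] by auto
  obtain c2 where c2: "polyrun c2 (\<lambda>\<rho>. \<rho> 0 = 0 \<and> \<rho> 12 = 0 \<and> \<rho> 2 = 0)
      (\<lambda>w (\<rho>, h, out). (\<rho>(2 := poly (p + q) (\<rho> 15)), h, out))" using ev[of 2 "p + q"] by auto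
  obtain c3 where c3: "polyrun c3 (\<lambda>\<rho>. \<rho> 0 = 0 \<and> \<rho> 12 = 0 \<and> \<rho> 3 = 0)
      (\<lambda>w (\<rho>, h, out). (\<rho>(3 := poly (2 * p + 1) (\<rho> 15)), h, out))" using ev[of 3 "2 * p + 1"] by auto
  obtain c4 where c4: "polyrun c4 (\<lambda>\<rho>. \<rho> 0 = 0 \<and> \<rho> 12 = 0 \<and> \<rho> 16 = 0)
      (\<lambda>w (\<rho>, h, out). (\<rho>(16 := poly (p + [:0, 1:]) (\<rho> 15)), h, out))"
    using ev[of 16 "p + [:0, 1:]"] by auto
  let ?rewind = "While (Pos [16]) (Seq (Dec 16) (MoveIn False))"
  let ?rest = "Seq c1 (Seq c2 (Seq c3 (Seq c4 (Seq ?rewind (Seq (drain 15 []) c)))))"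
  define reg where "reg = (\<lambda>n. (\<lambda>_ :: nat. 0 :: nat)(1 := poly p n, 2 := poly (p + q) n, 3 := 2 * poly p n + 1))"
  have d: "polyrun (drain 15 []) (\<lambda>_. True) (\<lambda>w (\<rho>, h, out). (drained 15 [] \<rho>, h, out))"
    by (rule polyrun_drain) simp
  have d': "polyrun (drain 15 []) (\<lambda>\<rho>. \<forall>r. r \<notin> {1, 2, 3, 15} \<longrightarrow> \<rho> r = 0)
      (\<lambda>w (\<rho>, h, out). (\<rho>(15 := 0), h, out))"
    by (rule polyrun_cong[OF d]) (auto simp: drained_def fun_eq_iff)
  have s6: "polyrun (Seq (drain 15 []) c) (\<lambda>\<rho>. \<forall>r. r \<notin> {1, 2, 3, 15} \<longrightarrow> \<rho> r = 0)
      (\<lambda>w (\<rho>, h, out). (\<rho>(15 := 0), h, out @ f w h (\<rho>(15 := 0))))"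
    by (rule polyrun_cong[OF polyrun_Seq[OF d' assms[unfolded emits_def]]]) auto
  have s5: "polyrun (Seq ?rewind (Seq (drain 15 []) c)) (\<lambda>\<rho>. \<forall>r. r \<notin> {1, 2, 3, 15, 16} \<longrightarrow> \<rho> r = 0)
      (\<lambda>w (\<rho>, h, out). (\<rho>(16 := 0, 15 := 0), h - int (\<rho> 16),
        out @ f w (h - int (\<rho> 16)) (\<rho>(16 := 0, 15 := 0))))"
    by (rule polyrun_cong[OF polyrun_Seq[OF polyrun_rewind[where P =
          "\<lambda>\<rho>. \<forall>r. r \<notin> {1, 2, 3, 15, 16} \<longrightarrow> \<rho> r = 0"] s6]]) auto
  have s: "polyrun ?rest ?P (\<lambda>w (\<rho>, h, out).
      (reg (\<rho> 15), h - int (poly p (\<rho> 15) + \<rho> 15),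
       out @ f w (h - int (poly p (\<rho> 15) + \<rho> 15)) (reg (\<rho> 15))))"
  proof -
    have e: "\<rho>(1 := a, 2 := b, 3 := c, 16 := 0, 15 := 0) = (\<lambda>_. 0)(1 := a, 2 := b, 3 := c)"
      if "?P \<rho>" for \<rho> a b c using that by (auto simp: fun_eq_iff)
    show ?thesis
      by (rule polyrun_cong[OF polyrun_Seq[OF polyrun_cong[OF c1, of ?P, OF _ refl]
            polyrun_Seq[OF polyrun_cong[OF c2, of "\<lambda>\<rho>. \<forall>r. r \<notin> {1, 15} \<longrightarrow> \<rho> r = 0", OF _ refl]
            polyrun_Seq[OF polyrun_cong[OF c3, of "\<lambda>\<rho>. \<forall>r. r \<notin> {1, 2, 15} \<longrightarrow> \<rho> r = 0", OF _ refl]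
            polyrun_Seq[OF polyrun_cong[OF c4, of "\<lambda>\<rho>. \<forall>r. r \<notin> {1, 2, 3, 15} \<longrightarrow> \<rho> r = 0", OF _ refl]
            s5]]]]])
        (auto simp: reg_def e fun_eq_iff intro!: arg_cong[where f = "f w' h'" for w' h'])
  qed
  obtain t :: "nat poly" where t: "\<And>w s N. ?P (fst s) \<Longrightarrow> (\<And>r. fst s r \<le> N) \<Longrightarrow> reaches w ?rest s
      (case s of (\<rho>, h, out) \<Rightarrow> (reg (\<rho> 15), h - int (poly p (\<rho> 15) + \<rho> 15),
       out @ f w (h - int (poly p (\<rho> 15) + \<rho> 15)) (reg (\<rho> 15)))) (poly t N)"
    by (rule polyrunE[OF s], rule that) blast
  have "reaches x (Seq (While (Symb [1, 2]) (Seq (MoveIn True) (Inc 15))) ?rest) (\<lambda>_. 0, 0, [])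
      (reg (length x), - int (poly p (length x)), f x (- int (poly p (length x))) (reg (length x)))
      (poly ([:2, 4:] + t) (length x))" for x
  proof -
    have "reaches x ?rest ((\<lambda>_. 0)(15 := length x), int (length x), [])
        (reg (length x), - int (poly p (length x)), f x (- int (poly p (length x))) (reg (length x)))
        (poly t (length x))"
    proof -
      let ?s = "((\<lambda>_. 0)(15 := length x), int (length x), []) :: store"
      have "reaches x ?rest ?s
        (case ?s of (\<rho>, h, out) \<Rightarrow> (reg (\<rho> 15), h - int (poly p (\<rho> 15) + \<rho> 15),
         out @ f x (h - int (poly p (\<rho> 15) + \<rho> 15)) (reg (\<rho> 15)))) (poly t (length x))"
        by (rule t) simp_all
      then show ?thesis by (simp only: prod.case fun_upd_same append_Nil) simp
    qed
    from reaches_Seq[OF reaches_count this] show ?thesis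
      by (rule reaches_mono) simp
  qed
  then show ?thesis unfolding reg_def by (intro com_polytime) blast
qed

section \<open>The tableau\<close>

text \<open>\<open>Mv i d\<close> is an auxiliary variable: tape \<open>i\<close> moves by
  \<open>d\<close> in this step. It separates the choice of the move, which depends on all scanned
  symbols, from the shift of the tape, so that a shifted cell needs only a clause of three
  literals.\<close>

datatype kind = Cell nat nat | State nat | Mv nat move

text \<open>
  Positions are relative to the heads: column p of a tape holds the cell at distance p - H
  from the head, so that a move shifts the whole tape.  An offset e stands for e - 1.
\<close>

datatype loc = Rel nat | Cen nat

fun locate :: "nat \<Rightarrow> nat \<Rightarrow> loc \<Rightarrow> nat" where
  "locate H p (Rel e) = p + e - 1"
| "locate H p (Cen e) = H + e - 1"

text \<open>A clause scheme is instantiated at all times and columns of the tableau, and its guard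
  selects the instances that count. \<open>GNe e\<close> leaves out the column whose source
  \<open>p + e - 1\<close> is the centre, because it receives the newly written symbol.\<close>

datatype guard = GTrue | GInit | GSym nat | GLeft | GRight | GEnd | GNe nat | GFinal

fun gsem :: "guard \<Rightarrow> bool list \<Rightarrow> nat \<Rightarrow> nat \<Rightarrow> nat \<Rightarrow> nat \<Rightarrow> bool" where
  "gsem GTrue x H E t p \<longleftrightarrow> True"
| "gsem GInit x H E t p \<longleftrightarrow> t = 0"
| "gsem (GSym a) x H E t p \<longleftrightarrow> t = 0 \<and> word_tape x (int p - int H) = a"
| "gsem GLeft x H E t p \<longleftrightarrow> t = 0 \<and> p < H"
| "gsem GRight x H E t p \<longleftrightarrow> t = 0 \<and> H \<le> p"
| "gsem GEnd x H E t p \<longleftrightarrow> t = 0 \<and> p = E"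
| "gsem (GNe e) x H E t p \<longleftrightarrow> p + e \<noteq> H + 1"
| "gsem GFinal x H E t p \<longleftrightarrow> t + 1 = H"

type_synonym literal = "bool \<times> kind \<times> nat \<times> loc"

text \<open>After a move to the right, column \<open>p\<close> shows what stood in column
  \<open>p + 1\<close>, which is offset 2; dually for a move to the left.\<close>

fun off :: "move \<Rightarrow> nat" where
  "off MoveLeft = 0"
| "off Stay = 1"
| "off MoveRight = 2"

definition moves :: "move list" where
  "moves = [MoveLeft, Stay, MoveRight]"

lemma set_moves [simp]: "set moves = UNIV"
  unfolding moves_def by (auto intro: move.exhaust)

lemma off_le: "off d \<le> 2"
  by (cases d) auto

text \<open>Extended by the identity to the halting states, so that the transition clauses also
  carry a halted configuration on to the final time.\<close>

definition delta :: "tm \<Rightarrow> nat \<Rightarrow> nat list \<Rightarrow> nat \<times> (nat \<times> move) list" where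
  "delta M q as = (if q = accept_state M \<or> q = reject_state M then (q, map (\<lambda>a. (a, Stay)) as)
     else transition M q as)"

definition kinds :: "tm \<Rightarrow> kind list" where
  "kinds M = remdups ([Cell i a. i \<leftarrow> [0..<num_tapes M], a \<leftarrow> [0..<num_symbols M]] @
     map State [0..<num_states M] @ [Mv i d. i \<leftarrow> [0..<num_tapes M], d \<leftarrow> moves])"

text \<open>Negated because these are the premises of an implication; the literals of
  \<open>acting\<close> are its conclusions, each in a clause of its own.\<close>

definition reading :: "tm \<Rightarrow> nat \<Rightarrow> nat list \<Rightarrow> literal list" where
  "reading M q as =
     (False, State q, 0, Cen 1) # map (\<lambda>i. (False, Cell i (as ! i), 0, Cen 1)) [0..<num_tapes M]"

text \<open>After a move with offset \<open>o\<close> the cell just written is in column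
  \<open>H + 1 - o\<close>, and \<open>Cen e\<close> stands for \<open>H + e - 1\<close>, whence the
  argument \<open>2 - o\<close>.\<close>

definition acting :: "tm \<Rightarrow> nat \<Rightarrow> nat list \<Rightarrow> literal list" where
  "acting M q as = (case delta M q as of (q', ws) \<Rightarrow>
     (True, State q', 1, Cen 1) #
     map (\<lambda>i. (True, Mv i (snd (ws ! i)), 0, Cen 1)) [0..<num_tapes M] @
     map (\<lambda>i. (True, Cell i (fst (ws ! i)), 1, Cen (2 - off (snd (ws ! i))))) [0..<num_tapes M])"

text \<open>At time 0 tape 0 carries the input, and the tapes from 2 on are blank. On tape 1 the
  columns from the centre on are left open, which is the guess of the certificate: each shows one of
  the three symbols, \<open>E\<close> is blank, and a blank is not followed by a bit.\<close>

definition clauses :: "tm \<Rightarrow> (guard \<times> literal list) list" where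
  "clauses M =
     [(GSym a, [(True, Cell 0 a, 0, Rel 1)]). a \<leftarrow> [0..<3]] @
     [(GInit, [(True, Cell i 0, 0, Rel 1)]). i \<leftarrow> [2..<num_tapes M]] @
     [(GLeft, [(True, Cell 1 0, 0, Rel 1)]),
      (GEnd, [(True, Cell 1 0, 0, Rel 1)]),
      (GInit, [(True, Cell 1 0, 0, Rel 1), (True, Cell 1 1, 0, Rel 1), (True, Cell 1 2, 0, Rel 1)]),
      (GRight, [(False, Cell 1 0, 0, Rel 1), (False, Cell 1 1, 0, Rel 2)]),
      (GRight, [(False, Cell 1 0, 0, Rel 1), (False, Cell 1 2, 0, Rel 2)]),
      (GInit, [(True, State (start_state M), 0, Cen 1)]),
      (GFinal, [(False, State (reject_state M), 0, Cen 1)])] @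
     [(GTrue, reading M q as @ [l]). q \<leftarrow> [0..<num_states M],
        as \<leftarrow> List.n_lists (num_tapes M) [0..<num_symbols M], l \<leftarrow> acting M q as] @
     [(GNe (off d), [(False, Mv i d, 0, Cen 1), (False, Cell i a, 0, Rel (off d)),
        (True, Cell i a, 1, Rel 1)]).
        i \<leftarrow> [0..<num_tapes M], d \<leftarrow> moves, a \<leftarrow> [0..<num_symbols M]]"

lemma ball_clauses:
  "(\<forall>c\<in>set (clauses M). P c) \<longleftrightarrow>
     (\<forall>a<3. P (GSym a, [(True, Cell 0 a, 0, Rel 1)])) \<and>
     (\<forall>i<num_tapes M. 2 \<le> i \<longrightarrow> P (GInit, [(True, Cell i 0, 0, Rel 1)])) \<and>
     P (GLeft, [(True, Cell 1 0, 0, Rel 1)]) \<and>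
     P (GEnd, [(True, Cell 1 0, 0, Rel 1)]) \<and>
     P (GInit, [(True, Cell 1 0, 0, Rel 1), (True, Cell 1 1, 0, Rel 1), (True, Cell 1 2, 0, Rel 1)]) \<and>
     P (GRight, [(False, Cell 1 0, 0, Rel 1), (False, Cell 1 1, 0, Rel 2)]) \<and>
     P (GRight, [(False, Cell 1 0, 0, Rel 1), (False, Cell 1 2, 0, Rel 2)]) \<and>
     P (GInit, [(True, State (start_state M), 0, Cen 1)]) \<and>
     P (GFinal, [(False, State (reject_state M), 0, Cen 1)]) \<and>
     (\<forall>q<num_states M. \<forall>as. length as = num_tapes M \<longrightarrow> set as \<subseteq> {..<num_symbols M} \<longrightarrow>
        (\<forall>l\<in>set (acting M q as). P (GTrue, reading M q as @ [l]))) \<and>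
     (\<forall>i<num_tapes M. \<forall>d. \<forall>a<num_symbols M. P (GNe (off d),
        [(False, Mv i d, 0, Cen 1), (False, Cell i a, 0, Rel (off d)), (True, Cell i a, 1, Rel 1)]))"
  unfolding clauses_def
  by (simp add: ball_Un set_n_lists atLeast0LessThan imp_conjL)
    (simp add: Ball_def conj_ac imp_conjL)

text \<open>The margins keep \<open>t + 1\<close>, \<open>p - 1\<close> and \<open>p + 1\<close>
  between 0 and \<open>2 * H\<close>, the digits of base \<open>2 * H + 1\<close>.\<close>

definition active :: "guard \<Rightarrow> bool list \<Rightarrow> nat \<Rightarrow> nat \<Rightarrow> nat \<Rightarrow> nat \<Rightarrow> bool" where
  "active g x H E t p \<longleftrightarrow> t < 2 * H \<and> 0 < p \<and> p < 2 * H \<and> gsem g x H E t p"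

definition clause_holds :: "(kind \<Rightarrow> nat \<Rightarrow> nat \<Rightarrow> bool) \<Rightarrow> bool list \<Rightarrow> nat \<Rightarrow> nat \<Rightarrow>
    guard \<times> literal list \<Rightarrow> bool" where
  "clause_holds \<alpha> x H E = (\<lambda>(g, ls). \<forall>t p. active g x H E t p \<longrightarrow>
     (\<exists>(s, k, dt, l)\<in>set ls. \<alpha> k (t + dt) (locate H p l) = s))"

locale verifier =
  fixes M :: tm
  assumes wf: "wf_tm M" and two_tapes: "2 \<le> num_tapes M"
begin

abbreviation "K \<equiv> num_tapes M"
abbreviation "S \<equiv> num_symbols M"
abbreviation "Q \<equiv> num_states M"

lemma delta_wf:
  assumes "q < Q" "length as = K" "set as \<subseteq> {..<S}"
  shows "fst (delta M q as) < Q" "length (snd (delta M q as)) = K"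
    "i < K \<Longrightarrow> fst (snd (delta M q as) ! i) < S"
proof -
  have *: "fst (delta M q as) < Q \<and> length (snd (delta M q as)) = K \<and>
      fst ` set (snd (delta M q as)) \<subseteq> {..<S}"
  proof (cases "q = accept_state M \<or> q = reject_state M")
    case True
    then show ?thesis using assms by (auto simp: delta_def)
  next
    case False
    then show ?thesis using wf assms by (fastforce simp: wf_tm_def delta_def)
  qed
  then show "fst (delta M q as) < Q" "length (snd (delta M q as)) = K" by auto
  assume "i < K"
  then have "snd (delta M q as) ! i \<in> set (snd (delta M q as))" using * by simp
  then show "fst (snd (delta M q as) ! i) < S" using * by blast
qed

lemma step_delta:
  assumes "length ts = K"
  shows "step M (q, ts) = (fst (delta M q (map (\<lambda>(f, h). f h) ts)),
    map2 act (snd (delta M q (map (\<lambda>(f, h). f h) ts))) ts)"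
proof -
  have "map2 act (map (\<lambda>a. (a, Stay)) (map (\<lambda>(f, h). f h) ts)) ts = ts"
    by (rule nth_equalityI) (auto split: prod.splits)
  then show ?thesis by (auto simp: delta_def split: prod.splits)
qed

section \<open>Configurations as seen from the heads\<close>

definition state :: "bool list \<Rightarrow> bool list \<Rightarrow> nat \<Rightarrow> nat" where
  "state x y t = fst (run M [x, y] t)"

definition cell :: "bool list \<Rightarrow> bool list \<Rightarrow> nat \<Rightarrow> nat \<Rightarrow> int \<Rightarrow> nat" where
  "cell x y t i z = (case snd (run M [x, y] t) ! i of (f, h) \<Rightarrow> f (h + z))"

definition response :: "bool list \<Rightarrow> bool list \<Rightarrow> nat \<Rightarrow> nat \<times> (nat \<times> move) list" where
  "response x y t = delta M (state x y t) (map (\<lambda>i. cell x y t i 0) [0..<K])"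

lemma run_wf:
  "state x y t < Q \<and> length (snd (run M [x, y] t)) = K \<and> (\<forall>i<K. \<forall>z. cell x y t i z < S)"
proof (induction t)
  case 0
  have "word_tape w z < S" for w z using wf by (auto simp: word_tape_def wf_tm_def)
  then show ?case using wf by (auto simp: state_def cell_def run_def initial_def wf_tm_def)
next
  case (Suc t)
  obtain q ts where qt: "run M [x, y] t = (q, ts)" by fastforce
  let ?as = "map (\<lambda>(f, h). f h) ts"
  have ts: "length ts = K" using Suc qt by simp
  have sym: "fst (ts ! i) z < S" if "i < K" for i z
  proof -
    have "cell x y t i (z - snd (ts ! i)) < S" using Suc that by blast
    then show ?thesis by (simp add: cell_def qt split: prod.splits)
  qed
  have as: "set ?as \<subseteq> {..<S}"
    using sym ts by (force simp: set_conv_nth split: prod.splits)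
  have q: "q < Q" using Suc qt by (simp add: state_def)
  note d = delta_wf[OF q _ as]
  have r: "run M [x, y] (Suc t) = (fst (delta M q ?as), map2 act (snd (delta M q ?as)) ts)"
    using step_delta[OF ts] qt by (simp add: run_def)
  have "cell x y (Suc t) i z < S" if i: "i < K" for i z
  proof -
    obtain a mv where w: "snd (delta M q ?as) ! i = (a, mv)" by fastforce
    obtain f h where fh: "ts ! i = (f, h)" by fastforce
    have "a < S" using d(3)[of i] i ts w by simp
    moreover have "f z < S" for z using sym[OF i, of z] fh by simp
    ultimately show ?thesis using i ts d(2) w fh by (simp add: cell_def r)
  qed
  then show ?case using d ts by (simp add: state_def r)
qed

text \<open>A cell at distance \<open>z\<close> from the new head was at distance
  \<open>z + off d - 1\<close> from the old one, and distance 0 is where the machine wrote.\<close>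

lemma step_state: "state x y (Suc t) = fst (response x y t)"
  and step_cell: "i < K \<Longrightarrow> cell x y (Suc t) i z =
    (let (a, d) = snd (response x y t) ! i; z' = z + int (off d) - 1
     in if z' = 0 then a else cell x y t i z')"
proof -
  obtain q ts where qt: "run M [x, y] t = (q, ts)" by fastforce
  let ?as = "map (\<lambda>(f, h). f h) ts"
  have ts: "length ts = K" using run_wf[of x y t] qt by simp
  have as: "map (\<lambda>i. cell x y t i 0) [0..<K] = ?as"
    using ts qt by (intro nth_equalityI) (auto simp: cell_def split: prod.splits)
  have res: "response x y t = delta M q ?as"
    using qt by (simp add: response_def as state_def)
  have r: "run M [x, y] (Suc t) = (fst (delta M q ?as), map2 act (snd (delta M q ?as)) ts)"
    using step_delta[OF ts] qt by (simp add: run_def)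
  show "state x y (Suc t) = fst (response x y t)" by (simp add: state_def r res)
  assume i: "i < K"
  have len: "length (snd (delta M q ?as)) = K"
  proof (rule delta_wf)
    show "q < Q" using run_wf[of x y t] qt by (simp add: state_def)
    show "set ?as \<subseteq> {..<S}" unfolding as[symmetric] using run_wf[of x y t] by auto
  qed (use ts in simp)
  obtain a d where w: "snd (delta M q ?as) ! i = (a, d)" by fastforce
  obtain f h where fh: "ts ! i = (f, h)" by fastforce
  show "cell x y (Suc t) i z = (let (a, d) = snd (response x y t) ! i; z' = z + int (off d) - 1
     in if z' = 0 then a else cell x y t i z')"
    using i ts len w fh by (cases d) (auto simp: cell_def r res qt algebra_simps)
qed

lemma initial_state: "state x y 0 = start_state M"
  by (simp add: state_def run_def initial_def)

lemma initial_cell: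
  "i < K \<Longrightarrow> cell x y 0 i z = word_tape (if i = 0 then x else if i = 1 then y else []) z"
  by (auto simp: cell_def run_def initial_def nth_Cons')

text \<open>The intended model. States and moves have no position; the clauses refer to them in the
  centre column.\<close>

fun trace :: "bool list \<Rightarrow> bool list \<Rightarrow> nat \<Rightarrow> kind \<Rightarrow> nat \<Rightarrow> nat \<Rightarrow> bool" where
  "trace x y H (Cell i a) t p \<longleftrightarrow> cell x y t i (int p - int H) = a"
| "trace x y H (State q) t p \<longleftrightarrow> state x y t = q"
| "trace x y H (Mv i d) t p \<longleftrightarrow> snd (snd (response x y t) ! i) = d"

lemma trace_clauses:
  assumes y: "length y \<le> L" and E: "E = H + L" and H: "state x y (H - 1) \<noteq> reject_state M"
  shows "\<forall>c\<in>set (clauses M). clause_holds (trace x y H) x H E c"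
  unfolding ball_clauses
proof (intro conjI allI impI ballI)
  have K: "0 < K" "1 < K" using two_tapes by auto
  have y_cell: "cell x y 0 1 z = word_tape y z" for z using K by (simp add: initial_cell)
  show "clause_holds (trace x y H) x H E (GSym a, [(True, Cell 0 a, 0, Rel 1)])" for a
    using K by (auto simp: clause_holds_def active_def initial_cell)
  show "clause_holds (trace x y H) x H E (GInit, [(True, Cell i 0, 0, Rel 1)])"
    if "2 \<le> i" "i < K" for i
    using that by (auto simp: clause_holds_def active_def initial_cell word_tape_def)
  show "clause_holds (trace x y H) x H E (GLeft, [(True, Cell 1 0, 0, Rel 1)])"
    using y_cell by (auto simp: clause_holds_def active_def word_tape_def)
  show "clause_holds (trace x y H) x H E (GEnd, [(True, Cell 1 0, 0, Rel 1)])"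
    using y_cell y E by (auto simp: clause_holds_def active_def word_tape_def)
  have "word_tape w z = 0 \<or> word_tape w z = 1 \<or> word_tape w z = 2" for w z
    by (simp add: word_tape_def)
  then show "clause_holds (trace x y H) x H E
      (GInit, [(True, Cell 1 0, 0, Rel 1), (True, Cell 1 1, 0, Rel 1), (True, Cell 1 2, 0, Rel 1)])"
    using y_cell by (auto simp: clause_holds_def active_def)
  \<comment> \<open>A word has no blanks inside, so from the centre on a blank is followed by
    blanks.\<close>
  have "word_tape y (1 + int p - int H) = 0" if "word_tape y (int p - int H) = 0" "H \<le> p" for p
    using that by (auto simp: word_tape_def split: if_splits)
  then have right: "clause_holds (trace x y H) x H E
      (GRight, [(False, Cell 1 0, 0, Rel 1), (False, Cell 1 b, 0, Rel 2)])" if "b \<noteq> 0" for b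
    using y_cell that by (fastforce simp: clause_holds_def active_def)
  show "clause_holds (trace x y H) x H E
      (GRight, [(False, Cell 1 0, 0, Rel 1), (False, Cell 1 1, 0, Rel 2)])" by (rule right) simp
  show "clause_holds (trace x y H) x H E
      (GRight, [(False, Cell 1 0, 0, Rel 1), (False, Cell 1 2, 0, Rel 2)])" by (rule right) simp
  show "clause_holds (trace x y H) x H E (GInit, [(True, State (start_state M), 0, Cen 1)])"
    by (auto simp: clause_holds_def active_def initial_state)
  show "clause_holds (trace x y H) x H E (GFinal, [(False, State (reject_state M), 0, Cen 1)])"
    using H by (auto simp: clause_holds_def active_def)
  show "clause_holds (trace x y H) x H E (GTrue, reading M q as @ [l])"
    if as: "length as = K" and l: "l \<in> set (acting M q as)" for q as l
    unfolding clause_holds_def prod.case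
  proof (intro allI impI)
    fix t p assume act: "active GTrue x H E t p"
    show "\<exists>(s, k, dt, l)\<in>set (reading M q as @ [l]). trace x y H k (t + dt) (locate H p l) = s"
    \<comment> \<open>If all premises hold, the scanned symbols are \<open>as\<close> and
      \<open>delta M q as\<close> is the actual response; otherwise a negated premise satisfies the
      clause.\<close>
    proof (cases "\<forall>(s, k, dt, l)\<in>set (reading M q as). trace x y H k (t + dt) (locate H p l)")
      case True
      then have q: "state x y t = q" and "\<forall>i<K. cell x y t i 0 = as ! i"
        by (auto simp: reading_def)
      then have "map (\<lambda>i. cell x y t i 0) [0..<K] = as"
        using as by (intro nth_equalityI) auto
      then have r: "response x y t = delta M q as" using q by (simp add: response_def)
      obtain q' ws where d: "delta M q as = (q', ws)" by fastforce
      have "cell x y (Suc t) i (int (H + (2 - off (snd (ws ! i))) - 1) - int H) = fst (ws ! i)"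
        if "i < K" for i
        using that act by (cases "ws ! i"; cases "snd (ws ! i)")
          (auto simp: step_cell r d active_def of_nat_diff)
      then show ?thesis using l by (auto simp: acting_def d r step_state)
    next
      case False
      then show ?thesis by (auto simp: reading_def)
    qed
  qed
  show "clause_holds (trace x y H) x H E (GNe (off d),
      [(False, Mv i d, 0, Cen 1), (False, Cell i a, 0, Rel (off d)), (True, Cell i a, 1, Rel 1)])"
    if i: "i < K" for i d a
    unfolding clause_holds_def prod.case
  proof (intro allI impI)
    fix t p assume act: "active (GNe (off d)) x H E t p"
    have "cell x y (Suc t) i (int p - int H) = cell x y t i (int (p + off d - 1) - int H)"
      if "snd (snd (response x y t) ! i) = d"
      using i act that by (cases "snd (response x y t) ! i")
        (auto simp: step_cell active_def of_nat_diff algebra_simps)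
    then show "\<exists>(s, k, dt, l)\<in>set [(False, Mv i d, 0, Cen 1), (False, Cell i a, 0, Rel (off d)),
        (True, Cell i a, 1, Rel 1)]. trace x y H k (t + dt) (locate H p l) = s" by auto
  qed
qed

text \<open>A model determines y and, by induction on t, contains the trace of the run on x and y.\<close>

lemma model_imp_accepting:
  assumes sat: "\<forall>c\<in>set (clauses M). clause_holds \<alpha> x H E c" and E: "E = H + L" and L: "L < H"
  obtains y where "length y \<le> L" "state x y (H - 1) \<noteq> reject_state M"
proof -
  have K: "0 < K" "1 < K" using two_tapes by auto
  note sat' = sat[unfolded ball_clauses]
  have holds: "\<exists>(s, k, dt, l)\<in>set ls. \<alpha> k (t + dt) (locate H p l) = s"
    if "clause_holds \<alpha> x H E (g, ls)" "active g x H E t p" for g ls t p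
    using that by (auto simp: clause_holds_def)
  let ?c = "\<lambda>a j. \<alpha> (Cell 1 a) 0 (H + j)"
  have E0: "?c 0 L"
    using holds[of GEnd "[(True, Cell 1 0, 0, Rel 1)]" 0 E] sat' L by (simp add: active_def E)
  \<comment> \<open>The certificate ends at the first column, counted from the centre, where the
    model admits a blank; \<open>GEnd\<close> bounds its length by \<open>L\<close>.\<close>
  define n where "n = (LEAST j. ?c 0 j)"
  have n: "?c 0 n" "n \<le> L" unfolding n_def using E0 by (rule LeastI, rule Least_le)
  have before: "\<not> ?c 0 j" if "j < n" for j using that not_less_Least n_def by blast
  \<comment> \<open>Symbol 2 is the bit True. Where the model denies 2 before \<open>n\<close> it
    admits 1, since it denies 0 there and admits one of the three.\<close>
  define y where "y = map (\<lambda>j. ?c 2 j) [0..<n]"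
  have some: "?c 0 j \<or> ?c 1 j \<or> ?c 2 j" if "j < H" for j
    using holds[of GInit "[(True, Cell 1 0, 0, Rel 1), (True, Cell 1 1, 0, Rel 1), (True, Cell 1 2, 0, Rel 1)]"
        0 "H + j"] that sat' by (simp add: active_def)
  have blank: "?c 0 j" if "n \<le> j" "j < H" for j
    using that
  proof (induction j rule: dec_induct)
    case (step j)
    have "\<not> ?c b (Suc j)" if "b = 1 \<or> b = 2" for b
      using holds[of GRight "[(False, Cell 1 0, 0, Rel 1), (False, Cell 1 b, 0, Rel 2)]" 0 "H + j"]
        step that sat' by (auto simp: active_def)
    then show ?case using some[of "Suc j"] step by auto
  qed (use n in simp)
  have y_cell: "\<alpha> (Cell 1 (word_tape y (int p - int H))) 0 p" if p: "0 < p" "p < 2 * H" for p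
  proof (cases "p < H")
    case True
    then show ?thesis
      using holds[of GLeft "[(True, Cell 1 0, 0, Rel 1)]" 0 p] p sat'
      by (simp add: active_def word_tape_def)
  next
    case False
    then obtain j where j: "p = H + j" "j < H" using p by (metis add_less_cancel_left le_Suc_ex mult_2 not_less)
    show ?thesis
    proof (cases "j < n")
      case True
      then show ?thesis using some[OF j(2)] before[OF True] j by (auto simp: word_tape_def y_def)
    next
      case False
      then show ?thesis using blank[of j] j by (simp add: word_tape_def y_def)
    qed
  qed
  \<comment> \<open>The range of columns loses one at either end per step, since a shift draws on a
    neighbour. As long as \<open>t < H\<close> the centre is among them.\<close>
  have trace: "\<alpha> (State (state x y t)) t H \<and>
      (\<forall>i<K. \<forall>p. t < p \<longrightarrow> p + t < 2 * H \<longrightarrow> \<alpha> (Cell i (cell x y t i (int p - int H))) t p)"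
    if "t < H" for t
    using that
  proof (induction t)
    case 0
    have "\<alpha> (State (start_state M)) 0 H"
      using holds[of GInit "[(True, State (start_state M), 0, Cen 1)]" 0 H] 0 sat'
      by (simp add: active_def)
    moreover have "\<alpha> (Cell i (cell x y 0 i (int p - int H))) 0 p"
      if i: "i < K" and p: "0 < p" "p < 2 * H" for i p
    proof -
      consider "i = 0" | "i = 1" | "2 \<le> i" by linarith
      then show ?thesis
      proof cases
        case 1
        define a where "a = word_tape x (int p - int H)"
        have "a < 3" by (simp add: a_def word_tape_def)
        then have "clause_holds \<alpha> x H E (GSym a, [(True, Cell 0 a, 0, Rel 1)])" using sat' by blast
        from holds[OF this, of 0 p] show ?thesis
          using 1 i p by (simp add: initial_cell active_def a_def)
      next
        case 2
        then show ?thesis using i y_cell[OF p] by (simp add: initial_cell)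
      next
        case 3
        then have "clause_holds \<alpha> x H E (GInit, [(True, Cell i 0, 0, Rel 1)])" using i sat' by blast
        moreover have "word_tape [] z = 0" for z by (simp add: word_tape_def)
        ultimately show ?thesis
          using holds[of GInit _ 0 p] 3 i p by (fastforce simp: initial_cell active_def)
      qed
    qed
    ultimately show ?case by (simp add: initial_state)
  next
    case (Suc t)
    then have IH: "\<alpha> (State (state x y t)) t H"
      "\<And>i p. i < K \<Longrightarrow> t < p \<Longrightarrow> p + t < 2 * H \<Longrightarrow> \<alpha> (Cell i (cell x y t i (int p - int H))) t p"
      by auto
    define as where "as = map (\<lambda>i. cell x y t i 0) [0..<K]"
    obtain q' ws where d: "delta M (state x y t) as = (q', ws)" by fastforce
    then have r: "response x y t = (q', ws)" by (simp add: response_def as_def)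
    have acts: "case l of (s, k, dt, l) \<Rightarrow> \<alpha> k (t + dt) (locate H H l) = s"
      if l: "l \<in> set (acting M (state x y t) as)" for l
    proof -
      have "length as = K" "set as \<subseteq> {..<S}" "state x y t < Q"
        using run_wf[of x y t] by (auto simp: as_def)
      then have "clause_holds \<alpha> x H E (GTrue, reading M (state x y t) as @ [l])" using l sat' by blast
      moreover have "active GTrue x H E t H" using Suc.prems by (simp add: active_def)
      ultimately have "\<exists>(s, k, dt, l)\<in>set (reading M (state x y t) as @ [l]).
          \<alpha> k (t + dt) (locate H H l) = s" by (rule holds)
      moreover have "\<alpha> (Cell i (as ! i)) t H" if "i < K" for i
        using IH(2)[OF that, of H] that Suc.prems by (simp add: as_def)
      ultimately show ?thesis using IH(1) by (auto simp: reading_def)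
    qed
    have st: "\<alpha> (State q') (Suc t) H"
      using acts[of "(True, State q', 1, Cen 1)"] by (simp add: acting_def d)
    have mv: "\<alpha> (Mv i (snd (ws ! i))) t H" if "i < K" for i
      using acts[of "(True, Mv i (snd (ws ! i)), 0, Cen 1)"] that by (simp add: acting_def d)
    have wr: "\<alpha> (Cell i (fst (ws ! i))) (Suc t) (H + (2 - off (snd (ws ! i))) - 1)" if "i < K" for i
      using acts[of "(True, Cell i (fst (ws ! i)), 1, Cen (2 - off (snd (ws ! i))))"] that
      by (simp add: acting_def d)
    have "\<alpha> (Cell i (cell x y (Suc t) i (int p - int H))) (Suc t) p"
      if i: "i < K" and p: "Suc t < p" "p + Suc t < 2 * H" for i p
    proof -
      obtain a mv' where w: "ws ! i = (a, mv')" by fastforce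
      show ?thesis
      \<comment> \<open>In this case column \<open>p\<close> shows the cell just written; otherwise
        it shows the old content of column \<open>p + off mv' - 1\<close>.\<close>
      proof (cases "p + off mv' = H + 1")
        case True
        then have "int p - int H + int (off mv') - 1 = 0" by linarith
        moreover have p': "H + (2 - off mv') - 1 = p" using True off_le[of mv'] p by linarith
        have "\<alpha> (Cell i a) (Suc t) p" using wr[OF i] unfolding w fst_conv snd_conv p' .
        ultimately show ?thesis by (simp add: step_cell i r w)
      next
        case False
        define b where "b = cell x y t i (int (p + off mv' - 1) - int H)"
        have "int p - int H + int (off mv') - 1 \<noteq> 0" using False by linarith
        moreover have "int p - int H + int (off mv') - 1 = int (p + off mv' - 1) - int H"
          using p by linarith
        ultimately have b: "cell x y (Suc t) i (int p - int H) = b"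
          unfolding b_def step_cell[OF i] r snd_conv w Let_def prod.case by presburger
        have "b < S" using run_wf[of x y t] i by (simp add: b_def)
        then have "clause_holds \<alpha> x H E (GNe (off mv'), [(False, Mv i mv', 0, Cen 1),
            (False, Cell i b, 0, Rel (off mv')), (True, Cell i b, 1, Rel 1)])"
          using i sat' by blast
        moreover have "active (GNe (off mv')) x H E t p"
          using False p Suc.prems by (simp add: active_def)
        ultimately have "\<not> \<alpha> (Mv i mv') t H \<or> \<not> \<alpha> (Cell i b) t (p + off mv' - 1) \<or>
            \<alpha> (Cell i b) (Suc t) p"
          using holds by fastforce
        moreover have "\<alpha> (Cell i b) t (p + off mv' - 1)"
          unfolding b_def using p off_le[of mv'] by (intro IH(2) i) auto
        ultimately show ?thesis using mv[OF i] b by (simp add: w)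
      qed
    qed
    then show ?case using st by (simp add: step_state r)
  qed
  have "\<not> \<alpha> (State (reject_state M)) (H - 1) H"
    using holds[of GFinal "[(False, State (reject_state M), 0, Cen 1)]" "H - 1" H] sat' L
    by (simp add: active_def)
  moreover have "\<alpha> (State (state x y (H - 1))) (H - 1) H" using trace[of "H - 1"] L by simp
  ultimately have "state x y (H - 1) \<noteq> reject_state M" by auto
  moreover have "length y \<le> L" using n by (simp add: y_def)
  ultimately show ?thesis using that by blast
qed

end

section \<open>Satisfiability as a delay problem\<close>

context pair_graph
begin

text \<open>From \<open>s\<close> into \<open>K\<close>, across the clique and out to
  \<open>t\<close>: the inner vertices are in \<open>K\<close> and cost nothing, so only the start
  can be charged.\<close>

lemma apath_dominating_clique:
  assumes K: "K \<subseteq> pverts G" "\<And>u v. u \<in> K \<Longrightarrow> v \<in> K \<Longrightarrow> u \<noteq> v \<Longrightarrow> (u, v) \<in> parcs G"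
    and dom: "\<And>v. v \<in> pverts G \<Longrightarrow> v \<notin> K \<Longrightarrow> \<exists>u\<in>K. (v, u) \<in> parcs G"
    and st: "s \<in> pverts G" "t \<in> pverts G"
  obtains p where "apath s p t"
    "path_delay (zero_delays K l) p = (if s = t \<or> s \<in> K then 0 else l s)"
proof -
  have sym: "(v, u) \<in> parcs G" if "(u, v) \<in> parcs G" for u v
    using that by (rule arcs_symmetric)
  obtain a where a: "a \<in> K" "s \<in> K \<Longrightarrow> a = s" "s \<notin> K \<Longrightarrow> (s, a) \<in> parcs G"
    using dom[OF st(1)] by (cases "s \<in> K") auto
  obtain b where b: "b \<in> K" "t \<in> K \<Longrightarrow> b = t" "t \<notin> K \<Longrightarrow> (b, t) \<in> parcs G"
    using dom[OF st(2)] sym by (cases "t \<in> K") blast+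
  have ab: "a \<noteq> b \<Longrightarrow> (a, b) \<in> parcs G" using a b K by blast
  define p where "p = (if s = t then [] else (if s \<in> K then [] else [(s, a)]) @
    (if a = b then [] else [(a, b)]) @ (if t \<in> K then [] else [(b, t)]))"
  have V: "a \<in> pverts G" "b \<in> pverts G" using a b K by auto
  have "apath s p t"
  proof (cases "s = t")
    case True
    then show ?thesis using st by (simp add: p_def apath_Nil_iff)
  next
    case False
    then have "s \<notin> K \<Longrightarrow> s \<noteq> a \<and> s \<noteq> b" "t \<notin> K \<Longrightarrow> a \<noteq> t \<and> b \<noteq> t" using a(1) b(1) by auto
    then show ?thesis
      using False a b ab V st
      by (cases "s \<in> K"; cases "t \<in> K"; cases "a = b") (simp_all add: p_def apath_simps)
  qed
  moreover have "path_delay (zero_delays K l) p = (if s = t \<or> s \<in> K then 0 else l s)"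
    using a(1) b(1) by (simp add: p_def path_delay_def zero_delays_def)
  ultimately show ?thesis by (rule that)
qed

lemma finite_path_delays: "finite {path_delay l p | p. apath s p t}"
  using apaths_finite[of s t] by simp

lemma delay_dist_le: "apath s p t \<Longrightarrow> delay_dist G l s t \<le> path_delay l p"
  unfolding delay_dist_def by (rule Min_le) (use finite_path_delays in auto)

lemma delay_dist_attained:
  assumes "apath s q t"
  obtains p where "apath s p t" "delay_dist G l s t = path_delay l p"
proof -
  have "delay_dist G l s t \<in> {path_delay l p | p. apath s p t}"
    unfolding delay_dist_def by (rule Min_in) (use finite_path_delays assms in auto)
  then show ?thesis using that by auto
qed

lemma path_delay_nonneg:
  assumes "apath s p t" "\<And>v. v \<in> pverts G \<Longrightarrow> 0 \<le> l v"
  shows "0 \<le> path_delay l p"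
  unfolding path_delay_def
proof (rule sum_list_nonneg)
  have "set p \<subseteq> parcs G" using assms(1) by (auto simp: apath_def awalk_def)
  then show "0 \<le> x" if "x \<in> set (map (\<lambda>a. l (fst a)) p)" for x
    using that assms(2) by (auto dest!: subsetD arc_fst_in_verts)
qed

text \<open>The trivial lower bound in closed form: the summand is what the start alone costs,
  namely 1 unless it is in \<open>T\<close> or already the destination.\<close>

lemma sum_pairs:
  assumes "T \<subseteq> pverts G"
  shows "(\<Sum>s\<in>pverts G. \<Sum>t\<in>pverts G. if s = t \<or> s \<in> T then 0 else 1 :: real) =
    (real (card (pverts G)) - real (card T)) * (real (card (pverts G)) - 1)"
proof -
  let ?V = "pverts G"
  have fin: "finite ?V" by (rule pair_finite_verts)
  have "(\<Sum>t\<in>?V. if s = t \<or> s \<in> T then 0 else 1 :: real) =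
      (if s \<in> T then 0 else real (card ?V) - 1)" if "s \<in> ?V" for s
  proof (cases "s \<in> T")
    case False
    have "(\<Sum>t\<in>?V. if s = t \<or> s \<in> T then 0 else 1 :: real) = (\<Sum>t\<in>?V - {s}. 1)"
      using fin False by (intro sum.mono_neutral_cong_right) auto
    also have "\<dots> = real (card ?V) - 1"
      using card.remove[OF fin that] by simp
    finally show ?thesis using False by simp
  qed simp
  then have "(\<Sum>s\<in>?V. \<Sum>t\<in>?V. if s = t \<or> s \<in> T then 0 else 1 :: real) =
      (\<Sum>s\<in>?V. if s \<in> T then 0 else real (card ?V) - 1)" by simp
  also have "\<dots> = (\<Sum>s\<in>?V - T. real (card ?V) - 1)"
    using fin by (intro sum.mono_neutral_cong_right) auto
  also have "\<dots> = (real (card ?V) - real (card T)) * (real (card ?V) - 1)"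
    using assms fin by (simp add: card_Diff_subset finite_subset card_mono of_nat_diff)
  finally show ?thesis .
qed

lemma total_delay_dominating_clique:
  assumes "K \<subseteq> pverts G" "\<And>u v. u \<in> K \<Longrightarrow> v \<in> K \<Longrightarrow> u \<noteq> v \<Longrightarrow> (u, v) \<in> parcs G"
    and "\<And>v. v \<in> pverts G \<Longrightarrow> v \<notin> K \<Longrightarrow> \<exists>u\<in>K. (v, u) \<in> parcs G"
  shows "total_delay G (\<lambda>_. 1) K \<le>
    (real (card (pverts G)) - real (card K)) * (real (card (pverts G)) - 1)"
  unfolding total_delay_def sum_pairs[OF assms(1), symmetric]
proof (intro sum_mono)
  fix s t assume st: "s \<in> pverts G" "t \<in> pverts G"
  obtain p where "apath s p t"
      "path_delay (zero_delays K (\<lambda>_. 1)) p = (if s = t \<or> s \<in> K then 0 else 1)"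
    using apath_dominating_clique[OF assms st, where l = "\<lambda>_. 1"] by blast
  then show "delay_dist G (zero_delays K (\<lambda>_. 1)) s t \<le> (if s = t \<or> s \<in> K then 0 else 1)"
    using delay_dist_le[of s p t "zero_delays K (\<lambda>_. 1)"] by simp
qed

text \<open>
  Attaining the trivial lower bound means that every vertex outside T reaches every other
  vertex through T.
\<close>

lemma total_delay_imp_dominating:
  assumes T: "T \<subseteq> pverts G"
    and conn: "\<And>s t. s \<in> pverts G \<Longrightarrow> t \<in> pverts G \<Longrightarrow> \<exists>p. apath s p t"
    and le: "total_delay G (\<lambda>_. 1) T \<le>
      (real (card (pverts G)) - real (card T)) * (real (card (pverts G)) - 1)"
    and v: "v \<in> pverts G" "v \<notin> T" and w: "w \<in> pverts G" "v \<noteq> w" "(v, w) \<notin> parcs G"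
  shows "\<exists>u\<in>T. (v, u) \<in> parcs G"
proof -
  let ?V = "pverts G" and ?l = "zero_delays T (\<lambda>_. 1 :: real)"
  define d where "d = (\<lambda>(s, t). delay_dist G ?l s t)"
  define e where "e = (\<lambda>(s, t). if s = t \<or> s \<in> T then 0 else 1 :: real)"
  have fin: "finite (?V \<times> ?V)" using pair_finite_verts by simp
  have ed: "e i \<le> d i" if i: "i \<in> ?V \<times> ?V" for i
  proof -
    obtain s t where st: "i = (s, t)" "s \<in> ?V" "t \<in> ?V" using i by auto
    obtain q where "apath s q t" using conn st by blast
    then obtain p where p: "apath s p t" "delay_dist G ?l s t = path_delay ?l p"
      using delay_dist_attained[of s q t ?l] by blast
    have nonneg: "0 \<le> path_delay ?l q" if "apath u q v" for u q v
      using that by (rule path_delay_nonneg) (simp add: zero_delays_def)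
    have "(if s = t \<or> s \<in> T then 0 else 1) \<le> path_delay ?l p"
    proof (cases p)
      case Nil
      then show ?thesis using p(1) by (simp add: apath_Nil_iff path_delay_def)
    next
      case (Cons a q)
      then have "fst a = s" "apath (snd a) q t" using p(1) by (auto simp: apath_Cons_iff)
      then show ?thesis using nonneg[of "snd a" q t] Cons by (simp add: path_delay_def zero_delays_def)
    qed
    then show ?thesis using p st by (simp add: d_def e_def)
  qed
  \<comment> \<open>Termwise \<open>e\<close> is at most \<open>d\<close>, so this inequality of
    sums makes all terms equal and fixes the single distance from \<open>v\<close> to
    \<open>w\<close>.\<close>
  have "sum d (?V \<times> ?V) \<le> sum e (?V \<times> ?V)"
    using le sum_pairs[OF T] by (simp add: total_delay_def sum.cartesian_product d_def e_def)
  then have "sum e (?V \<times> ?V) = sum d (?V \<times> ?V)" using sum_mono[of "?V \<times> ?V" e d] ed by force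
  from sum_mono_inv[OF this ed _ fin, of "(v, w)"]
  have dvw: "delay_dist G ?l v w = 1" using v w by (simp add: d_def e_def)
  obtain q where "apath v q w" using conn v w by blast
  then obtain p where p: "apath v p w" "path_delay ?l p = 1"
    using delay_dist_attained[of v q w ?l] dvw by metis
  obtain a q where aq: "p = a # q" using p(1) w by (cases p) (auto simp: apath_Nil_iff)
  then have a: "a \<in> parcs G" "fst a = v" "apath (snd a) q w" using p(1) by (auto simp: apath_Cons_iff)
  moreover have "snd a \<noteq> w" using a w(3) by (cases a) auto
  ultimately obtain b r where br: "q = b # r" by (cases q) (auto simp: apath_Nil_iff)
  then have b: "fst b = snd a" "apath (snd b) r w" using a by (auto simp: apath_Cons_iff)
  have "0 \<le> path_delay ?l r"
    using b(2) by (rule path_delay_nonneg) (simp add: zero_delays_def)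
  \<comment> \<open>The delay 1 is used up by \<open>v\<close> itself, so the next vertex, which is
    not the destination, must be free.\<close>
  then have "?l (snd a) \<le> 0"
    using p(2) a(2) b(1) v by (simp add: aq br path_delay_def zero_delays_def)
  then have "snd a \<in> T" by (simp add: zero_delays_def split: if_splits)
  then show ?thesis using a by (metis prod.collapse)
qed

lemma connected_if_apaths:
  assumes "pverts G \<noteq> {}" "\<And>s t. s \<in> pverts G \<Longrightarrow> t \<in> pverts G \<Longrightarrow> \<exists>p. apath s p t"
  shows "Digraph_Component.connected (with_proj G)"
proof (rule connectedI)
  fix u v assume "u \<in> pverts G" "v \<in> pverts G"
  then obtain p where "apath u p v" using assms by auto
  then have "u \<rightarrow>\<^sup>*\<^bsub>with_proj G\<^esub> v" using reachable_apath by blast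
  then show "u \<rightarrow>\<^sup>*\<^bsub>with_proj (mk_symmetric (with_proj G))\<^esub> v" by (rule reachable_mk_symmetricI)
qed (use assms in auto)

end

text \<open>
  The positive literals are the vertices below N and the negative ones those from N to 2 N - 1,
  followed by N variable vertices and M clause vertices.
\<close>

definition sat_arc :: "nat \<Rightarrow> (nat \<Rightarrow> nat \<Rightarrow> bool) \<Rightarrow> nat \<Rightarrow> nat \<Rightarrow> bool" where
  "sat_arc N occ i j \<longleftrightarrow> i < 2 * N \<and>
     (j < 2 * N \<and> i \<noteq> j \<or> 2 * N \<le> j \<and> j < 3 * N \<and> i mod N = j mod N \<or> 3 * N \<le> j \<and> occ (j - 3 * N) i)"

definition sat_graph :: "nat \<Rightarrow> nat \<Rightarrow> (nat \<Rightarrow> nat \<Rightarrow> bool) \<Rightarrow> nat pair_pre_digraph" where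
  "sat_graph N M occ = \<lparr>pverts = {..<3 * N + M},
     parcs = {(i, j). i < 3 * N + M \<and> j < 3 * N + M \<and> (sat_arc N occ i j \<or> sat_arc N occ j i)}\<rparr>"

definition lit_true :: "nat \<Rightarrow> (nat \<Rightarrow> bool) \<Rightarrow> nat \<Rightarrow> bool" where
  "lit_true N \<alpha> i \<longleftrightarrow> (if i < N then \<alpha> i else \<not> \<alpha> (i - N))"

lemma pair_graph_sat_graph: "pair_graph (sat_graph N M occ)"
proof
  have "parcs (sat_graph N M occ) \<subseteq> {..<3 * N + M} \<times> {..<3 * N + M}" by (auto simp: sat_graph_def)
  then show "finite (parcs (sat_graph N M occ))" by (rule finite_subset) simp
  show "symmetric (with_proj (sat_graph N M occ))"
    by (auto simp: symmetric_def sym_def sat_graph_def)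
qed (auto simp: sat_graph_def sat_arc_def)

section \<open>Assignments and sets that attain the lower bound\<close>

context
  fixes N M :: nat and occ :: "nat \<Rightarrow> nat \<Rightarrow> bool"
  assumes N: "0 < N" and M: "0 < M" and occ: "\<And>c. c < M \<Longrightarrow> \<exists>i<2 * N. occ c i"
begin

interpretation G: pair_graph "sat_graph N M occ" by (rule pair_graph_sat_graph)

lemma sat_graph_verts: "pverts (sat_graph N M occ) = {..<3 * N + M}"
  by (simp add: sat_graph_def)

text \<open>All literals together form a dominating clique; \<open>occ\<close> supplies a literal
  next to each clause.\<close>

lemma sat_graph_apath:
  assumes "s \<in> pverts (sat_graph N M occ)" "t \<in> pverts (sat_graph N M occ)"
  shows "\<exists>p. G.apath s p t"
proof -
  have "\<exists>u\<in>{..<2 * N}. (v, u) \<in> parcs (sat_graph N M occ)"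
    if v: "v \<in> pverts (sat_graph N M occ)" "v \<notin> {..<2 * N}" for v
  proof (cases "v < 3 * N")
    case True
    have "v mod N < N" using N by simp
    then have "v mod N < 2 * N" "v mod N < 3 * N + M" by linarith+
    then show ?thesis using v True
      by (intro bexI[of _ "v mod N"]) (auto simp: sat_graph_def sat_arc_def)
  next
    case False
    then have "v - 3 * N < M" using v by (auto simp: sat_graph_def)
    then obtain i where "i < 2 * N" "occ (v - 3 * N) i" using occ by blast
    then show ?thesis using v False by (intro bexI[of _ i]) (auto simp: sat_graph_def sat_arc_def)
  qed
  moreover have "{..<2 * N} \<subseteq> pverts (sat_graph N M occ)" by (auto simp: sat_graph_def)
  moreover have "(u, v) \<in> parcs (sat_graph N M occ)"
    if "u \<in> {..<2 * N}" "v \<in> {..<2 * N}" "u \<noteq> v" for u v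
    using that by (auto simp: sat_graph_def sat_arc_def)
  ultimately show ?thesis
    using G.apath_dominating_clique[of "{..<2 * N}" s t] assms by metis
qed

lemma network_sat_graph: "network (sat_graph N M occ) (\<lambda>_. 1)"
proof -
  have "0 \<in> pverts (sat_graph N M occ)" using N by (simp add: sat_graph_verts)
  then have "Digraph_Component.connected (with_proj (sat_graph N M occ))"
    by (intro G.connected_if_apaths sat_graph_apath) auto
  then show ?thesis using pair_graph_sat_graph by (simp add: network_def)
qed

text \<open>The true literals are a clique with one member per variable. They dominate the false
  literals as a clique, the variable vertices because each variable has a true literal, and the
  clauses because these are satisfied.\<close>

lemma satisfiable_imp_dmp:
  assumes \<alpha>: "\<And>c. c < M \<Longrightarrow> \<exists>i<2 * N. occ c i \<and> lit_true N \<alpha> i"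
  shows "dmp_decision (sat_graph N M occ) (\<lambda>_. 1) N
    ((real (3 * N + M) - real N) * (real (3 * N + M) - 1))"
proof -
  define lit where "lit = (\<lambda>i. if \<alpha> i then i else N + i)"
  define K where "K = lit ` {..<N}"
  have lit: "lit i < 2 * N" "lit i mod N = i" if "i < N" for i using that by (auto simp: lit_def)
  have K: "i < 2 * N" if "i \<in> K" for i using that lit(1) by (auto simp: K_def)
  have "inj_on lit {..<N}" using lit(2) by (metis inj_onI lessThan_iff)
  then have card: "card K = N" unfolding K_def by (simp add: card_image)
  have true: "i \<in> K" if "i < 2 * N" "lit_true N \<alpha> i" for i
    using that unfolding K_def by (intro image_eqI[of _ _ "i mod N"])
      (auto simp: lit_def lit_true_def mod_if split: if_splits)
  have "\<exists>u\<in>K. (v, u) \<in> parcs (sat_graph N M occ)"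
    if v: "v \<in> pverts (sat_graph N M occ)" "v \<notin> K" for v
  proof (cases "v < 3 * N")
    case True
    have m: "v mod N < N" using N by simp
    \<comment> \<open>\<open>v mod N\<close> is the variable of a literal as well as of a variable
      vertex, so one neighbour serves both cases.\<close>
    have "lit (v mod N) \<noteq> v" using v(2) m unfolding K_def by (metis imageI lessThan_iff)
    then have "(v, lit (v mod N)) \<in> parcs (sat_graph N M occ)"
      using v True lit[OF m] by (auto simp: sat_graph_def sat_arc_def)
    then show ?thesis using m by (auto simp: K_def)
  next
    case False
    then have "v - 3 * N < M" using v by (auto simp: sat_graph_def)
    then obtain i where i: "i < 2 * N" "occ (v - 3 * N) i" "lit_true N \<alpha> i" using \<alpha> by blast
    then show ?thesis using v False true[of i]
      by (intro bexI[of _ i]) (auto simp: sat_graph_def sat_arc_def)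
  qed
  then have "total_delay (sat_graph N M occ) (\<lambda>_. 1) K \<le>
      (real (card (pverts (sat_graph N M occ))) - real (card K)) *
      (real (card (pverts (sat_graph N M occ))) - 1)"
    by (intro G.total_delay_dominating_clique) (auto simp: sat_graph_def sat_arc_def dest!: K)
  moreover have "K \<subseteq> pverts (sat_graph N M occ)" by (auto simp: sat_graph_def dest!: K)
  ultimately show ?thesis
    unfolding dmp_decision_def using card by (intro exI[of _ K]) (simp add: sat_graph_verts)
qed

lemma dmp_imp_satisfiable:
  assumes "dmp_decision (sat_graph N M occ) (\<lambda>_. 1) N
    ((real (3 * N + M) - real N) * (real (3 * N + M) - 1))"
  obtains \<alpha> where "\<And>c. c < M \<Longrightarrow> \<exists>i<2 * N. occ c i \<and> lit_true N \<alpha> i"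
proof -
  obtain T where T: "T \<subseteq> {..<3 * N + M}" "card T = N" and le: "total_delay (sat_graph N M occ) (\<lambda>_. 1) T \<le>
      (real (card (pverts (sat_graph N M occ))) - real (card T)) *
      (real (card (pverts (sat_graph N M occ))) - 1)"
    using assms unfolding dmp_decision_def by (auto simp: sat_graph_verts)
  have dom: "\<exists>u\<in>T. (v, u) \<in> parcs (sat_graph N M occ)"
    if "v < 3 * N + M" "v \<notin> T" "2 * N \<le> v" for v
  \<comment> \<open>Variable and clause vertices are pairwise nonadjacent, so the first vertex of
    the other sort is the required partner of \<open>v\<close>.\<close>
  proof (rule G.total_delay_imp_dominating[OF _ sat_graph_apath le, of v "if v < 3 * N then 3 * N else 2 * N"])
    show "(v, if v < 3 * N then 3 * N else 2 * N) \<notin> parcs (sat_graph N M occ)"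
      using that by (auto simp: sat_graph_def sat_arc_def)
  qed (use that T N M in \<open>auto simp: sat_graph_verts\<close>)
  \<comment> \<open>A variable vertex is in \<open>T\<close> or has a neighbour there, and its
    neighbours are its two literals; all three have the same residue modulo
    \<open>N\<close>.\<close>
  have "\<exists>u\<in>T. u < 3 * N \<and> u mod N = v" if v: "v < N" for v
  proof (cases "2 * N + v \<in> T")
    case True
    then show ?thesis using that by (intro bexI[of _ "2 * N + v"]) auto
  next
    case False
    then obtain u where "u \<in> T" "(2 * N + v, u) \<in> parcs (sat_graph N M occ)"
      using dom[of "2 * N + v"] v by force
    then show ?thesis using that by (intro bexI[of _ u]) (auto simp: sat_graph_def sat_arc_def)
  qed
  then obtain g where g: "\<And>v. v < N \<Longrightarrow> g v \<in> T \<and> g v < 3 * N \<and> g v mod N = v" by metis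
  text \<open>The budget only suffices for one vertex per variable, so T is the image of g.\<close>
  have "inj_on g {..<N}" using g by (metis inj_onI lessThan_iff)
  then have "card (g ` {..<N}) = card T" using T by (simp add: card_image)
  moreover have "finite T" using T(1) finite_subset by blast
  ultimately have gT: "g ` {..<N} = T" using g by (intro card_subset_eq) auto
  define \<alpha> where "\<alpha> = (\<lambda>v. v \<in> T)"
  have true: "lit_true N \<alpha> i" if i: "i \<in> T" "i < 2 * N" for i
  proof (cases "i < N")
    case False
    \<comment> \<open>A literal and its negation have the same residue, and \<open>T\<close>
      contains each residue only once.\<close>
    have "i - N \<notin> T"
    proof
      assume "i - N \<in> T"
      then obtain v v' where "v < N" "v' < N" "i - N = g v" "i = g v'" using gT i by blast
      moreover from this have "v = v'" using g False i
        by (metis le_mod_geq not_less)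
      ultimately show False using False N by auto
    qed
    then show ?thesis using False by (simp add: lit_true_def \<alpha>_def)
  qed (use i in \<open>simp add: lit_true_def \<alpha>_def\<close>)
  have "\<exists>i<2 * N. occ c i \<and> lit_true N \<alpha> i" if c: "c < M" for c
  proof -
    \<comment> \<open>The values of \<open>g\<close> lie below \<open>3 * N\<close>, so
      \<open>T\<close> contains no clause vertex.\<close>
    have "3 * N + c \<notin> T" using gT g by fastforce
    then obtain u where "u \<in> T" "(3 * N + c, u) \<in> parcs (sat_graph N M occ)"
      using dom[of "3 * N + c"] c by auto
    then show ?thesis using true by (intro exI[of _ u]) (auto simp: sat_graph_def sat_arc_def)
  qed
  then show ?thesis by (rule that)
qed

end

section \<open>Numbering the clauses and literals\<close>

text \<open>The kind is the leading digit, so the vertices of one kind form a block of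
  \<open>B * B\<close> numbers, and multiples of \<open>N\<close> are block boundaries.\<close>

definition enc :: "nat \<Rightarrow> nat \<Rightarrow> nat \<Rightarrow> nat \<Rightarrow> nat" where
  "enc B k t p = (k * B + t) * B + p"

lemma enc_less: "t < B \<Longrightarrow> p < B \<Longrightarrow> enc B k t p < K * B * B \<longleftrightarrow> k < K"
proof -
  assume tp: "t < B" "p < B"
  have "(a * B + b) < K' * B \<longleftrightarrow> a < K'" if "b < B" for a b K'
  proof
    assume "a * B + b < K' * B"
    then have "a * B < K' * B" by linarith
    then show "a < K'" by simp
  next
    assume "a < K'"
    then have "Suc a * B \<le> K' * B" by (intro mult_right_mono) auto
    then show "a * B + b < K' * B" using that by simp
  qed
  from this[OF tp(2)] this[OF tp(1)] show ?thesis unfolding enc_def by blast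
qed

lemma enc_decode: "i = enc B (i div B div B) (i div B mod B) (i mod B)"
  by (simp add: enc_def)

lemma enc_div [simp]:
  assumes "t < B" "p < B"
  shows "enc B k t p div B div B = k" "enc B k t p div B mod B = t" "enc B k t p mod B = p"
  using assms by (auto simp: enc_def)

lemma enc_inject:
  assumes "t < B" "p < B" "t' < B" "p' < B"
  shows "enc B k t p = enc B k' t' p' \<longleftrightarrow> k = k' \<and> t = t' \<and> p = p'"
  using enc_div[OF assms(1,2), of k] enc_div[OF assms(3,4), of k'] by metis

lemma enc_add: "enc B (a + k) t p = a * B * B + enc B k t p"
  by (simp add: enc_def algebra_simps)

text \<open>A modulus that is a whole number of blocks affects the leading digit only: a literal and
  its variable share time and position.\<close>

lemma enc_mod:
  assumes "t < B" "p < B" "0 < K"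
  shows "enc B k t p mod (K * B * B) = enc B (k mod K) t p"
proof -
  have "enc B k t p = enc B (k div K * K + k mod K) t p" by simp
  also have "\<dots> = k div K * (K * B * B) + enc B (k mod K) t p" by (simp only: enc_add mult.assoc)
  finally show ?thesis using enc_less[OF assms(1,2), of "k mod K" K] assms(3) by simp
qed

lemma concat_map_mult:
  "concat (map F [0..<K * B]) = concat (map (\<lambda>a. concat (map (\<lambda>b. F (a * B + b)) [0..<B])) [0..<K])"
proof (induction K)
  case (Suc K)
  have "[0..<Suc K * B] = [0..<K * B] @ map (\<lambda>b. b + K * B) [0..<B]"
    using upt_add_eq_append[of 0 "K * B" B] by (simp add: add.commute map_add_upt)
  then show ?case using Suc by (simp add: comp_def add.commute)
qed simp

text \<open>Counting through the numbers is the same as looping over their digits, the form in which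
  the program prints rows and columns.\<close>

lemma concat_map_enc:
  "concat (map F [0..<K * B * B]) =
   concat (map (\<lambda>k. concat (map (\<lambda>t. concat (map (\<lambda>p. F (enc B k t p)) [0..<B])) [0..<B])) [0..<K])"
  unfolding concat_map_mult[of F "K * B" B]
  by (subst concat_map_mult) (simp add: enc_def)

text \<open>
  Clause and literal numbers are decoded into kind, time and position; the literal kinds from Kv on
  are negative.  An inactive clause contains every literal, which makes it harmless.
\<close>

definition occurs :: "tm \<Rightarrow> bool list \<Rightarrow> nat \<Rightarrow> nat \<Rightarrow> nat \<Rightarrow> nat \<Rightarrow> bool" where
  "occurs M x H E c i = (let B = 2 * H + 1; Kv = length (kinds M);
       (g, ls) = clauses M ! (c div B div B); t = c div B mod B; p = c mod B; k = i div B div B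
     in active g x H E t p \<longrightarrow> (\<exists>(s, v, dt, l)\<in>set ls. s = (k < Kv) \<and> v = kinds M ! (k mod Kv) \<and>
          i div B mod B = t + dt \<and> i mod B = locate H p l))"

text \<open>The bounds keep the literals of an active clause inside the numbering; nonemptiness
  attaches every clause vertex to the graph.\<close>

lemma clauses_shape:
  "\<forall>(g, ls)\<in>set (clauses M). ls \<noteq> [] \<and> (\<forall>(s, v, dt, l)\<in>set ls. dt \<le> 1 \<and>
     (case l of Rel e \<Rightarrow> e \<le> 2 | Cen e \<Rightarrow> e \<le> 2))"
proof -
  have "\<forall>(s, v, dt, l)\<in>set (acting M q as). dt \<le> 1 \<and> (case l of Rel e \<Rightarrow> e \<le> 2 | Cen e \<Rightarrow> e \<le> 2)" for q as
    by (auto simp: acting_def split: prod.splits)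
  then show ?thesis unfolding ball_clauses by (auto simp: reading_def off_le)
qed

context verifier
begin

abbreviation "Kv \<equiv> length (kinds M)"
abbreviation "Kc \<equiv> length (clauses M)"

lemma kinds_pos: "0 < Kv" and clauses_pos: "0 < Kc"
  using wf by (auto simp: kinds_def clauses_def wf_tm_def)

lemma set_kinds:
  "v \<in> set (kinds M) \<longleftrightarrow> (case v of Cell i a \<Rightarrow> i < K \<and> a < S | State q \<Rightarrow> q < Q | Mv i d \<Rightarrow> i < K)"
  by (cases v) (auto simp: kinds_def image_iff)

lemma clauses_kinds:
  "\<forall>(g, ls)\<in>set (clauses M). \<forall>(s, v, dt, l)\<in>set ls. v \<in> set (kinds M)"
proof -
  have sym: "as ! i < S" if "i < K" "length as = K" "set as \<subseteq> {..<S}" for as i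
    using that nth_mem[of i as] by (auto simp del: nth_mem)
  have "\<forall>(s, v, dt, l)\<in>set (acting M q as). v \<in> set (kinds M)"
    if "q < Q" "length as = K" "set as \<subseteq> {..<S}" for q as
    using delta_wf[OF that] by (cases "delta M q as") (auto simp: acting_def set_kinds)
  moreover have "3 \<le> S" "start_state M < Q" "reject_state M < Q" using wf by (auto simp: wf_tm_def)
  ultimately show ?thesis
    unfolding ball_clauses using sym two_tapes by (auto simp: reading_def set_kinds)
qed

context
  fixes x :: "bool list" and H E B N :: nat
  assumes H: "0 < H" and B: "B = 2 * H + 1" and N: "N = Kv * B * B"
begin

lemma occurs_iff:
  assumes "clauses M ! (c div B div B) = (g, ls)"
  shows "occurs M x H E c i \<longleftrightarrow> (active g x H E (c div B mod B) (c mod B) \<longrightarrow>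
    (\<exists>(s, v, dt, l)\<in>set ls. s = (i div B div B < Kv) \<and> v = kinds M ! (i div B div B mod Kv) \<and>
       i div B mod B = c div B mod B + dt \<and> i mod B = locate H (c mod B) l))"
  by (simp only: occurs_def Let_def flip: B) (simp add: assms)

lemma locate_less:
  assumes "(g, ls) \<in> set (clauses M)" "(s, v, dt, l) \<in> set ls" "active g x H E t p"
  shows "t + dt < B" "locate H p l < B"
proof -
  have "dt \<le> 1" "case l of Rel e \<Rightarrow> e \<le> 2 | Cen e \<Rightarrow> e \<le> 2"
    using clauses_shape[of M] assms(1,2) by fastforce+
  then show "t + dt < B" "locate H p l < B"
    using assms(3) H B by (cases l; auto simp: active_def)+
qed

text \<open>Negation adds \<open>Kv\<close> to the kind, hence \<open>N\<close> to the number, in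
  agreement with \<open>lit_true\<close>.\<close>

lemma literal_index:
  assumes "v \<in> set (kinds M)" "t < B" "p < B"
  obtains i where "i < 2 * N" "(i div B div B < Kv) = s" "kinds M ! (i div B div B mod Kv) = v"
    "i div B mod B = t" "i mod B = p"
    "lit_true N (\<lambda>i. \<alpha> (kinds M ! (i div B div B)) (i div B mod B) (i mod B)) i = (\<alpha> v t p = s)"
proof -
  obtain k where k: "k < Kv" "kinds M ! k = v" using assms(1) by (metis in_set_conv_nth)
  define i where "i = enc B (if s then k else Kv + k) t p"
  have less: "enc B k t p < N" unfolding N using enc_less[OF assms(2,3)] k by blast
  have i: "i = (if s then enc B k t p else N + enc B k t p)" by (simp add: i_def enc_add N)
  note d = enc_div[OF assms(2,3)]
  show ?thesis
  proof (rule that[of i])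
    show "i < 2 * N" using less i by auto
    show "(i div B div B < Kv) = s" "kinds M ! (i div B div B mod Kv) = v"
      "i div B mod B = t" "i mod B = p"
      unfolding i_def d using k by auto
    show "lit_true N (\<lambda>i. \<alpha> (kinds M ! (i div B div B)) (i div B mod B) (i mod B)) i = (\<alpha> v t p = s)"
    proof (cases s)
      case True
      then show ?thesis using i less d k by (simp add: lit_true_def)
    next
      case False
      have "\<not> i < N" "i - N = enc B k t p" using i False by auto
      then show ?thesis using False d k by (simp add: lit_true_def)
    qed
  qed
qed

text \<open>Needed for the connectedness of the graph; for an inactive clause literal 0 will
  do.\<close>

lemma occurs_nonempty:
  assumes "c < Kc * B * B"
  shows "\<exists>i<2 * N. occurs M x H E c i"
proof -
  define t p where "t = c div B mod B" and "p = c mod B"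
  obtain g ls where gls: "clauses M ! (c div B div B) = (g, ls)" by fastforce
  have "c div B div B < Kc"
    using assms by (simp add: less_mult_imp_div_less)
  then have mem: "(g, ls) \<in> set (clauses M)" using gls by (metis nth_mem)
  show ?thesis
  proof (cases "active g x H E t p")
    case True
    obtain s v dt l where l: "(s, v, dt, l) \<in> set ls"
    proof -
      have "ls \<noteq> []" using clauses_shape[of M] mem by blast
      then show ?thesis using that by (metis list.set_sel(1) prod.collapse)
    qed
    have v: "v \<in> set (kinds M)" using clauses_kinds mem l by fastforce
    obtain i where i: "i < 2 * N" "(i div B div B < Kv) = s" "kinds M ! (i div B div B mod Kv) = v"
      "i div B mod B = t + dt" "i mod B = locate H p l"
      by (rule literal_index[OF v locate_less[OF mem l True], of s])
    then have "occurs M x H E c i"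
      unfolding occurs_iff[OF gls] by (intro impI bexI[OF _ l]) (simp add: t_def p_def)
    then show ?thesis using i by blast
  next
    case False
    then show ?thesis
      using kinds_pos B unfolding occurs_iff[OF gls]
      by (intro exI[of _ 0]) (auto simp: t_def p_def N)
  qed
qed

text \<open>The two sides name the variables differently, by numbers or by kind, time and position;
  the left one also has the inactive clauses.\<close>

lemma model_iff:
  "(\<exists>\<alpha>. \<forall>c<Kc * B * B. \<exists>i<2 * N. occurs M x H E c i \<and> lit_true N \<alpha> i) \<longleftrightarrow>
   (\<exists>\<alpha>. \<forall>c\<in>set (clauses M). clause_holds \<alpha> x H E c)"
proof
  assume "\<exists>\<alpha>. \<forall>c<Kc * B * B. \<exists>i<2 * N. occurs M x H E c i \<and> lit_true N \<alpha> i"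
  then obtain \<alpha> where \<alpha>: "\<And>c. c < Kc * B * B \<Longrightarrow> \<exists>i<2 * N. occurs M x H E c i \<and> lit_true N \<alpha> i" by blast
  \<comment> \<open>Inverts the list of kinds, which is duplicate-free by
    \<open>remdups\<close>.\<close>
  define idx where "idx = (\<lambda>v. SOME k. k < Kv \<and> kinds M ! k = v)"
  have idx: "idx (kinds M ! k) = k" if "k < Kv" for k
  proof -
    have "idx (kinds M ! k) < Kv \<and> kinds M ! idx (kinds M ! k) = kinds M ! k"
      unfolding idx_def by (rule someI[of _ k]) (use that in simp)
    moreover have "distinct (kinds M)" by (simp add: kinds_def)
    ultimately show ?thesis using that nth_eq_iff_index_eq by blast
  qed
  have "clause_holds (\<lambda>v t p. \<alpha> (enc B (idx v) t p)) x H E (g, ls)" if mem: "(g, ls) \<in> set (clauses M)" for g ls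
    unfolding clause_holds_def prod.case
  proof (intro allI impI)
    fix t p assume act: "active g x H E t p"
    then have tp: "t < B" "p < B" using B by (auto simp: active_def)
    note d = enc_div[OF tp]
    obtain j where j: "j < Kc" "clauses M ! j = (g, ls)" using mem by (metis in_set_conv_nth)
    then have cl: "clauses M ! (enc B j t p div B div B) = (g, ls)" unfolding d by simp
    have "enc B j t p < Kc * B * B" using enc_less[OF tp] j by blast
    from \<alpha>[OF this] obtain i where i: "i < 2 * N" "occurs M x H E (enc B j t p) i" "lit_true N \<alpha> i" by blast
    let ?k = "i div B div B"
    obtain s v dt l where l: "(s, v, dt, l) \<in> set ls" "s = (?k < Kv)" "v = kinds M ! (?k mod Kv)"
      "i div B mod B = t + dt" "i mod B = locate H p l"
      using i(2) act unfolding occurs_iff[OF cl] d by blast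
    have ie: "i = enc B ?k (t + dt) (locate H p l)" using enc_decode[of i B] l by simp
    note le = locate_less[OF mem l(1) act]
    have iN: "i < N \<longleftrightarrow> ?k < Kv" using enc_less[OF le, of ?k Kv] ie N by simp
    have "\<alpha> (enc B (idx v) (t + dt) (locate H p l)) = s"
    proof (cases "?k < Kv")
      case True
      then show ?thesis using i(3) iN l ie idx by (simp add: lit_true_def)
    next
      case False
      have "i < (2 * Kv) * B * B" using i(1) by (simp add: N algebra_simps)
      then have "?k < 2 * Kv" using enc_less[OF le, of ?k "2 * Kv"] ie by simp
      then have k: "?k mod Kv = ?k - Kv" "?k - Kv < Kv" using False by (auto simp: mod_if)
      have "?k = Kv + (?k - Kv)" using False by simp
      then have "i = N + enc B (?k - Kv) (t + dt) (locate H p l)" using ie enc_add N by metis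
      moreover have "idx v = ?k - Kv" using l(3) k idx by simp
      ultimately have "\<not> \<alpha> (enc B (idx v) (t + dt) (locate H p l))"
        using i(3) by (metis add_diff_cancel_left' lit_true_def not_add_less1)
      then show ?thesis using l(2) False by blast
    qed
    then show "\<exists>(s, k, dt, l)\<in>set ls. \<alpha> (enc B (idx k) (t + dt) (locate H p l)) = s" using l(1) by blast
  qed
  then show "\<exists>\<alpha>. \<forall>c\<in>set (clauses M). clause_holds \<alpha> x H E c" by (intro exI ballI) auto
next
  assume "\<exists>\<alpha>. \<forall>c\<in>set (clauses M). clause_holds \<alpha> x H E c"
  then obtain \<alpha> where \<alpha>: "\<And>c. c \<in> set (clauses M) \<Longrightarrow> clause_holds \<alpha> x H E c" by blast
  let ?\<alpha> = "\<lambda>i. \<alpha> (kinds M ! (i div B div B)) (i div B mod B) (i mod B)"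
  have "\<exists>i<2 * N. occurs M x H E c i \<and> lit_true N ?\<alpha> i" if "c < Kc * B * B" for c
  proof -
    define t p where "t = c div B mod B" and "p = c mod B"
    obtain g ls where gls: "clauses M ! (c div B div B) = (g, ls)" by fastforce
    have "c div B div B < Kc"
      using that by (simp add: less_mult_imp_div_less)
    then have mem: "(g, ls) \<in> set (clauses M)" using gls by (metis nth_mem)
    show ?thesis
    proof (cases "active g x H E t p")
      case True
      then obtain s v dt l where l: "(s, v, dt, l) \<in> set ls" "\<alpha> v (t + dt) (locate H p l) = s"
        using \<alpha>[OF mem] unfolding clause_holds_def by blast
      have v: "v \<in> set (kinds M)" using clauses_kinds mem l by fastforce
      obtain i where i: "i < 2 * N" "(i div B div B < Kv) = s" "kinds M ! (i div B div B mod Kv) = v"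
        "i div B mod B = t + dt" "i mod B = locate H p l" "lit_true N ?\<alpha> i"
        using literal_index[OF v locate_less[OF mem l(1) True], of s \<alpha>] l(2) by blast
      then have "occurs M x H E c i"
        unfolding occurs_iff[OF gls] by (intro impI bexI[OF _ l(1)]) (simp add: t_def p_def)
      then show ?thesis using i by blast
    next
      case False
      \<comment> \<open>An inactive clause contains every literal, in particular number 0 and its
        negation \<open>N\<close>, one of which is true.\<close>
      have "0 < N" using kinds_pos B N by simp
      then have "lit_true N ?\<alpha> (if ?\<alpha> 0 then 0 else N)" "(if ?\<alpha> 0 then 0 else N) < 2 * N"
        by (auto simp: lit_true_def)
      then show ?thesis
        using False unfolding occurs_iff[OF gls] t_def p_def by blast
    qed
  qed
  then show "\<exists>\<alpha>. \<forall>c<Kc * B * B. \<exists>i<2 * N. occurs M x H E c i \<and> lit_true N \<alpha> i" by blast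
qed

end

end

section \<open>Printing the instance\<close>

lemma emits_const: "\<exists>c. emits Z c (\<lambda>_ _ _. bs)"
proof (induction bs)
  case Nil
  show ?case using emits_Skip by blast
next
  case (Cons b bs)
  then obtain c where "emits Z c (\<lambda>_ _ _. bs)" ..
  from emits_Seq[OF emits_Out[of Z b] this] show ?case by auto
qed

text \<open>The kinds are unrolled into the program because their number depends on the machine
  alone; times and positions are loops up to register 3.\<close>

definition grid :: "nat \<Rightarrow> nat \<Rightarrow> nat \<Rightarrow> nat \<Rightarrow> nat \<Rightarrow> (nat \<Rightarrow> com) \<Rightarrow> com" where
  "grid t p mt mp K c =
     foldr Seq (map (\<lambda>k. for_loop 0 mt 3 t (for_loop 0 mp 3 p (c k))) [0..<K]) Skip"

definition grid_out :: "nat \<Rightarrow> nat \<Rightarrow> nat \<Rightarrow>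
    (nat \<Rightarrow> bool list \<Rightarrow> int \<Rightarrow> (nat \<Rightarrow> nat) \<Rightarrow> bool list) \<Rightarrow> bool list \<Rightarrow> int \<Rightarrow> (nat \<Rightarrow> nat) \<Rightarrow> bool list"
  where
  "grid_out t p K f w h \<rho> = concat (map (\<lambda>k. concat (map (\<lambda>a. concat (map (\<lambda>b.
     f k w h (\<rho>(t := a, p := b))) [0..<\<rho> 3])) [0..<\<rho> 3])) [0..<K])"

lemma emits_grid:
  assumes c: "\<And>k. k < K \<Longrightarrow> emits Z' (c k) (f k)"
    and Z: "Z' \<union> {0, t, p, mt, mp} \<subseteq> Z" "Z' \<inter> {t, p, mt, mp} = {}"
    and distinct: "distinct [0, 3, mt, mp, t, p]"
    and insens: "\<And>k w h \<rho> m x. m \<in> {mt, mp} \<Longrightarrow> f k w h (\<rho>(m := x)) = f k w h \<rho>"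
  shows "emits Z (grid t p mt mp K c) (grid_out t p K f)"
proof -
  have "emits Z (for_loop 0 mt 3 t (for_loop 0 mp 3 p (c k))) (\<lambda>w h \<rho>.
      concat (map (\<lambda>a. concat (map (\<lambda>b. f k w h (\<rho>(t := a, p := b))) [0..<\<rho> 3])) [0..<\<rho> 3]))"
    if k: "k < K" for k
  proof -
    have "emits (insert p (insert mp (insert 0 Z'))) (for_loop 0 mp 3 p (c k)) (\<lambda>w h \<rho>.
        concat (map (\<lambda>b. f k w h (\<rho>(p := b))) [0..<\<rho> 3]))"
      by (rule emits_for_loop[OF c[OF k]]) (use Z(2) distinct insens in auto)
    then have "emits Z (for_loop 0 mt 3 t (for_loop 0 mp 3 p (c k))) (\<lambda>w h \<rho>. concat (map (\<lambda>a.
        concat (map (\<lambda>b. f k w h (\<rho>(t := a, p := b))) [0..<(\<rho>(t := a)) 3])) [0..<\<rho> 3]))"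
      by (rule emits_for_loop) (use Z distinct insens[of mt] in \<open>auto simp: fun_upd_twist[of mt p]\<close>)
    then show ?thesis using distinct by simp
  qed
  then show ?thesis
    unfolding grid_def grid_out_def
    by (intro emits_list[where f = "\<lambda>k w h \<rho>. concat (map (\<lambda>a. concat (map (\<lambda>b.
      f k w h (\<rho>(t := a, p := b))) [0..<\<rho> 3])) [0..<\<rho> 3])"]) auto
qed

text \<open>
  Registers 1, 2 and 3 hold H, the column E = H + L in which the certificate must have ended, and
  the number B = 2 H + 1 of columns.
\<close>

definition FalseC :: cond where
  "FalseC = AndC (IsZ 1) (NotC (IsZ 1))"

definition EqC :: "nat \<Rightarrow> nat \<Rightarrow> cond" where
  "EqC r s = AndC (NotC (Less r s)) (NotC (Less s r))"

definition OrC :: "cond \<Rightarrow> cond \<Rightarrow> cond" where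
  "OrC b c = NotC (AndC (NotC b) (NotC c))"

lemma ceval_FalseC [simp]: "\<not> ceval FalseC w h \<rho>"
  and ceval_EqC [simp]: "ceval (EqC r s) w h \<rho> \<longleftrightarrow> \<rho> r = \<rho> s"
  and ceval_OrC [simp]: "ceval (OrC b c) w h \<rho> \<longleftrightarrow> ceval b w h \<rho> \<or> ceval c w h \<rho>"
  by (auto simp: FalseC_def EqC_def OrC_def)

lemma wf_FalseC [simp]: "wf_cond u FalseC"
  and wf_EqC [simp]: "wf_cond u (EqC r s) \<longleftrightarrow> distinct [r, s, u]"
  and wf_OrC [simp]: "wf_cond u (OrC b c) \<longleftrightarrow> wf_cond u b \<and> wf_cond u c"
  by (auto simp: FalseC_def EqC_def OrC_def)

lemma cregs_simps [simp]:
  "cregs FalseC = {1}" "cregs (EqC r s) = {r, s}" "cregs (OrC b c) = cregs b \<union> cregs c"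
  by (auto simp: FalseC_def EqC_def OrC_def)

fun shift :: "nat \<Rightarrow> nat \<Rightarrow> cond \<Rightarrow> cond" where
  "shift 0 r b = b"
| "shift (Suc n) r b = Shift r (shift n r b)"

lemma ceval_shift [simp]: "ceval (shift n r b) w h \<rho> \<longleftrightarrow> ceval b w h (\<rho>(r := \<rho> r + n))"
  by (induction n arbitrary: \<rho>) auto

lemma wf_shift [simp]: "wf_cond u b \<Longrightarrow> r \<noteq> u \<Longrightarrow> wf_cond u (shift n r b)"
  by (induction n) auto

lemma cregs_shift: "cregs (shift n r b) \<subseteq> insert r (cregs b)"
  by (induction n) auto

text \<open>The numerals 1 and 2 are the registers of \<open>H\<close> and \<open>E\<close>. Offsets
  are added by \<open>Shift\<close>, on either side of a comparison. \<open>InSym p a\<close>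
  presupposes the input head on cell \<open>-H\<close>, the origin of the columns.\<close>

fun guard_cond :: "guard \<Rightarrow> nat \<Rightarrow> nat \<Rightarrow> cond" where
  "guard_cond GTrue t p = NotC FalseC"
| "guard_cond GInit t p = IsZ t"
| "guard_cond (GSym a) t p = AndC (IsZ t) (InSym p a)"
| "guard_cond GLeft t p = AndC (IsZ t) (Less p 1)"
| "guard_cond GRight t p = AndC (IsZ t) (NotC (Less p 1))"
| "guard_cond GEnd t p = AndC (IsZ t) (EqC p 2)"
| "guard_cond (GNe e) t p = NotC (Shift 1 (shift e p (EqC p 1)))"
| "guard_cond GFinal t p = Shift t (EqC t 1)"

text \<open>Expresses \<open>locate\<close> without subtraction, as \<open>p' + 1 = p + e\<close> or
  \<open>p' + 1 = H + e\<close>; for positive \<open>p\<close> and \<open>H\<close> this agrees with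
  the truncated form.\<close>

fun loc_cond :: "loc \<Rightarrow> nat \<Rightarrow> nat \<Rightarrow> cond" where
  "loc_cond (Rel e) p p' = Shift p' (shift e p (EqC p' p))"
| "loc_cond (Cen e) p p' = Shift p' (shift e 1 (EqC p' 1))"

definition active_cond :: "guard \<Rightarrow> nat \<Rightarrow> nat \<Rightarrow> cond" where
  "active_cond g t p = AndC (Shift t (Less t 3)) (AndC (NotC (IsZ p)) (AndC (Shift p (Less p 3)) (guard_cond g t p)))"

text \<open>\<open>j\<close> and \<open>k\<close> are constants of the program text, so signs and
  kinds are compared while the condition is built. What is left to run time are times, positions and
  input symbols.\<close>

definition occurs_cond :: "tm \<Rightarrow> nat \<Rightarrow> nat \<Rightarrow> nat \<Rightarrow> nat \<Rightarrow> nat \<Rightarrow> nat \<Rightarrow> cond" where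
  "occurs_cond M j k t p t' p' = (let Kv = length (kinds M); (g, ls) = clauses M ! j in
     OrC (NotC (active_cond g t p))
       (foldr OrC (map (\<lambda>(s, v, dt, l). if s = (k < Kv) \<and> v = kinds M ! (k mod Kv)
          then AndC (shift dt t (EqC t' t)) (loc_cond l p p') else FalseC) ls) FalseC))"

lemma ceval_foldr_OrC: "ceval (foldr OrC bs FalseC) w h \<rho> \<longleftrightarrow> (\<exists>b\<in>set bs. ceval b w h \<rho>)"
  by (induction bs) auto

lemma wf_foldr_OrC: "wf_cond u (foldr OrC bs FalseC) \<longleftrightarrow> (\<forall>b\<in>set bs. wf_cond u b)"
  by (induction bs) auto

lemma cregs_foldr_OrC: "cregs (foldr OrC bs FalseC) = insert 1 (\<Union>b\<in>set bs. cregs b)"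
  by (induction bs) auto

lemma ceval_guard_cond:
  assumes "distinct [1, 2, 3, t, p]"
  shows "ceval (guard_cond g t p) w (- int (\<rho> 1)) \<rho> \<longleftrightarrow> gsem g w (\<rho> 1) (\<rho> 2) (\<rho> t) (\<rho> p)"
  using assms by (cases g) auto

lemma ceval_active_cond:
  assumes "distinct [1, 2, 3, t, p]" "\<rho> 3 = 2 * \<rho> 1 + 1"
  shows "ceval (active_cond g t p) w (- int (\<rho> 1)) \<rho> \<longleftrightarrow> active g w (\<rho> 1) (\<rho> 2) (\<rho> t) (\<rho> p)"
  using assms ceval_guard_cond[OF assms(1)] by (auto simp: active_cond_def active_def)

lemma ceval_loc_cond:
  assumes "distinct [1, p, p']" "0 < \<rho> 1" "0 < \<rho> p"
  shows "ceval (loc_cond l p p') w h \<rho> \<longleftrightarrow> \<rho> p' = locate (\<rho> 1) (\<rho> p) l"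
  using assms by (cases l) auto

lemma ceval_occurs_cond:
  assumes regs: "distinct [1, 2, 3, t, p, t', p']"
    and \<rho>: "0 < \<rho> 1" "\<rho> 3 = 2 * \<rho> 1 + 1" "\<rho> t < \<rho> 3" "\<rho> p < \<rho> 3" "\<rho> t' < \<rho> 3" "\<rho> p' < \<rho> 3"
  shows "ceval (occurs_cond M j k t p t' p') w (- int (\<rho> 1)) \<rho> \<longleftrightarrow>
    occurs M w (\<rho> 1) (\<rho> 2) (enc (\<rho> 3) j (\<rho> t) (\<rho> p)) (enc (\<rho> 3) k (\<rho> t') (\<rho> p'))"
proof -
  obtain g ls where gls: "clauses M ! j = (g, ls)" by fastforce
  have lit: "ceval (case a of (s, v, dt, l) \<Rightarrow> if s = (k < length (kinds M)) \<and> v = kinds M ! (k mod length (kinds M))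
        then AndC (shift dt t (EqC t' t)) (loc_cond l p p') else FalseC) w h \<rho> \<longleftrightarrow>
      (case a of (s, v, dt, l) \<Rightarrow> s = (k < length (kinds M)) \<and> v = kinds M ! (k mod length (kinds M)) \<and>
         \<rho> t' = \<rho> t + dt \<and> \<rho> p' = locate (\<rho> 1) (\<rho> p) l)" if "0 < \<rho> p" for a h
    using regs \<rho> ceval_loc_cond[of p p' \<rho> _ w h] that by (cases a) auto
  have act: "ceval (active_cond g t p) w (- int (\<rho> 1)) \<rho> \<longleftrightarrow> active g w (\<rho> 1) (\<rho> 2) (\<rho> t) (\<rho> p)"
    using regs \<rho> by (intro ceval_active_cond) auto
  have "occurs M w (\<rho> 1) (\<rho> 2) (enc (\<rho> 3) j (\<rho> t) (\<rho> p)) (enc (\<rho> 3) k (\<rho> t') (\<rho> p')) \<longleftrightarrow>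
      (active g w (\<rho> 1) (\<rho> 2) (\<rho> t) (\<rho> p) \<longrightarrow> (\<exists>(s, v, dt, l)\<in>set ls. s = (k < length (kinds M)) \<and>
         v = kinds M ! (k mod length (kinds M)) \<and> \<rho> t' = \<rho> t + dt \<and> \<rho> p' = locate (\<rho> 1) (\<rho> p) l))"
    unfolding occurs_def \<rho>(2)[symmetric] Let_def enc_div[OF \<rho>(3,4)] enc_div[OF \<rho>(5,6)] gls prod.case ..
  moreover have "active g w (\<rho> 1) (\<rho> 2) (\<rho> t) (\<rho> p) \<Longrightarrow> 0 < \<rho> p" by (simp add: active_def)
  ultimately show ?thesis
    unfolding occurs_cond_def Let_def gls prod.case ceval_OrC ceval.simps act ceval_foldr_OrC
    by (cases "active g w (\<rho> 1) (\<rho> 2) (\<rho> t) (\<rho> p)") (simp_all add: lit)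
qed

lemma wf_occurs_cond:
  assumes "distinct [0, 1, 2, 3, t, p, t', p']"
  shows "wf_cond 0 (occurs_cond M j k t p t' p')"
proof -
  have "wf_cond 0 (guard_cond g t p)" for g using assms by (cases g) auto
  moreover have "wf_cond 0 (loc_cond l p p')" for l using assms by (cases l) auto
  ultimately show ?thesis
    using assms by (auto simp: occurs_cond_def Let_def wf_foldr_OrC active_cond_def split: prod.splits)
qed

lemma cregs_occurs_cond: "cregs (occurs_cond M j k t p t' p') \<subseteq> {1, 2, 3, t, p, t', p'}"
proof -
  have "cregs (guard_cond g t p) \<subseteq> {1, 2, 3, t, p, t', p'}" for g
    using cregs_shift by (cases g) (fastforce)+
  moreover have "cregs (loc_cond l p p') \<subseteq> {1, 2, 3, t, p, t', p'}" for l
    using cregs_shift by (cases l) (fastforce)+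
  moreover have "cregs (shift dt t (EqC t' t)) \<subseteq> {1, 2, 3, t, p, t', p'}" for dt
    using cregs_shift[of dt t "EqC t' t"] by auto
  ultimately show ?thesis
    by (auto simp: occurs_cond_def Let_def cregs_foldr_OrC active_cond_def split: prod.splits if_splits; blast)
qed

text \<open>Registers 4, 5 and 6, 7 hold the time and position of the two vertices.\<close>

definition same_cond :: cond where
  "same_cond = AndC (EqC 4 6) (EqC 5 7)"

text \<open>Kinds below \<open>2 * Kv\<close> are literals, those from there to
  \<open>3 * Kv\<close> variables, and the rest clauses. The clause may be the row or the column of
  the matrix, hence the two calls with the register pairs exchanged.\<close>

definition adj_cond :: "tm \<Rightarrow> nat \<Rightarrow> nat \<Rightarrow> cond" where
  "adj_cond M k k' = (let Kv = length (kinds M) in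
     if k < 2 * Kv \<and> k' < 2 * Kv then if k = k' then NotC same_cond else NotC FalseC
     else if k < 2 * Kv \<and> k' < 3 * Kv \<or> k' < 2 * Kv \<and> k < 3 * Kv
       then if k mod Kv = k' mod Kv then same_cond else FalseC
     else if k < 2 * Kv then occurs_cond M (k' - 3 * Kv) k 6 7 4 5
     else if k' < 2 * Kv then occurs_cond M (k - 3 * Kv) k' 4 5 6 7
     else FalseC)"

lemma wf_adj_cond: "wf_cond 0 (adj_cond M k k')"
  by (simp add: adj_cond_def Let_def same_cond_def wf_occurs_cond)

lemma cregs_adj_cond: "cregs (adj_cond M k k') \<subseteq> {1, 2, 3, 4, 5, 6, 7}"
  using cregs_occurs_cond[of M "k' - 3 * length (kinds M)" k 6 7 4 5]
    cregs_occurs_cond[of M "k - 3 * length (kinds M)" k' 4 5 6 7]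
  by (auto simp: adj_cond_def Let_def same_cond_def)

lemma ceval_adj_cond:
  assumes \<rho>: "0 < \<rho> 1" "\<rho> 3 = 2 * \<rho> 1 + 1" "\<rho> 4 < \<rho> 3" "\<rho> 5 < \<rho> 3" "\<rho> 6 < \<rho> 3" "\<rho> 7 < \<rho> 3"
    and k: "k < 3 * length (kinds M) + length (clauses M)" "k' < 3 * length (kinds M) + length (clauses M)"
    and pos: "0 < length (kinds M)"
  shows "ceval (adj_cond M k k') w (- int (\<rho> 1)) \<rho> \<longleftrightarrow>
    (enc (\<rho> 3) k (\<rho> 4) (\<rho> 5), enc (\<rho> 3) k' (\<rho> 6) (\<rho> 7)) \<in>
      parcs (sat_graph (length (kinds M) * \<rho> 3 * \<rho> 3) (length (clauses M) * \<rho> 3 * \<rho> 3)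
        (occurs M w (\<rho> 1) (\<rho> 2)))"
proof -
  define Kv where "Kv = length (kinds M)"
  define N where "N = Kv * \<rho> 3 * \<rho> 3"
  let ?i = "enc (\<rho> 3) k (\<rho> 4) (\<rho> 5)" and ?j = "enc (\<rho> 3) k' (\<rho> 6) (\<rho> 7)"
  let ?occ = "occurs M w (\<rho> 1) (\<rho> 2)"
  note a = \<rho>(3,4) and b = \<rho>(5,6)
  have n: "3 * N + length (clauses M) * \<rho> 3 * \<rho> 3 = (3 * Kv + length (clauses M)) * \<rho> 3 * \<rho> 3"
    by (simp add: N_def algebra_simps)
  have V: "?i < 3 * N + length (clauses M) * \<rho> 3 * \<rho> 3" "?j < 3 * N + length (clauses M) * \<rho> 3 * \<rho> 3"
    unfolding n enc_less[OF a] enc_less[OF b] Kv_def using k by auto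
  have m: "c * N = (c * Kv) * \<rho> 3 * \<rho> 3" for c by (simp add: N_def)
  \<comment> \<open>Multiples of \<open>N\<close> are block boundaries, so comparing a vertex with
    them compares its kind.\<close>
  have less: "?i < c * N \<longleftrightarrow> k < c * Kv" "?j < c * N \<longleftrightarrow> k' < c * Kv" for c
    unfolding m enc_less[OF a] enc_less[OF b] by auto
  have eq: "?i = ?j \<longleftrightarrow> k = k' \<and> \<rho> 4 = \<rho> 6 \<and> \<rho> 5 = \<rho> 7" by (rule enc_inject[OF a b])
  have mod: "?i mod N = ?j mod N \<longleftrightarrow> k mod Kv = k' mod Kv \<and> \<rho> 4 = \<rho> 6 \<and> \<rho> 5 = \<rho> 7"
    unfolding N_def enc_mod[OF a pos[folded Kv_def]] enc_mod[OF b pos[folded Kv_def]]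
    by (rule enc_inject[OF a b])
  have sub: "enc (\<rho> 3) c t p - 3 * N = enc (\<rho> 3) (c - 3 * Kv) t p" if "3 * Kv \<le> c" for c t p
    using enc_add[of "\<rho> 3" "3 * Kv" "c - 3 * Kv" t p] that by (simp add: m)
  have "(?i, ?j) \<in> parcs (sat_graph N (length (clauses M) * \<rho> 3 * \<rho> 3) ?occ) \<longleftrightarrow>
      sat_arc N ?occ ?i ?j \<or> sat_arc N ?occ ?j ?i"
    using V by (simp add: sat_graph_def)
  moreover have "sat_arc N ?occ ?i ?j \<longleftrightarrow> k < 2 * Kv \<and> (k' < 2 * Kv \<and> ?i \<noteq> ?j \<or>
      2 * Kv \<le> k' \<and> k' < 3 * Kv \<and> k mod Kv = k' mod Kv \<and> \<rho> 4 = \<rho> 6 \<and> \<rho> 5 = \<rho> 7 \<or>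
      3 * Kv \<le> k' \<and> ?occ (enc (\<rho> 3) (k' - 3 * Kv) (\<rho> 6) (\<rho> 7)) ?i)"
    unfolding sat_arc_def less mod not_less[symmetric] using sub[of k' "\<rho> 6" "\<rho> 7"] by (cases "3 * Kv \<le> k'") (auto simp: not_less)
  moreover have "sat_arc N ?occ ?j ?i \<longleftrightarrow> k' < 2 * Kv \<and> (k < 2 * Kv \<and> ?i \<noteq> ?j \<or>
      2 * Kv \<le> k \<and> k < 3 * Kv \<and> k mod Kv = k' mod Kv \<and> \<rho> 4 = \<rho> 6 \<and> \<rho> 5 = \<rho> 7 \<or>
      3 * Kv \<le> k \<and> ?occ (enc (\<rho> 3) (k - 3 * Kv) (\<rho> 4) (\<rho> 5)) ?j)"
    unfolding sat_arc_def less mod[symmetric] not_less[symmetric] using sub[of k "\<rho> 4" "\<rho> 5"] by (cases "3 * Kv \<le> k") (auto simp: not_less)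
  moreover have "ceval (occurs_cond M j k 6 7 4 5) w (- int (\<rho> 1)) \<rho> \<longleftrightarrow> ?occ (enc (\<rho> 3) j (\<rho> 6) (\<rho> 7)) ?i"
    "ceval (occurs_cond M j k' 4 5 6 7) w (- int (\<rho> 1)) \<rho> \<longleftrightarrow> ?occ (enc (\<rho> 3) j (\<rho> 4) (\<rho> 5)) ?j" for j
    by (rule ceval_occurs_cond; use \<rho> in simp)+
  ultimately show ?thesis
    unfolding adj_cond_def Let_def Kv_def[symmetric] N_def[symmetric] eq
    by (auto simp: same_cond_def)
qed

section \<open>The reduction\<close>

text \<open>The bound is the trivial lower bound for \<open>3 * N + C\<close> vertices and budget
  \<open>N\<close>.\<close>

definition tableau_instance :: "tm \<Rightarrow> bool list \<Rightarrow> nat \<Rightarrow> nat \<Rightarrow> dmp_instance" where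
  "tableau_instance M x H E = (let B = 2 * H + 1; N = length (kinds M) * B * B; C = length (clauses M) * B * B
     in \<lparr>graph = sat_graph N C (occurs M x H E), delays = \<lambda>_. 1, budget = N,
         bound = of_nat ((2 * N + C) * (3 * N + C - 1))\<rparr>)"

lemma enc_rat_of_nat: "enc_rat (of_nat n) = False # enc_nat n @ enc_nat 1"
  using quotient_of_int[of "int n"] by (simp add: enc_rat_def)

lemma map_eq_concat: "map P xs = concat (map (\<lambda>x. [P x]) xs)"
  by (induction xs) auto

text \<open>\<open>[:a, 4 * a, 4 * a:]\<close> at \<open>H\<close> is
  \<open>a * (2 * H + 1)^2\<close>, the number of vertices of \<open>a\<close> kinds; with constant
  term \<open>V - 1\<close> it is the order of the graph minus 1. \<open>[False]\<close> and the
  last \<open>enc_nat 1\<close> are sign and denominator of the bound.\<close>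

definition instance_out :: "tm \<Rightarrow> bool list \<Rightarrow> int \<Rightarrow> (nat \<Rightarrow> nat) \<Rightarrow> bool list" where
  "instance_out M w h \<rho> = (let Kv = length (kinds M); V = 3 * Kv + length (clauses M) in
     enc_nat (poly [:V, 4 * V, 4 * V:] (\<rho> 1)) @
     grid_out 4 5 V (\<lambda>k. grid_out 6 7 V (\<lambda>k' w h \<rho>. if ceval (adj_cond M k k') w h \<rho> then [True] else [False])) w h \<rho> @
     grid_out 4 5 V (\<lambda>_ _ _ _. enc_rat 1) w h \<rho> @
     enc_nat (poly [:Kv, 4 * Kv, 4 * Kv:] (\<rho> 1)) @
     [False] @ enc_nat (poly ([:V - Kv, 4 * (V - Kv), 4 * (V - Kv):] * [:V - 1, 4 * V, 4 * V:]) (\<rho> 1)) @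
     enc_nat 1)"

text \<open>Registers 4 to 7 are the coordinates of the two vertices and 8 to 11 the countdowns of
  their loops. Register 0 is the scratch register of tests and copies, and 12 to 14 serve to compute
  and print numbers.\<close>

lemma emits_instance: "\<exists>c. emits (- {1, 2, 3}) c (instance_out M)"
proof -
  define Kv where "Kv = length (kinds M)"
  define V where "V = 3 * Kv + length (clauses M)"
  let ?Z = "- {1, 2, 3 :: nat}"
  let ?cell = "\<lambda>k k' w h \<rho>. if ceval (adj_cond M k k') w h \<rho> then [True] else [False]"
  have num: "\<exists>c. emits ?Z c (\<lambda>w h \<rho>. enc_nat (poly p (\<rho> 1)))" for p :: "nat poly"
    by (rule emits_enc_nat[of 0 12 13 1 14]) auto
  have const: "\<exists>c. emits Z c (\<lambda>w h \<rho>. bs)" for Z bs by (rule emits_const)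
  have insens: "ceval (adj_cond M k k') w h (\<rho>(m := a)) = ceval (adj_cond M k k') w h \<rho>"
    if "m \<notin> {1, 2, 3, 4, 5, 6, 7}" for k k' w h \<rho> m a
    using that cregs_adj_cond[of M k k'] by (intro ceval_cong) auto
  have cell: "emits {0} (branch 0 (adj_cond M k k') (Out True) (Out False)) (?cell k k')" for k k'
    by (intro emits_branch wf_adj_cond emits_Out) auto
  have row: "emits {0, 6, 7, 10, 11} (grid 6 7 10 11 V (\<lambda>k'. branch 0 (adj_cond M k k') (Out True) (Out False)))
      (grid_out 6 7 V (?cell k))" for k
    by (rule emits_grid[OF cell]) (auto simp: insens)
  have "emits ?Z (grid 4 5 8 9 V (\<lambda>k. grid 6 7 10 11 V
        (\<lambda>k'. branch 0 (adj_cond M k k') (Out True) (Out False)))) (grid_out 4 5 V (\<lambda>k. grid_out 6 7 V (?cell k)))"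
    by (rule emits_grid[OF row]) (auto simp: grid_out_def insens fun_upd_twist[of 8] fun_upd_twist[of 9])
  then have matrix: "\<exists>c. emits ?Z c (grid_out 4 5 V (\<lambda>k. grid_out 6 7 V (?cell k)))" by blast
  obtain c1 where c1: "emits {} c1 (\<lambda>w h \<rho>. enc_rat 1)" using const by blast
  have "emits ?Z (grid 4 5 8 9 V (\<lambda>_. c1)) (grid_out 4 5 V (\<lambda>_ _ _ _. enc_rat 1))"
    by (rule emits_grid[OF c1]) auto
  then have delays: "\<exists>c. emits ?Z c (grid_out 4 5 V (\<lambda>_ _ _ _. enc_rat 1))" by blast
  have seq: "\<exists>c. emits ?Z c (\<lambda>w h \<rho>. f w h \<rho> @ g w h \<rho>)"
    if "\<exists>c. emits ?Z c f" "\<exists>c. emits ?Z c g" for f g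
    using that emits_Seq by blast
  show ?thesis
    unfolding instance_out_def Let_def Kv_def[symmetric] V_def[symmetric]
    by (intro seq num const matrix delays)
qed

lemma instance_out:
  assumes "0 < H" "0 < length (kinds M)"
  shows "instance_out M x (- int H) ((\<lambda>_. 0)(1 := H, 2 := E, 3 := 2 * H + 1)) =
    enc_instance (tableau_instance M x H E)"
proof -
  define Kv Kc B where "Kv = length (kinds M)" and "Kc = length (clauses M)" and "B = 2 * H + 1"
  define V where "V = 3 * Kv + Kc"
  define \<rho> where "\<rho> = (\<lambda>_ :: nat. 0 :: nat)(1 := H, 2 := E, 3 := B)"
  define N C where "N = Kv * B * B" and "C = Kc * B * B"
  define P where "P = parcs (sat_graph N C (occurs M x H E))"
  have n: "3 * N + C = V * B * B" by (simp add: N_def C_def V_def algebra_simps)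
  have sq: "poly [:a, 4 * a, 4 * a:] H = a * B * B" for a
    by (simp add: B_def algebra_simps)
  have V: "0 < V" "Kv \<le> V" using assms(2) by (auto simp: V_def Kv_def)
  have sq': "poly [:V - 1, 4 * V, 4 * V:] H = V * B * B - 1"
    using sq[of V] V by simp
  have X: "(2 * N + C) * (3 * N + C - 1) =
      poly ([:V - Kv, 4 * (V - Kv), 4 * (V - Kv):] * [:V - 1, 4 * V, 4 * V:]) H"
  proof -
    have "2 * N + C = (V - Kv) * B * B" by (simp add: N_def C_def V_def algebra_simps)
    then show ?thesis unfolding poly_mult sq sq' n by simp
  qed
  have cell: "(if ceval (adj_cond M k k') x (- int H) (\<rho>(4 := a, 5 := b, 6 := a', 7 := b')) then [True] else [False]) =
      [(enc B k a b, enc B k' a' b') \<in> P]"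
    if "k < V" "k' < V" "a < B" "b < B" "a' < B" "b' < B" for k k' a b a' b'
  proof -
    let ?\<rho> = "\<rho>(4 := a, 5 := b, 6 := a', 7 := b')"
    have r: "?\<rho> 1 = H" "?\<rho> 2 = E" "?\<rho> 3 = B" "?\<rho> 4 = a" "?\<rho> 5 = b" "?\<rho> 6 = a'" "?\<rho> 7 = b'"
      by (auto simp: \<rho>_def)
    have "ceval (adj_cond M k k') x (- int (?\<rho> 1)) ?\<rho> \<longleftrightarrow> (enc B k a b, enc B k' a' b') \<in> P"
      using ceval_adj_cond[of ?\<rho> k M k' x, unfolded r] that assms
      unfolding r P_def N_def C_def V_def Kv_def Kc_def by (simp add: B_def)
    then show ?thesis unfolding r by simp
  qed
  have "grid_out 4 5 V (\<lambda>k. grid_out 6 7 V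
      (\<lambda>k' w h \<rho>. if ceval (adj_cond M k k') w h \<rho> then [True] else [False])) x (- int H) \<rho> =
    concat (map (\<lambda>k. concat (map (\<lambda>a. concat (map (\<lambda>b. concat (map (\<lambda>k'. concat (map (\<lambda>a'. concat (map (\<lambda>b'.
      [(enc B k a b, enc B k' a' b') \<in> P]) [0..<B])) [0..<B])) [0..<V])) [0..<B])) [0..<B])) [0..<V])"
  proof -
    have B3: "\<rho> 3 = B" by (simp add: \<rho>_def)
    have "concat (map (\<lambda>b'. if ceval (adj_cond M k k') x (- int H) (\<rho>(4 := a, 5 := b, 6 := a', 7 := b'))
          then [True] else [False]) [0..<B]) = map (\<lambda>b'. (enc B k a b, enc B k' a' b') \<in> P) [0..<B]"
      if "k < V" "k' < V" "a < B" "b < B" "a' < B" for k k' a b a'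
      unfolding map_eq_concat[where P = "\<lambda>b'. (enc B k a b, enc B k' a' b') \<in> P"]
      by (rule arg_cong[where f = concat], rule map_cong[OF refl], rule cell) (use that in auto)
    then show ?thesis
      unfolding grid_out_def by (auto simp: B3 intro!: arg_cong[where f = concat] map_cong)
  qed
  \<comment> \<open>The six loops over kinds, times and positions flatten to two loops over vertex
    numbers.\<close>
  also have "\<dots> = concat (map (\<lambda>i. map (\<lambda>j. (i, j) \<in> P) [0..<V * B * B]) [0..<V * B * B])"
    unfolding map_eq_concat[where P = "\<lambda>j. (i, j) \<in> P" for i] concat_map_enc ..
  finally have matrix: "grid_out 4 5 V (\<lambda>k. grid_out 6 7 V
      (\<lambda>k' w h \<rho>. if ceval (adj_cond M k k') w h \<rho> then [True] else [False])) x (- int H) \<rho> =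
    concat (map (\<lambda>i. map (\<lambda>j. (i, j) \<in> P) [0..<V * B * B]) [0..<V * B * B])" .
  have delays: "grid_out 4 5 V (\<lambda>_ _ _ _. enc_rat 1) x (- int H) \<rho> =
      concat (map (\<lambda>v. enc_rat 1) [0..<V * B * B])"
    unfolding concat_map_enc grid_out_def by (simp add: \<rho>_def)
  have card: "card (pverts (sat_graph N C (occurs M x H E))) = V * B * B"
    by (simp add: sat_graph_def n)
  have \<rho>1: "\<rho> 1 = H" by (simp add: \<rho>_def)
  have I: "tableau_instance M x H E = \<lparr>graph = sat_graph N C (occurs M x H E), delays = \<lambda>_. 1, budget = N,
      bound = of_nat ((2 * N + C) * (3 * N + C - 1))\<rparr>"
    by (simp only: tableau_instance_def Let_def N_def C_def Kv_def Kc_def B_def)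
  have "instance_out M x (- int H) \<rho> = enc_instance (tableau_instance M x H E)"
    unfolding I enc_instance_def instance_out_def Let_def Kv_def[symmetric] Kc_def[symmetric] V_def[symmetric]
      dmp_instance.select_convs card enc_rat_of_nat X matrix delays \<rho>1 sq P_def[symmetric]
    by (simp add: N_def)
  then show ?thesis unfolding \<rho>_def B_def .
qed

context verifier
begin

lemma tableau_uniform:
  assumes "0 < H"
  shows "uniform_instance (tableau_instance M x H E)"
proof -
  let ?B = "2 * H + 1"
  have "network (sat_graph (Kv * ?B * ?B) (Kc * ?B * ?B) (occurs M x H E)) (\<lambda>_. 1)"
    using kinds_pos clauses_pos occurs_nonempty[OF assms refl refl]
    by (intro network_sat_graph) auto
  then show ?thesis
    unfolding uniform_instance_def valid_instance_def tableau_instance_def Let_def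
    by (auto simp: real_delays_def[abs_def] sat_graph_def)
qed

lemma tableau_yes_iff:
  assumes H: "0 < H"
  shows "yes_instance (tableau_instance M x H E) \<longleftrightarrow>
    (\<exists>\<alpha>. \<forall>c\<in>set (clauses M). clause_holds \<alpha> x H E c)"
proof -
  define B where "B = 2 * H + 1"
  define N C where "N = Kv * B * B" and "C = Kc * B * B"
  have pos: "0 < N" "0 < C" using kinds_pos clauses_pos by (auto simp: N_def C_def B_def)
  have occ: "\<exists>i<2 * N. occurs M x H E c i" if "c < C" for c
    using occurs_nonempty[OF H B_def N_def] that by (simp add: C_def)
  have I: "tableau_instance M x H E = \<lparr>graph = sat_graph N C (occurs M x H E), delays = \<lambda>_. 1, budget = N,
      bound = of_nat ((2 * N + C) * (3 * N + C - 1))\<rparr>"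
    by (simp only: tableau_instance_def Let_def N_def C_def B_def)
  have X: "of_rat (of_nat ((2 * N + C) * (3 * N + C - 1))) = (real (3 * N + C) - real N) * (real (3 * N + C) - 1)"
    unfolding of_rat_of_nat_eq using pos by (simp add: of_nat_diff Suc_leI)
  have fields: "graph (tableau_instance M x H E) = sat_graph N C (occurs M x H E)"
    "budget (tableau_instance M x H E) = N"
    "bound (tableau_instance M x H E) = of_nat ((2 * N + C) * (3 * N + C - 1))"
    "real_delays (tableau_instance M x H E) = (\<lambda>_. 1)"
    by (auto simp: I real_delays_def)
  have "yes_instance (tableau_instance M x H E) \<longleftrightarrow> dmp_decision (sat_graph N C (occurs M x H E)) (\<lambda>_. 1) N
      ((real (3 * N + C) - real N) * (real (3 * N + C) - 1))"
    using tableau_uniform[OF H, of x E]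
    unfolding yes_instance_def uniform_instance_def fields X by simp
  also have "\<dots> \<longleftrightarrow> (\<exists>\<alpha>. \<forall>c<C. \<exists>i<2 * N. occurs M x H E c i \<and> lit_true N \<alpha> i)"
  proof
    assume "dmp_decision (sat_graph N C (occurs M x H E)) (\<lambda>_. 1) N
      ((real (3 * N + C) - real N) * (real (3 * N + C) - 1))"
    from dmp_imp_satisfiable[OF pos occ this]
    show "\<exists>\<alpha>. \<forall>c<C. \<exists>i<2 * N. occurs M x H E c i \<and> lit_true N \<alpha> i" by blast
  next
    assume "\<exists>\<alpha>. \<forall>c<C. \<exists>i<2 * N. occurs M x H E c i \<and> lit_true N \<alpha> i"
    then obtain \<alpha> where \<alpha>: "\<And>c. c < C \<Longrightarrow> \<exists>i<2 * N. occurs M x H E c i \<and> lit_true N \<alpha> i" by blast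
    show "dmp_decision (sat_graph N C (occurs M x H E)) (\<lambda>_. 1) N
      ((real (3 * N + C) - real N) * (real (3 * N + C) - 1))"
      by (rule satisfiable_imp_dmp[OF pos]) (fact occ \<alpha>)+
  qed
  also have "\<dots> \<longleftrightarrow> (\<exists>\<alpha>. \<forall>c\<in>set (clauses M). clause_holds \<alpha> x H E c)"
    using model_iff[OF H B_def N_def] by (simp add: C_def)
  finally show ?thesis .
qed

lemma state_halted:
  assumes "state x y t = accept_state M \<or> state x y t = reject_state M" "t \<le> t'"
  shows "state x y t' = state x y t"
  using assms(2)
proof (induction t' rule: dec_induct)
  case (step t')
  then show ?case using assms(1) by (cases "run M [x, y] t'") (auto simp: state_def run_def)
qed simp

end

theorem NP_reduces_to_uniform_DMP:
  assumes "A \<in> NP"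
  shows "\<exists>f. poly_reduction f A DMP \<and> range f \<subseteq> uniform_model"
proof -
  obtain R and p :: "nat poly" where R: "polytime_decidable2 R"
    and A: "\<And>x. x \<in> A \<longleftrightarrow> (\<exists>y. length y \<le> poly p (length x) \<and> R x y)"
    using assms unfolding NP_def by blast
  obtain M and q :: "nat poly" where M: "wf_tm M" "2 \<le> num_tapes M"
    and run: "\<And>x y. fst (run M [x, y] (poly q (length x + length y))) =
      (if R x y then accept_state M else reject_state M)"
    using R unfolding polytime_decidable2_def by blast
  interpret verifier M by unfold_locales (rule M)+
  \<comment> \<open>\<open>H - 1\<close> must cover the verifier's time for every certificate of
    length up to \<open>L\<close>, whence \<open>q\<close> at the input length plus
    \<open>L\<close>; the summands \<open>p\<close> and 1 give \<open>L < H\<close>.\<close>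
  define h where "h = pcompose q ([:0, 1:] + p) + p + 1"
  let ?H = "\<lambda>x :: bool list. poly h (length x)" and ?L = "\<lambda>x :: bool list. poly p (length x)"
  define f where "f = (\<lambda>x. enc_instance (tableau_instance M x (?H x) (?H x + ?L x)))"
  have h: "poly h n = poly q (n + poly p n) + poly p n + 1" for n
    by (simp add: h_def poly_pcompose)
  obtain c where "emits (- {1, 2, 3}) c (instance_out M)" using emits_instance by blast
  moreover have "f = (\<lambda>x. instance_out M x (- int (?H x))
      ((\<lambda>_. 0)(1 := ?H x, 2 := poly (h + p) (length x), 3 := 2 * ?H x + 1)))"
    unfolding f_def poly_add by (rule ext, rule instance_out[symmetric]) (use kinds_pos in \<open>simp_all add: h\<close>)
  ultimately have poly: "polytime_computable f" using emits_polytime[of c "instance_out M" h p] by simp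
  have uniform: "uniform_instance (tableau_instance M x (?H x) (?H x + ?L x))" for x
    by (rule tableau_uniform) (simp add: h)
  have "x \<in> A \<longleftrightarrow> f x \<in> DMP" for x
  proof -
    have acc: "accept_state M \<noteq> reject_state M" using M(1) by (simp add: wf_tm_def)
    \<comment> \<open>By time \<open>H - 1\<close> the verifier has halted, so not rejecting means
      accepting.\<close>
    have R_iff: "R x y \<longleftrightarrow> state x y (?H x - 1) \<noteq> reject_state M" if "length y \<le> ?L x" for y
    proof -
      have "poly q (length x + length y) \<le> poly q (length x + ?L x)"
        using that by (intro poly_nat_mono) simp
      then have "poly q (length x + length y) \<le> ?H x - 1" by (simp add: h)
      from state_halted[OF _ this, of x y] show ?thesis
        using run[of x y] acc by (auto simp: state_def split: if_splits)
    qed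
    have "f x \<in> DMP \<longleftrightarrow> yes_instance (tableau_instance M x (?H x) (?H x + ?L x))"
      unfolding f_def using uniform[of x] by (intro enc_instance_in_DMP_iff) (simp add: uniform_instance_def)
    also have "\<dots> \<longleftrightarrow> (\<exists>\<alpha>. \<forall>c\<in>set (clauses M). clause_holds \<alpha> x (?H x) (?H x + ?L x) c)"
      by (rule tableau_yes_iff) (simp add: h)
    also have "\<dots> \<longleftrightarrow> (\<exists>y. length y \<le> ?L x \<and> state x y (?H x - 1) \<noteq> reject_state M)"
    proof
      assume "\<exists>\<alpha>. \<forall>c\<in>set (clauses M). clause_holds \<alpha> x (?H x) (?H x + ?L x) c"
      then obtain \<alpha> where "\<forall>c\<in>set (clauses M). clause_holds \<alpha> x (?H x) (?H x + ?L x) c" ..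
      from model_imp_accepting[OF this refl] show "\<exists>y. length y \<le> ?L x \<and> state x y (?H x - 1) \<noteq> reject_state M"
        by (metis h less_add_one linorder_not_less trans_le_add2 le_add2 not_less add.assoc)
    next
      assume "\<exists>y. length y \<le> ?L x \<and> state x y (?H x - 1) \<noteq> reject_state M"
      then show "\<exists>\<alpha>. \<forall>c\<in>set (clauses M). clause_holds \<alpha> x (?H x) (?H x + ?L x) c"
        using trace_clauses by blast
    qed
    also have "\<dots> \<longleftrightarrow> x \<in> A" using A R_iff by blast
    finally show ?thesis by blast
  qed
  moreover have "range f \<subseteq> uniform_model" using uniform by (auto simp: f_def uniform_model_def)
  ultimately show ?thesis using poly unfolding poly_reduction_def by blast
qed

theorem theorem1:
  shows "NP_hard_on uniform_model DMP \<and> NP_hard DMP"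
  unfolding NP_hard_on_def NP_hard_def using NP_reduces_to_uniform_DMP by blast

end
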